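(* Let $V$ be a unitary operator in $L^2(\Omega_2)$ and let $H_V$ be the self-adjoint extension of $\frac1i\frac{\partial}{\partial x_1}$ in $L^2((0,1)\times\Omega_2)$ associated with $V$, with boundary operator $U_V$, as described in the context. Then $H_V$ generates a unitary one-parameter group $\{U_V(t):t\in\mathbb{R}\}$ in $L^2((0,1)\times\Omega_2)$ which may be realized (up to unitary equivalence) in the Hilbert space $\mathcal{H}_V$ of measurable functions $f\colon\mathbb{R}\to L^2(\Omega_2)$ satisfying $$f(x_1+1)=U_V(f(x_1))\quad\text{for all }x_1\in\mathbb{R},$$ where the norm on $\mathcal{H}_V$ is defined by $$\|f\|_{\mathcal{H}_V}^2=\int_0^1\|f(x_1)\|_{L^2(\Omega_2)}^2\,dx_1 .$$ In this space the group $U_V(t)\colon\mathcal{H}_V\to\mathcal{H}_V$ is given by $$(U_V(t)f)(x_1)=f(x_1-t),\qquad x_1,t\in\mathbb{R}.$$ The unitary isomorphism of $\mathcal{H}_V$ onto $L^2((0,1)\times\Omega_2)=L^2((0,1),L^2(\Omega_2))$ is simply the restriction to $(0,1)$ in the $x_1$-variable. Finally, if $U_V(t)$ is computed in $L^2((0,1)\times\Omega_2)$, the formula is $$(U_V(t)f)(x_1,\cdot)=\begin{cases} f(x_1-t,\cdot)&\text{if }0\le t<x_1<1,\\ U_V\big(f(x_1-t,\cdot)\big)&\text{if }0<x_1\le t\le 1.\end{cases}$$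
   Context: $\Omega_2\subset\mathbb{R}^{d-1}$ is a subset of finite positive $(d-1)$-dimensional Lebesgue measure, and points of $(0,1)\times\Omega_2$ are written $(x_1,y)$. Let $\mathcal{D}$ be the space of $\varphi\in L^2((0,1)\times\Omega_2)$ with $\varphi(\cdot,y)\in C_c^\infty((0,1))$ for all $y\in\Omega_2$. For a unitary $V$ in $L^2(\Omega_2)$, $H_V$ is the self-adjoint extension of $\frac1i\frac{\partial}{\partial x_1}$ on $\mathcal{D}$ determined by the core domain $\mathcal{D}_V=\{\varphi+e^{x_1}h+e^{1-x_1}Vh:\varphi\in\mathcal{D},\,h\in L^2(\Omega_2)\}$ and $iH_V(\varphi+e^{x_1}h+e^{1-x_1}Vh)=\frac{\partial\varphi}{\partial x_1}+e^{x_1}h-e^{1-x_1}Vh$. Its boundary condition is interpreted as $f(1,\cdot)=U_V(f(0,\cdot))$, $f\in\mathcal{D}_V$, where the boundary operator $U_V$ on $L^2(\Omega_2)$ is given by $W_V=(eI+V)(I+eV)^{-1}$, $U_V=\exp W_V$ ($e$ the base of natural logarithms, $I$ the identity operator). The symbol $U_V$ without argument is this boundary operator; $U_V(t)$ is the one-parameter group. In the last formula, $x_1-t$ is read with translation modulo $\mathbb{Z}$ in the $x_1$-variable.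
   Formalization: The boundary operator is U_V = W_V = (eI+V)(I+eV)^{-1} instead of exp W_V; in the second case of the final formula U_V is replaced by its inverse; functions in D must also have ∂φ/∂x_1 in L^2. As printed the claim fails, e.g. for V = I. *)

theory Defs
  imports "HOL-Analysis.Analysis"
begin

section \<open>The complex Hilbert space of square-integrable functions on a Euclidean space\<close>

definition square_int :: "('a::euclidean_space \<Rightarrow> complex) \<Rightarrow> bool" where
  "square_int f \<longleftrightarrow>
     f \<in> borel_measurable lebesgue \<and> integrable lebesgue (\<lambda>x. (cmod (f x))\<^sup>2)"

definition L2_rel :: "('a::euclidean_space \<Rightarrow> complex) \<Rightarrow> ('a \<Rightarrow> complex) \<Rightarrow> bool" where
  "L2_rel f g \<longleftrightarrow> square_int f \<and> square_int g \<and> (AE x in lebesgue. f x = g x)"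

lemma square_int_zero [simp]: "square_int (\<lambda>x. 0)"
  by (simp add: square_int_def)

lemma square_int_scale:
  assumes "square_int f"
  shows "square_int (\<lambda>x. c * f x)"
  using assms by (auto simp: square_int_def norm_mult power_mult_distrib)

lemma square_int_add:
  assumes "square_int f" "square_int g"
  shows "square_int (\<lambda>x. f x + g x)"
proof -
  have m: "f \<in> borel_measurable lebesgue" "g \<in> borel_measurable lebesgue"
    and i: "integrable lebesgue (\<lambda>x. (cmod (f x))\<^sup>2)" "integrable lebesgue (\<lambda>x. (cmod (g x))\<^sup>2)"
    using assms by (auto simp: square_int_def)
  have "integrable lebesgue (\<lambda>x. (cmod (f x + g x))\<^sup>2)"
  proof (rule Bochner_Integration.integrable_bound)
    show "integrable lebesgue (\<lambda>x. 2 * (cmod (f x))\<^sup>2 + 2 * (cmod (g x))\<^sup>2)"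
      using i by auto
    show "(\<lambda>x. (cmod (f x + g x))\<^sup>2) \<in> borel_measurable lebesgue"
      using m by measurable
    have "(cmod (f x + g x))\<^sup>2 \<le> 2 * (cmod (f x))\<^sup>2 + 2 * (cmod (g x))\<^sup>2" for x
    proof -
      have "(cmod (f x + g x))\<^sup>2 \<le> (cmod (f x) + cmod (g x))\<^sup>2"
        by (intro power_mono norm_triangle_ineq) auto
      also have "\<dots> \<le> 2 * (cmod (f x))\<^sup>2 + 2 * (cmod (g x))\<^sup>2"
        using sum_squares_ge_zero[of "cmod (f x) - cmod (g x)" 0]
        by (simp add: power2_eq_square algebra_simps)
      finally show ?thesis .
    qed
    then show "AE x in lebesgue. norm ((cmod (f x + g x))\<^sup>2)
        \<le> norm (2 * (cmod (f x))\<^sup>2 + 2 * (cmod (g x))\<^sup>2)"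
      by auto
  qed
  then show ?thesis
    using m by (simp add: square_int_def)
qed

lemma integrable_square_int_mult:
  assumes "square_int f" "square_int g"
  shows "integrable lebesgue (\<lambda>x. f x * cnj (g x))"
proof -
  have m: "f \<in> borel_measurable lebesgue" "g \<in> borel_measurable lebesgue"
    and i: "integrable lebesgue (\<lambda>x. (cmod (f x))\<^sup>2)" "integrable lebesgue (\<lambda>x. (cmod (g x))\<^sup>2)"
    using assms by (auto simp: square_int_def)
  have mc: "(\<lambda>x. cnj (g x)) \<in> borel_measurable lebesgue"
    using m(2) by (intro borel_measurable_continuous_on[where f=cnj] continuous_intros)
  show ?thesis
  proof (rule Bochner_Integration.integrable_bound)
    show "integrable lebesgue (\<lambda>x. (cmod (f x))\<^sup>2 + (cmod (g x))\<^sup>2)"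
      using i by auto
    show "(\<lambda>x. f x * cnj (g x)) \<in> borel_measurable lebesgue"
      using m(1) mc by measurable
    have "cmod (f x) * cmod (g x) \<le> (cmod (f x))\<^sup>2 + (cmod (g x))\<^sup>2" for x
    proof -
      have "2 * (cmod (f x) * cmod (g x)) \<le> (cmod (f x))\<^sup>2 + (cmod (g x))\<^sup>2"
        using sum_squares_bound[of "cmod (f x)" "cmod (g x)"] by (simp add: mult.assoc)
      moreover have "0 \<le> cmod (f x) * cmod (g x)" by simp
      ultimately show ?thesis by linarith
    qed
    then show "AE x in lebesgue. norm (f x * cnj (g x)) \<le> norm ((cmod (f x))\<^sup>2 + (cmod (g x))\<^sup>2)"
      by (auto simp: norm_mult)
  qed
qed

quotient_type (overloaded) 'a L2 = "'a::euclidean_space \<Rightarrow> complex" / partial: L2_rel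
  morphisms fun_of_L2 L2_of
proof (rule part_equivpI)
  show "\<exists>f::'a \<Rightarrow> complex. L2_rel f f"
    by (rule exI[of _ "\<lambda>x. 0"]) (simp add: L2_rel_def)
  show "symp (L2_rel :: ('a \<Rightarrow> complex) \<Rightarrow> _)"
    by (auto simp: symp_def L2_rel_def elim: AE_mp)
  show "transp (L2_rel :: ('a \<Rightarrow> complex) \<Rightarrow> _)"
    by (auto simp: transp_def L2_rel_def elim: AE_mp)
qed

lift_definition scaleC :: "complex \<Rightarrow> 'a::euclidean_space L2 \<Rightarrow> 'a L2" (infixr "*\<^sub>C" 75)
  is "\<lambda>c f x. c * f x"
  by (auto simp: L2_rel_def intro: square_int_scale)

lift_definition cinner :: "'a::euclidean_space L2 \<Rightarrow> 'a L2 \<Rightarrow> complex"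
  is "\<lambda>f g. \<integral>x. f x * cnj (g x) \<partial>lebesgue"
proof -
  fix f1 f2 g1 g2 :: "'a \<Rightarrow> complex"
  assume a: "L2_rel f1 f2" "L2_rel g1 g2"
  show "(\<integral>x. f1 x * cnj (g1 x) \<partial>lebesgue) = (\<integral>x. f2 x * cnj (g2 x) \<partial>lebesgue)"
  proof (rule integral_cong_AE)
    show "(\<lambda>x. f1 x * cnj (g1 x)) \<in> borel_measurable lebesgue"
         "(\<lambda>x. f2 x * cnj (g2 x)) \<in> borel_measurable lebesgue"
      using a by (auto simp: L2_rel_def intro!: borel_measurable_integrable integrable_square_int_mult)
    have "AE x in lebesgue. f1 x = f2 x" "AE x in lebesgue. g1 x = g2 x"
      using a by (auto simp: L2_rel_def)
    then show "AE x in lebesgue. f1 x * cnj (g1 x) = f2 x * cnj (g2 x)"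
      by eventually_elim simp
  qed
qed

instantiation L2 :: (euclidean_space) real_inner
begin

lift_definition zero_L2 :: "'a L2" is "\<lambda>x. 0"
  by (simp add: L2_rel_def)

lift_definition plus_L2 :: "'a L2 \<Rightarrow> 'a L2 \<Rightarrow> 'a L2" is "\<lambda>f g x. f x + g x"
  by (auto simp: L2_rel_def intro: square_int_add)

definition scaleR_L2 :: "real \<Rightarrow> 'a L2 \<Rightarrow> 'a L2" where
  "scaleR_L2 r f = complex_of_real r *\<^sub>C f"

definition uminus_L2 :: "'a L2 \<Rightarrow> 'a L2" where
  "uminus_L2 f = (-1) *\<^sub>C f"

definition minus_L2 :: "'a L2 \<Rightarrow> 'a L2 \<Rightarrow> 'a L2" where
  "minus_L2 f g = f + - (g :: 'a L2)"

definition inner_L2 :: "'a L2 \<Rightarrow> 'a L2 \<Rightarrow> real" where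
  "inner_L2 f g = Re (cinner f g)"

definition norm_L2 :: "'a L2 \<Rightarrow> real" where
  "norm_L2 f = sqrt (f \<bullet> f)"

definition sgn_L2 :: "'a L2 \<Rightarrow> 'a L2" where
  "sgn_L2 f = inverse (norm f) *\<^sub>R f"

definition dist_L2 :: "'a L2 \<Rightarrow> 'a L2 \<Rightarrow> real" where
  "dist_L2 f g = norm (f - g)"

definition uniformity_L2 :: "('a L2 \<times> 'a L2) filter" where
  "uniformity_L2 = (INF e\<in>{0<..}. principal {(f, g). dist f g < e})"

definition open_L2 :: "'a L2 set \<Rightarrow> bool" where
  "open_L2 U \<longleftrightarrow> (\<forall>f\<in>U. eventually (\<lambda>(f', g). f' = f \<longrightarrow> g \<in> U) uniformity)"

instance
proof
  fix f g h :: "'a L2" and r s :: real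
  show "f + g + h = f + (g + h)"
    by transfer (auto simp: L2_rel_def algebra_simps intro: square_int_add)
  show "f + g = g + f"
    by transfer (auto simp: L2_rel_def algebra_simps intro: square_int_add)
  show "0 + f = f"
    by transfer (auto simp: L2_rel_def)
  show "- f + f = 0"
    unfolding uminus_L2_def
    by transfer (auto simp: L2_rel_def)
  show "f - g = f + - g"
    by (rule minus_L2_def)
  show "r *\<^sub>R (f + g) = r *\<^sub>R f + r *\<^sub>R g"
    unfolding scaleR_L2_def
    by transfer (auto simp: L2_rel_def distrib_left intro!: square_int_add square_int_scale)
  show "(r + s) *\<^sub>R f = r *\<^sub>R f + s *\<^sub>R f"
    unfolding scaleR_L2_def
    by transfer (auto simp: L2_rel_def distrib_right intro!: square_int_add square_int_scale)
  show "r *\<^sub>R s *\<^sub>R f = (r * s) *\<^sub>R f"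
    unfolding scaleR_L2_def
    by transfer (auto simp: L2_rel_def mult.assoc intro!: square_int_scale)
  show "1 *\<^sub>R f = f"
    unfolding scaleR_L2_def
    by transfer (auto simp: L2_rel_def)
  show "sgn f = inverse (norm f) *\<^sub>R f"
    by (rule sgn_L2_def)
  show "dist f g = norm (f - g)"
    by (rule dist_L2_def)
  show "uniformity = (INF e\<in>{0<..}. principal {(f, g :: 'a L2). dist f g < e})"
    by (rule uniformity_L2_def)
  show "open U = (\<forall>f\<in>U. eventually (\<lambda>(f', g). f' = f \<longrightarrow> g \<in> U) uniformity)" for U :: "'a L2 set"
    by (rule open_L2_def)
  have "cinner g f = cnj (cinner f g)"
    by transfer (subst Bochner_Integration.integral_cnj[symmetric], simp add: mult.commute)
  then show "f \<bullet> g = g \<bullet> f"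
    by (simp add: inner_L2_def)
  have "cinner (f + g) h = cinner f h + cinner g h"
    by transfer (simp add: L2_rel_def distrib_right integrable_square_int_mult)
  then show "(f + g) \<bullet> h = f \<bullet> h + g \<bullet> h"
    by (simp add: inner_L2_def)
  have "cinner (r *\<^sub>R f) g = complex_of_real r * cinner f g"
    unfolding scaleR_L2_def by transfer (simp add: mult.assoc)
  then show "r *\<^sub>R f \<bullet> g = r * (f \<bullet> g)"
    by (simp add: inner_L2_def)
  have eq: "Re (cinner k k) = (\<integral>x. (cmod (fun_of_L2 k x))\<^sup>2 \<partial>lebesgue)" for k :: "'a L2"
  proof -
    have "cinner k k = (\<integral>x. fun_of_L2 k x * cnj (fun_of_L2 k x) \<partial>lebesgue)"
      by (simp add: cinner.rep_eq)
    also have "\<dots> = (\<integral>x. complex_of_real ((cmod (fun_of_L2 k x))\<^sup>2) \<partial>lebesgue)"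
      by (simp only: complex_norm_square)
    also have "\<dots> = complex_of_real (\<integral>x. (cmod (fun_of_L2 k x))\<^sup>2 \<partial>lebesgue)"
      by (rule integral_complex_of_real)
    finally show ?thesis by simp
  qed
  show "0 \<le> f \<bullet> f"
    by (simp add: inner_L2_def eq)
  have sq: "square_int (fun_of_L2 f)"
    using Quotient3_rep_reflp[OF Quotient3_L2, of f] by (simp add: L2_rel_def)
  have "f \<bullet> f = 0 \<longleftrightarrow> (AE x in lebesgue. (cmod (fun_of_L2 f x))\<^sup>2 = 0)"
    unfolding inner_L2_def eq
    using sq by (subst integral_nonneg_eq_0_iff_AE) (auto simp: square_int_def)
  also have "\<dots> \<longleftrightarrow> L2_rel (fun_of_L2 f) (\<lambda>x. 0)"
    using sq by (simp add: L2_rel_def)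
  also have "\<dots> \<longleftrightarrow> L2_of (fun_of_L2 f) = L2_of (\<lambda>x. 0)"
    using Quotient3_rel[OF Quotient3_L2, of "fun_of_L2 f" "\<lambda>x. 0"] sq by (auto simp: L2_rel_def)
  also have "\<dots> \<longleftrightarrow> f = 0"
    using Quotient3_abs_rep[OF Quotient3_L2, of f] by (simp add: zero_L2.abs_eq zero_L2_def)
  finally show "(f \<bullet> f = 0) = (f = 0)" .
  show "norm f = sqrt (f \<bullet> f)"
    by (rule norm_L2_def)
qed

end

text \<open>\<open>L2_on S\<close> is the Hilbert space of square-integrable functions on \<open>S\<close>, realised as the
  closed subspace of those classes that vanish almost everywhere outside \<open>S\<close>.\<close>

definition L2_on :: "'a::euclidean_space set \<Rightarrow> 'a L2 set" where
  "L2_on S = {f. AE x in lebesgue. x \<notin> S \<longrightarrow> fun_of_L2 f x = 0}"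


section \<open>Operators and unitary groups\<close>

definition unitary_on :: "'a::euclidean_space L2 set \<Rightarrow> ('a L2 \<Rightarrow> 'a L2) \<Rightarrow> bool" where
  "unitary_on S V \<longleftrightarrow>
     V ` S = S \<and>
     (\<forall>f\<in>S. \<forall>g\<in>S. V (f + g) = V f + V g) \<and>
     (\<forall>c. \<forall>f\<in>S. V (c *\<^sub>C f) = c *\<^sub>C V f) \<and>
     (\<forall>f\<in>S. \<forall>g\<in>S. cinner (V f) (V g) = cinner f g)"

text \<open>Unbounded operators are represented by their graphs.\<close>

definition selfadjoint_on :: "'a::euclidean_space L2 set \<Rightarrow> ('a L2 \<times> 'a L2) set \<Rightarrow> bool" where
  "selfadjoint_on S H \<longleftrightarrow>
     S \<subseteq> closure (fst ` H) \<and>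
     H = {(f, g). f \<in> S \<and> g \<in> S \<and> (\<forall>(u, v)\<in>H. cinner v f = cinner u g)}"

definition unitary_group_on :: "'a::euclidean_space L2 set \<Rightarrow> (real \<Rightarrow> 'a L2 \<Rightarrow> 'a L2) \<Rightarrow> bool" where
  "unitary_group_on S U \<longleftrightarrow>
     (\<forall>t. unitary_on S (U t)) \<and>
     (\<forall>f\<in>S. U 0 f = f) \<and>
     (\<forall>s t. \<forall>f\<in>S. U (s + t) f = U s (U t f)) \<and>
     (\<forall>f\<in>S. continuous_on UNIV (\<lambda>t. U t f))"

text \<open>\<open>H\<close> generates \<open>U\<close> in the sense \<open>U t = exp (- i t H)\<close>, i.e. the infinitesimal generator of
  \<open>U\<close>, with its full domain, is \<open>- i H\<close>. This is the sign convention under which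
  \<open>H = (1/i) d/dx\<close> generates the translations \<open>f (x - t)\<close>.\<close>

definition generates_group_on ::
  "'a::euclidean_space L2 set \<Rightarrow> ('a L2 \<times> 'a L2) set \<Rightarrow> (real \<Rightarrow> 'a L2 \<Rightarrow> 'a L2) \<Rightarrow> bool" where
  "generates_group_on S H U \<longleftrightarrow>
     unitary_group_on S U \<and>
     H = {(f, g). f \<in> S \<and> ((\<lambda>t. (U t f - f) /\<^sub>R t) \<longlongrightarrow> (- \<i>) *\<^sub>C g) (at 0)}"


section \<open>The momentum operator on \<open>(0,1) \<times> \<Omega>\<close> and its extensions\<close>

text \<open>\<open>C\<^sub>c\<^sup>\<infinity>(0,1)\<close>, the functions being extended by \<open>0\<close> to the real line.\<close>

definition test_fun01 :: "(real \<Rightarrow> complex) \<Rightarrow> bool" where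
  "test_fun01 f \<longleftrightarrow>
     (\<exists>K. compact K \<and> K \<subseteq> {0<..<1} \<and> (\<forall>t. t \<notin> K \<longrightarrow> f t = 0)) \<and>
     (\<exists>D :: nat \<Rightarrow> real \<Rightarrow> complex.
        D 0 = f \<and> (\<forall>k t. (D k has_vector_derivative D (Suc k) t) (at t)))"

definition dx1 :: "(real \<times> 'a \<Rightarrow> complex) \<Rightarrow> real \<times> 'a \<Rightarrow> complex" where
  "dx1 \<phi> = (\<lambda>(x, y). vector_derivative (\<lambda>s. \<phi> (s, y)) (at x))"

text \<open>The graph of \<open>d/dx\<^sub>1\<close> on the space \<open>\<D>\<close>. Square integrability of \<open>dx1 \<phi>\<close> does not follow from
  the other conditions and is needed for \<open>d/dx\<^sub>1\<close> to map into \<open>L\<^sup>2\<close>.\<close>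

definition dx1_graph :: "'a::euclidean_space set \<Rightarrow> ((real \<times> 'a) L2 \<times> (real \<times> 'a) L2) set" where
  "dx1_graph \<Omega> = {(L2_of \<phi>, L2_of (dx1 \<phi>)) | \<phi>.
     square_int \<phi> \<and> square_int (dx1 \<phi>) \<and>
     (\<forall>x y. y \<notin> \<Omega> \<longrightarrow> \<phi> (x, y) = 0) \<and>
     (\<forall>y\<in>\<Omega>. test_fun01 (\<lambda>x. \<phi> (x, y)))}"

text \<open>The function \<open>(x\<^sub>1, y) \<mapsto> a(x\<^sub>1) h(y)\<close> on the slab \<open>0 < x\<^sub>1 < 1\<close>.\<close>

definition tensor01 :: "(real \<Rightarrow> complex) \<Rightarrow> 'a::euclidean_space L2 \<Rightarrow> (real \<times> 'a) L2" where
  "tensor01 a h = L2_of (\<lambda>(x, y). if x \<in> {0<..<1} then a x * fun_of_L2 h y else 0)"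

text \<open>The restriction of \<open>H\<^sub>V\<close> to the core \<open>\<D>\<^sub>V\<close>, followed by its closure \<open>H\<^sub>V\<close>.\<close>

definition core_graph ::
  "'a::euclidean_space set \<Rightarrow> ('a L2 \<Rightarrow> 'a L2) \<Rightarrow> ((real \<times> 'a) L2 \<times> (real \<times> 'a) L2) set" where
  "core_graph \<Omega> V = {(f, g). \<exists>\<phi> \<phi>' h. (\<phi>, \<phi>') \<in> dx1_graph \<Omega> \<and> h \<in> L2_on \<Omega> \<and>
     f = \<phi> + tensor01 (\<lambda>x. exp (of_real x)) h + tensor01 (\<lambda>x. exp (of_real (1 - x))) (V h) \<and>
     \<i> *\<^sub>C g = \<phi>' + tensor01 (\<lambda>x. exp (of_real x)) h - tensor01 (\<lambda>x. exp (of_real (1 - x))) (V h)}"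

definition H_op ::
  "'a::euclidean_space set \<Rightarrow> ('a L2 \<Rightarrow> 'a L2) \<Rightarrow> ((real \<times> 'a) L2 \<times> (real \<times> 'a) L2) set" where
  "H_op \<Omega> V = closure (core_graph \<Omega> V)"

text \<open>The boundary operator \<open>(eI + V)(I + eV)\<^sup>-\<^sup>1\<close> on \<open>L\<^sup>2(\<Omega>)\<close>. The source defines it as the
  exponential of this operator, but that contradicts the boundary condition
  \<open>f(1) = U\<^sub>V (f(0))\<close> for \<open>f = \<phi> + e\<^sup>x h + e\<^sup>1\<^sup>-\<^sup>x V h\<close>, where \<open>f(0) = h + e V h\<close> and
  \<open>f(1) = e h + V h\<close> (see \<open>bdry_op_boundary_condition\<close>), and it would not be unitary.\<close>

definition bdry_op :: "'a::euclidean_space set \<Rightarrow> ('a L2 \<Rightarrow> 'a L2) \<Rightarrow> 'a L2 \<Rightarrow> 'a L2" where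
  "bdry_op \<Omega> V g =
     (let h = inv_into (L2_on \<Omega>) (\<lambda>h. h + exp 1 *\<^sub>R V h) g in exp 1 *\<^sub>R h + V h)"

lemma fun_of_L2_square_int: "square_int (fun_of_L2 f)"
  using Quotient3_rep_reflp[OF Quotient3_L2, of f] by (simp add: L2_rel_def)

lemma L2_on_diff:
  assumes "f \<in> L2_on S" "g \<in> L2_on S"
  shows "f - g \<in> L2_on S"
proof -
  have rep: "L2_rel (fun_of_L2 (L2_of k)) k" if "square_int k" for k :: "'a \<Rightarrow> complex"
    using that rep_abs_rsp[OF Quotient3_L2, of k k] rep_abs_rsp_left[OF Quotient3_L2, of k k]
    by (simp add: L2_rel_def)
  let ?k = "\<lambda>x. fun_of_L2 f x + (-1) * fun_of_L2 g x"
  have sq: "square_int ?k"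
    by (intro square_int_add square_int_scale fun_of_L2_square_int)
  have "L2_of (fun_of_L2 f) - L2_of (fun_of_L2 g) = L2_of ?k"
    unfolding minus_L2_def uminus_L2_def
    by (subst scaleC.abs_eq, simp add: L2_rel_def fun_of_L2_square_int, subst plus_L2.abs_eq)
       (auto simp only: L2_rel_def intro!: fun_of_L2_square_int square_int_scale)
  then have "f - g = L2_of ?k"
    by (simp add: Quotient3_abs_rep[OF Quotient3_L2])
  with rep[OF sq] have "AE x in lebesgue. fun_of_L2 (f - g) x = ?k x"
    by (simp add: L2_rel_def)
  with assms show ?thesis
    unfolding L2_on_def mem_Collect_eq by eventually_elim simp
qed

lemma bdry_op_boundary_condition:
  assumes V: "unitary_on (L2_on \<Omega>) V" and h: "h \<in> L2_on \<Omega>"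
  shows "bdry_op \<Omega> V (h + exp 1 *\<^sub>R V h) = exp 1 *\<^sub>R h + V h"
proof -
  have "inj_on (\<lambda>h. h + exp 1 *\<^sub>R V h) (L2_on \<Omega>)"
  proof (rule inj_onI)
    fix f g assume f: "f \<in> L2_on \<Omega>" and g: "g \<in> L2_on \<Omega>"
      and eq: "f + exp 1 *\<^sub>R V f = g + exp 1 *\<^sub>R V g"
    have fg: "f - g \<in> L2_on \<Omega>" by (rule L2_on_diff[OF f g])
    have "V (f - g) + V g = V f"
      using V fg g unfolding unitary_on_def by (metis diff_add_cancel)
    then have "f - g = - exp 1 *\<^sub>R V (f - g)"
      using eq by (simp add: algebra_simps eq_diff_eq flip: \<open>V (f - g) + V g = V f\<close>)
    then have "norm (f - g) = exp 1 * norm (V (f - g))"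
      by (metis abs_exp_cancel norm_minus_cancel norm_scaleR scaleR_minus_left)
    moreover have "norm (V (f - g)) = norm (f - g)"
      using V fg by (simp add: unitary_on_def norm_eq_sqrt_inner inner_L2_def)
    ultimately have "norm (f - g) * (exp 1 - 1) = 0"
      by (simp add: algebra_simps)
    then show "f = g" by simp
  qed
  then have "inv_into (L2_on \<Omega>) (\<lambda>h. h + exp 1 *\<^sub>R V h) (h + exp 1 *\<^sub>R V h) = h"
    using h by (rule inv_into_f_f)
  then show ?thesis by (simp add: bdry_op_def)
qed


section \<open>The translation model\<close>

text \<open>Functions rather than classes: two elements of \<open>HV_space \<Omega> U\<close> that agree almost everywhere
  represent the same vector. Since \<open>f (x + 1) = U (f x)\<close>, a translate by \<open>t \<ge> x\<close> is expressed through
  the values on \<open>(0,1)\<close> as \<open>f (x - t) = U\<^sup>-\<^sup>1 (f (x - t + 1))\<close>; the source writes \<open>U\<close> for \<open>U\<^sup>-\<^sup>1\<close>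
  there.\<close>

definition HV_space :: "'a::euclidean_space set \<Rightarrow> ('a L2 \<Rightarrow> 'a L2) \<Rightarrow> (real \<Rightarrow> 'a L2) set" where
  "HV_space \<Omega> U = {f. f \<in> borel_measurable lebesgue \<and> (\<forall>x. f x \<in> L2_on \<Omega>) \<and>
     (\<forall>x. f (x + 1) = U (f x)) \<and>
     set_integrable lebesgue {0<..<1} (\<lambda>x. (norm (f x))\<^sup>2)}"

definition HV_norm :: "(real \<Rightarrow> 'a::euclidean_space L2) \<Rightarrow> real" where
  "HV_norm f = sqrt (set_lebesgue_integral lebesgue {0<..<1} (\<lambda>x. (norm (f x))\<^sup>2))"

text \<open>\<open>slice F x\<close> is \<open>F(x, \<cdot>)\<close>, meaningful for almost every \<open>x\<close>. It realises the identification of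
  \<open>L\<^sup>2((0,1) \<times> \<Omega>)\<close> with \<open>L\<^sup>2((0,1), L\<^sup>2(\<Omega>))\<close>.\<close>

definition slice :: "(real \<times> 'a::euclidean_space) L2 \<Rightarrow> real \<Rightarrow> 'a L2" where
  "slice F x = L2_of (\<lambda>y. fun_of_L2 F (x, y))"

definition restrict01 ::
  "'a::euclidean_space set \<Rightarrow> (real \<Rightarrow> 'a L2) \<Rightarrow> (real \<times> 'a) L2" where
  "restrict01 \<Omega> f = (THE F. F \<in> L2_on ({0<..<1} \<times> \<Omega>) \<and>
     (AE x in lebesgue. x \<in> {0<..<1} \<longrightarrow> slice F x = f x))"

end

theory Submission
  imports Defs
begin

text \<open>
Since \<open>V\<close> is unitary, \<open>h + e V h = g\<close> and \<open>e h + V h = g\<close> are solvable by contraction and the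
boundary operator \<open>U\<close> is unitary on \<open>K = L\<^sup>2(\<Omega>)\<close>. Every \<open>F\<close> in \<open>S = L\<^sup>2((0,1) \<times> \<Omega>)\<close> has sections in \<open>K\<close>
and extends to a function on the line with \<open>f(x + 1) = U (f x)\<close>; since \<open>\<parallel>f(x)\<parallel>\<close> is 1-periodic, translation
defines a unitary group on \<open>S\<close>. Its generator is \<open>-d/dx\<close> on the elementary tensors \<open>b \<otimes> h\<close> with a test
function \<open>b\<close> and on \<open>e\<^sup>x h + e\<^sup>1\<^sup>-\<^sup>x V h\<close>. These span a graph over which the ranges of \<open>H \<plusminus> i\<close> are dense, so its
closure is the whole generator and is self-adjoint. A general element of \<open>\<D>\<close> belongs to the domain
because it satisfies the adjoint identity against this graph, by integration by parts; hence the
generator is \<open>H\<^sub>V\<close>. A unitary group is determined by its generator, as \<open>\<parallel>U\<^sub>t f - W\<^sub>t f\<parallel>\<^sup>2\<close> has derivative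
zero for \<open>f\<close> in the domain.
\<close>

text \<open>The functions e^x and e^(1-x) come from the deficiency spaces: (1/i) d/dx multiplies the
  first by -i and the second by i. They have equal norm on (0,1), so von Neumann's theory matches
  the two spaces by a unitary \<open>V\<close>. At the endpoints e^x h + e^(1-x) V h takes the
  values h + e V h and e h + V h, which is why the quotient (eI + V)(I + eV)^-1 is the boundary
  operator. The obstacle is the size of the space of test functions: its elements are smooth in x1
  for each y, but with no bound uniform in y, so their difference quotients have no obvious
  majorant. Only tensors are differentiated by hand, where a single vector carries the dependence on
  y. The other difficulty is the passage between square-integrable functions of two variables and
  functions of x1 with values in \<open>L2\<close>. It uses completeness of \<open>L2\<close>, which
  supplies limits of simple functions, and separability, by which vector-valued measurability is
  tested on countably many balls.\<close>

lemma L2_of_fun_of_L2 [simp]: "L2_of (fun_of_L2 f) = f"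
  by (rule Quotient3_abs_rep[OF Quotient3_L2])

lemma L2_of_eq_iff:
  assumes "square_int f" "square_int g"
  shows "L2_of f = L2_of g \<longleftrightarrow> (AE x in lebesgue. f x = g x)"
  using Quotient3_rel[OF Quotient3_L2, of f g] assms by (auto simp: L2_rel_def)

lemma fun_of_L2_of:
  assumes "square_int f"
  shows "AE x in lebesgue. fun_of_L2 (L2_of f) x = f x"
  using L2_of_eq_iff[OF fun_of_L2_square_int assms, of "L2_of f"] by simp

lemma L2_eqI:
  assumes "AE x in lebesgue. fun_of_L2 f x = fun_of_L2 g x"
  shows "f = g"
  using L2_of_eq_iff[OF fun_of_L2_square_int fun_of_L2_square_int, of f g] assms by simp

lemma L2_of_cong:
  assumes "square_int f" "square_int g" "AE x in lebesgue. f x = g x"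
  shows "L2_of f = L2_of g"
  using assms L2_of_eq_iff by blast

lemma fun_of_L2_measurable [measurable]: "fun_of_L2 f \<in> borel_measurable lebesgue"
  using fun_of_L2_square_int[of f] by (simp add: square_int_def)

lemma square_int_measurable: "square_int f \<Longrightarrow> f \<in> borel_measurable lebesgue"
  by (simp add: square_int_def)

lemma L2_of_add:
  assumes "square_int f" "square_int g"
  shows "L2_of (\<lambda>x. f x + g x) = L2_of f + L2_of g"
  using assms by (simp add: plus_L2.abs_eq L2_rel_def)

lemma L2_of_scaleC:
  assumes "square_int f"
  shows "L2_of (\<lambda>x. c * f x) = c *\<^sub>C L2_of f"
  using assms by (simp add: scaleC.abs_eq L2_rel_def)

lemma L2_of_zero: "L2_of (\<lambda>x. 0) = 0"
  by (simp add: zero_L2_def)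

lemma scaleR_L2_eq: "r *\<^sub>R f = complex_of_real r *\<^sub>C f"
  by (rule scaleR_L2_def)

lemma square_int_diff:
  assumes "square_int f" "square_int g"
  shows "square_int (\<lambda>x. f x - g x)"
  using square_int_add[OF assms(1) square_int_scale[OF assms(2), of "-1"]] by simp

lemma L2_of_diff:
  assumes "square_int f" "square_int g"
  shows "L2_of (\<lambda>x. f x - g x) = L2_of f - L2_of g"
  using L2_of_add[OF assms(1) square_int_scale[OF assms(2), of "-1"]]
    L2_of_scaleC[OF assms(2), of "-1"] by (simp add: minus_L2_def uminus_L2_def)

lemma fun_of_L2_add: "AE x in lebesgue. fun_of_L2 (f + g) x = fun_of_L2 f x + fun_of_L2 g x"
  using fun_of_L2_of[OF square_int_add[OF fun_of_L2_square_int fun_of_L2_square_int], of f g]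
  by (simp add: L2_of_add[OF fun_of_L2_square_int fun_of_L2_square_int])

lemma fun_of_L2_diff: "AE x in lebesgue. fun_of_L2 (f - g) x = fun_of_L2 f x - fun_of_L2 g x"
  using fun_of_L2_of[OF square_int_diff[OF fun_of_L2_square_int fun_of_L2_square_int], of f g]
  by (simp add: L2_of_diff[OF fun_of_L2_square_int fun_of_L2_square_int])

lemma fun_of_L2_scaleC: "AE x in lebesgue. fun_of_L2 (c *\<^sub>C f) x = c * fun_of_L2 f x"
  using fun_of_L2_of[OF square_int_scale[OF fun_of_L2_square_int], of c f]
  by (simp add: L2_of_scaleC[OF fun_of_L2_square_int])

lemma fun_of_L2_zero: "AE x in lebesgue. fun_of_L2 0 x = 0"
  using fun_of_L2_of[OF square_int_zero] by (simp add: L2_of_zero)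

lemma scaleC_add_right: "c *\<^sub>C (f + g) = c *\<^sub>C f + c *\<^sub>C g"
proof (rule L2_eqI)
  show "AE x in lebesgue. fun_of_L2 (c *\<^sub>C (f + g)) x = fun_of_L2 (c *\<^sub>C f + c *\<^sub>C g) x"
    using fun_of_L2_add[of f g] fun_of_L2_scaleC[of c "f + g"] fun_of_L2_add[of "c *\<^sub>C f" "c *\<^sub>C g"]
      fun_of_L2_scaleC[of c f] fun_of_L2_scaleC[of c g]
    by eventually_elim (simp add: distrib_left)
qed

lemma scaleC_add_left: "(c + d) *\<^sub>C f = c *\<^sub>C f + d *\<^sub>C f"
proof (rule L2_eqI)
  show "AE x in lebesgue. fun_of_L2 ((c + d) *\<^sub>C f) x = fun_of_L2 (c *\<^sub>C f + d *\<^sub>C f) x"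
    using fun_of_L2_scaleC[of "c + d" f] fun_of_L2_add[of "c *\<^sub>C f" "d *\<^sub>C f"]
      fun_of_L2_scaleC[of c f] fun_of_L2_scaleC[of d f]
    by eventually_elim (simp add: distrib_right)
qed

lemma scaleC_scaleC [simp]: "c *\<^sub>C d *\<^sub>C f = (c * d) *\<^sub>C f"
proof (rule L2_eqI)
  show "AE x in lebesgue. fun_of_L2 (c *\<^sub>C d *\<^sub>C f) x = fun_of_L2 ((c * d) *\<^sub>C f) x"
    using fun_of_L2_scaleC[of "c * d" f] fun_of_L2_scaleC[of c "d *\<^sub>C f"] fun_of_L2_scaleC[of d f]
    by eventually_elim simp
qed

lemma scaleC_one [simp]: "1 *\<^sub>C f = f"
  using scaleR_L2_eq[of 1 f] by simp

lemma scaleC_minus_one: "(-1) *\<^sub>C f = - f"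
  by (simp add: uminus_L2_def)

lemma scaleC_minus_left [simp]: "(- c) *\<^sub>C f = - (c *\<^sub>C f)"
  using scaleC_scaleC[of "-1" c f] by (simp only: scaleC_minus_one mult_minus1)

lemma scaleC_minus_right [simp]: "c *\<^sub>C (- f) = - (c *\<^sub>C f)"
  using scaleC_scaleC[of c "-1" f] by (simp add: scaleC_minus_one)

lemma scaleC_diff_right: "c *\<^sub>C (f - g) = c *\<^sub>C f - c *\<^sub>C g"
  using scaleC_add_right[of c f "- g"] by simp

lemma scaleC_zero_left [simp]: "0 *\<^sub>C f = 0"
  using scaleR_L2_eq[of 0 f] by simp

lemma scaleC_zero_right [simp]: "c *\<^sub>C 0 = 0"
  using scaleC_scaleC[of c 0 0] by (metis mult_zero_right scaleC_zero_left)

lemma scaleC_scaleR_commute: "c *\<^sub>C (r *\<^sub>R f) = r *\<^sub>R (c *\<^sub>C f)"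
  by (simp add: scaleR_L2_eq mult.commute)

section \<open>The complex inner product\<close>

lemma cinner_L2_of:
  assumes "square_int f" "square_int g"
  shows "cinner (L2_of f) (L2_of g) = (\<integral>x. f x * cnj (g x) \<partial>lebesgue)"
  using assms by (simp add: cinner.abs_eq L2_rel_def)

lemma cinner_eq: "cinner f g = (\<integral>x. fun_of_L2 f x * cnj (fun_of_L2 g x) \<partial>lebesgue)"
  using cinner_L2_of[OF fun_of_L2_square_int fun_of_L2_square_int, of f g] by simp

lemma cinner_add_left: "cinner (f + g) h = cinner f h + cinner g h"
proof -
  have "cinner (f + g) h = cinner (L2_of (\<lambda>x. fun_of_L2 f x + fun_of_L2 g x)) (L2_of (fun_of_L2 h))"
    by (simp add: L2_of_add fun_of_L2_square_int)
  also have "\<dots> = cinner f h + cinner g h"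
    by (subst cinner_L2_of)
       (simp_all add: cinner_eq fun_of_L2_square_int square_int_add distrib_right
        integrable_square_int_mult)
  finally show ?thesis .
qed

lemma cinner_scaleC_left: "cinner (c *\<^sub>C f) g = c * cinner f g"
proof -
  have "cinner (c *\<^sub>C f) g = cinner (L2_of (\<lambda>x. c * fun_of_L2 f x)) (L2_of (fun_of_L2 g))"
    by (simp add: L2_of_scaleC fun_of_L2_square_int)
  also have "\<dots> = c * cinner f g"
    by (subst cinner_L2_of)
       (simp_all add: cinner_eq fun_of_L2_square_int square_int_scale mult.assoc)
  finally show ?thesis .
qed

lemma cinner_commute: "cinner g f = cnj (cinner f g)"
  unfolding cinner_eq
  by (subst Bochner_Integration.integral_cnj[symmetric], simp add: mult.commute)

lemma cinner_add_right: "cinner h (f + g) = cinner h f + cinner h g"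
  by (metis cinner_add_left cinner_commute complex_cnj_add)

lemma cinner_scaleC_right: "cinner f (c *\<^sub>C g) = cnj c * cinner f g"
  by (metis cinner_scaleC_left cinner_commute complex_cnj_mult)

lemma cinner_minus_left [simp]: "cinner (- f) g = - cinner f g"
  using cinner_scaleC_left[of "-1" f g] by (simp add: scaleC_minus_one)

lemma cinner_minus_right [simp]: "cinner f (- g) = - cinner f g"
  using cinner_scaleC_right[of f "-1" g] by (simp add: scaleC_minus_one)

lemma cinner_diff_left: "cinner (f - g) h = cinner f h - cinner g h"
  using cinner_add_left[of f "- g" h] by simp

lemma cinner_diff_right: "cinner h (f - g) = cinner h f - cinner h g"
  using cinner_add_right[of h f "- g"] by simp

text \<open>The imaginary part is, up to sign, a real inner product with
  \<open>\<i> *\<^sub>C f\<close>. Continuity and preservation of \<open>cinner\<close> therefore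
  reduce to facts about the real inner product.\<close>

lemma cinner_inner: "cinner f g = Complex (f \<bullet> g) (- ((\<i> *\<^sub>C f) \<bullet> g))"
  by (simp add: inner_L2_def complex_eq_iff cinner_scaleC_left)

lemma cinner_self: "cinner f f = complex_of_real ((norm f)\<^sup>2)"
proof -
  have "cnj (cinner f f) = cinner f f"
    using cinner_commute[of f f] by simp
  then have "Im (cinner f f) = 0"
    by (simp add: complex_eq_iff)
  moreover have "Re (cinner f f) = (norm f)\<^sup>2"
    by (simp add: power2_norm_eq_inner inner_L2_def)
  ultimately show ?thesis by (simp add: complex_eq_iff)
qed

lemma norm_scaleC [simp]: "norm (c *\<^sub>C f) = cmod c * norm f"
proof -
  have "complex_of_real ((norm (c *\<^sub>C f))\<^sup>2) = c * cnj c * cinner f f"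
    by (simp only: cinner_self[symmetric] cinner_scaleC_left cinner_scaleC_right) simp
  also have "\<dots> = complex_of_real ((cmod c * norm f)\<^sup>2)"
    by (simp add: cinner_self complex_norm_square power_mult_distrib del: complex_norm_square[symmetric])
       (simp add: complex_norm_square[symmetric])
  finally have "(norm (c *\<^sub>C f))\<^sup>2 = (cmod c * norm f)\<^sup>2"
    by (simp only: of_real_eq_iff)
  then show ?thesis by (simp add: power2_eq_iff_nonneg)
qed

lemma bounded_linear_scaleC: "bounded_linear (\<lambda>f. c *\<^sub>C f)"
  by (rule bounded_linear_intro[where K="cmod c"])
     (auto simp: scaleC_add_right scaleC_scaleR_commute)

lemma bounded_linear_scaleC_left: "bounded_linear (\<lambda>c. c *\<^sub>C f)"
  by (rule bounded_linear_intro[where K="norm f"])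
     (auto simp: scaleC_add_left scaleR_L2_eq scaleR_conv_of_real)

lemmas tendsto_scaleC_const = bounded_linear.tendsto[OF bounded_linear_scaleC]
lemma tendsto_cinner:
  assumes "(f \<longlongrightarrow> a) F" "(g \<longlongrightarrow> b) F"
  shows "((\<lambda>x. cinner (f x) (g x)) \<longlongrightarrow> cinner a b) F"
  unfolding cinner_inner Complex_eq
  by (intro tendsto_intros tendsto_scaleC_const assms)

section \<open>Square integrability and dominated convergence\<close>

lemma norm_L2_nn: "ennreal ((norm f)\<^sup>2) = (\<integral>\<^sup>+x. ennreal ((cmod (fun_of_L2 f x))\<^sup>2) \<partial>lebesgue)"
proof -
  have "complex_of_real ((norm f)\<^sup>2) = (\<integral>x. complex_of_real ((cmod (fun_of_L2 f x))\<^sup>2) \<partial>lebesgue)"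
    by (simp only: cinner_self[symmetric] cinner_eq complex_norm_square)
  then have "(norm f)\<^sup>2 = (\<integral>x. (cmod (fun_of_L2 f x))\<^sup>2 \<partial>lebesgue)"
    by (simp only: integral_complex_of_real of_real_eq_iff)
  then show ?thesis
    using fun_of_L2_square_int[of f] by (simp add: square_int_def nn_integral_eq_integral)
qed

lemma norm_L2_of_nn:
  assumes "square_int f"
  shows "ennreal ((norm (L2_of f))\<^sup>2) = (\<integral>\<^sup>+x. ennreal ((cmod (f x))\<^sup>2) \<partial>lebesgue)"
  unfolding norm_L2_nn
  by (rule nn_integral_cong_AE, use fun_of_L2_of[OF assms] in eventually_elim) simp

lemma square_int_iff_nn:
  "square_int f \<longleftrightarrow> f \<in> borel_measurable lebesgue \<and> (\<integral>\<^sup>+x. ennreal ((cmod (f x))\<^sup>2) \<partial>lebesgue) < \<infinity>"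
  by (auto simp: square_int_def integrable_iff_bounded)

lemma square_int_bound:
  assumes "square_int g" "f \<in> borel_measurable lebesgue" "AE x in lebesgue. cmod (f x) \<le> cmod (g x)"
  shows "square_int f"
  unfolding square_int_def
proof
  show "integrable lebesgue (\<lambda>x. (cmod (f x))\<^sup>2)"
  proof (rule Bochner_Integration.integrable_bound)
    show "integrable lebesgue (\<lambda>x. (cmod (g x))\<^sup>2)" using assms by (simp add: square_int_def)
    show "AE x in lebesgue. norm ((cmod (f x))\<^sup>2) \<le> norm ((cmod (g x))\<^sup>2)"
      using assms(3) by eventually_elim (simp add: power_mono)
  qed (use assms(2) in measurable)
qed (use assms in auto)

lemma square_int_cong_AE:
  assumes "square_int f" "AE x in lebesgue. f x = g x"
  shows "square_int g"
proof (rule square_int_bound[OF assms(1)])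
  show "g \<in> borel_measurable lebesgue"
    by (rule borel_measurable_AE[OF _ assms(2)]) (use assms in \<open>simp add: square_int_def\<close>)
qed (use assms(2) in eventually_elim, simp)

text \<open>Dominated convergence applied to the squares of \<open>f n - F\<close>, which turns
  pointwise convergence into convergence in norm. The bounds fail on countably many null sets only,
  so the limit obeys the same bound.\<close>

lemma L2_dominated:
  assumes g: "square_int g"
    and m: "\<And>n. f n \<in> borel_measurable lebesgue"
    and lim: "AE x in lebesgue. (\<lambda>n. f n x) \<longlonglongrightarrow> F x"
    and bd: "\<And>n. AE x in lebesgue. cmod (f n x) \<le> cmod (g x)"
    and mF: "F \<in> borel_measurable lebesgue"
  shows "square_int F" "(\<lambda>n. L2_of (f n)) \<longlonglongrightarrow> L2_of F"
proof -
  have bdF: "AE x in lebesgue. cmod (F x) \<le> cmod (g x)"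
  proof -
    have "AE x in lebesgue. \<forall>n. cmod (f n x) \<le> cmod (g x)"
      using bd by (simp add: AE_all_countable)
    with lim show ?thesis
    proof eventually_elim
      case (elim x)
      show ?case
        by (rule LIMSEQ_le_const2[OF tendsto_norm[OF elim(1)]]) (use elim(2) in auto)
    qed
  qed
  show sF: "square_int F" by (rule square_int_bound[OF g mF bdF])
  have sf: "square_int (f n)" for n by (rule square_int_bound[OF g m bd])
  have "(\<lambda>n. \<integral>\<^sup>+x. ennreal ((cmod (f n x - F x))\<^sup>2) \<partial>lebesgue) \<longlonglongrightarrow> (\<integral>\<^sup>+x. 0 \<partial>(lebesgue :: 'a measure))"
  \<comment> \<open>The majorant is the square of \<open>2 * cmod (g x)\<close>, which bounds
    \<open>cmod (f n x - F x)\<close>.\<close>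
  proof (rule nn_integral_dominated_convergence[where w="\<lambda>x. ennreal (4 * (cmod (g x))\<^sup>2)"])
    show "(\<lambda>x. ennreal ((cmod (f n x - F x))\<^sup>2)) \<in> borel_measurable lebesgue" for n
      using m mF by measurable
    show "(\<lambda>x. ennreal (4 * (cmod (g x))\<^sup>2)) \<in> borel_measurable lebesgue"
      using square_int_measurable[OF g] by measurable
    show "(\<integral>\<^sup>+x. ennreal (4 * (cmod (g x))\<^sup>2) \<partial>lebesgue) < \<infinity>"
      using square_int_scale[OF g, of 2]
      by (simp add: square_int_iff_nn norm_mult power_mult_distrib)
    show "AE x in lebesgue. ennreal ((cmod (f n x - F x))\<^sup>2) \<le> ennreal (4 * (cmod (g x))\<^sup>2)" for n
      using bdF bd[of n]
    proof eventually_elim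
      case (elim x)
      have "cmod (f n x - F x) \<le> 2 * cmod (g x)"
        using elim norm_triangle_ineq4[of "f n x" "F x"] by linarith
      then have "(cmod (f n x - F x))\<^sup>2 \<le> (2 * cmod (g x))\<^sup>2"
        by (rule power_mono) simp
      then show ?case by (intro ennreal_leI) (simp add: power_mult_distrib)
    qed
    show "AE x in lebesgue. (\<lambda>n. ennreal ((cmod (f n x - F x))\<^sup>2)) \<longlonglongrightarrow> 0"
      using lim
    proof eventually_elim
      case (elim x)
      have "(\<lambda>n. (cmod (f n x - F x))\<^sup>2) \<longlonglongrightarrow> (cmod (F x - F x))\<^sup>2"
        by (intro tendsto_intros elim)
      then have "(\<lambda>n. ennreal ((cmod (f n x - F x))\<^sup>2)) \<longlonglongrightarrow> ennreal ((cmod (F x - F x))\<^sup>2)"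
        by (rule tendsto_ennrealI)
      then show ?case by simp
    qed
  qed auto
  also have "(\<lambda>n. \<integral>\<^sup>+x. ennreal ((cmod (f n x - F x))\<^sup>2) \<partial>lebesgue) = (\<lambda>n. ennreal ((norm (L2_of (f n) - L2_of F))\<^sup>2))"
    using norm_L2_of_nn[OF square_int_diff[OF sf sF]] by (simp add: L2_of_diff[OF sf sF])
  finally have "(\<lambda>n. ennreal ((norm (L2_of (f n) - L2_of F))\<^sup>2)) \<longlonglongrightarrow> ennreal 0" by simp
  then have "(\<lambda>n. (norm (L2_of (f n) - L2_of F))\<^sup>2) \<longlonglongrightarrow> 0"
    by (subst (asm) tendsto_ennreal_iff) auto
  then have "(\<lambda>n. sqrt ((norm (L2_of (f n) - L2_of F))\<^sup>2)) \<longlonglongrightarrow> sqrt 0"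
    by (rule tendsto_real_sqrt)
  then show "(\<lambda>n. L2_of (f n)) \<longlonglongrightarrow> L2_of F"
    by (intro LIM_zero_cancel[of "\<lambda>n. L2_of (f n)"] tendsto_norm_zero_cancel[of "\<lambda>n. L2_of (f n) - L2_of F"]) simp
qed

section \<open>Completeness\<close>

text \<open>The weights \<open>4\<^sup>k\<close> keep \<open>\<Sum>k. 4\<^sup>k \<bar>X (k+1) - X k\<bar>\<^sup>2\<close> integrable, so almost everywhere the
  increments decay geometrically; Fatou's lemma then gives the norm estimate.\<close>

lemma L2_Cauchy_limit:
  fixes X :: "nat \<Rightarrow> 'a::euclidean_space L2"
  assumes C: "\<And>k m. m \<ge> k \<Longrightarrow> norm (X m - X k) \<le> (1/4) ^ k"
  shows "\<exists>L. \<forall>k. norm (L - X k) \<le> (1/4) ^ k"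
proof -
  let ?f = "\<lambda>k. fun_of_L2 (X k)"
  let ?D = "\<lambda>k. fun_of_L2 (X (Suc k) - X k)"
  have bound: "(\<integral>\<^sup>+x. ennreal (4^k * (cmod (?D k x))\<^sup>2) \<partial>lebesgue) \<le> ennreal ((1/4)^k)" for k
  proof -
    have "(\<integral>\<^sup>+x. ennreal (4^k * (cmod (?D k x))\<^sup>2) \<partial>lebesgue)
        = (\<integral>\<^sup>+x. ennreal (4^k) * ennreal ((cmod (?D k x))\<^sup>2) \<partial>lebesgue)"
      by (simp add: ennreal_mult)
    also have "\<dots> = ennreal (4^k) * ennreal ((norm (X (Suc k) - X k))\<^sup>2)"
      unfolding norm_L2_nn by (rule nn_integral_cmult) measurable
    also have "\<dots> \<le> ennreal (4^k) * ennreal (((1/4)^k)\<^sup>2)"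
      by (intro mult_left_mono ennreal_leI power_mono C) auto
    also have "\<dots> = ennreal (4^k * ((1/4)^k)\<^sup>2)"
      by (simp add: ennreal_mult)
    also have "4^k * ((1/4)^k)\<^sup>2 = (1/4::real)^k"
      by (simp add: power2_eq_square power_one_over)
    finally show ?thesis .
  qed
  have "(\<integral>\<^sup>+x. (\<Sum>k. ennreal (4^k * (cmod (?D k x))\<^sup>2)) \<partial>lebesgue)
      = (\<Sum>k. \<integral>\<^sup>+x. ennreal (4^k * (cmod (?D k x))\<^sup>2) \<partial>lebesgue)"
    by (rule nn_integral_suminf) measurable
  also have "\<dots> \<le> (\<Sum>k. ennreal ((1/4)^k))"
    by (intro suminf_le bound) auto
  also have "\<dots> = ennreal (\<Sum>k. (1/4)^k)"
    by (rule suminf_ennreal2) auto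
  also have "\<dots> < \<infinity>" by simp
  finally have "(\<integral>\<^sup>+x. (\<Sum>k. ennreal (4^k * (cmod (?D k x))\<^sup>2)) \<partial>lebesgue) \<noteq> \<infinity>" by simp
  then have fin: "AE x in lebesgue. (\<Sum>k. ennreal (4^k * (cmod (?D k x))\<^sup>2)) \<noteq> \<infinity>"
    by (rule nn_integral_PInf_AE[rotated]) measurable
  have dif: "AE x in lebesgue. \<forall>k. ?D k x = ?f (Suc k) x - ?f k x"
    unfolding AE_all_countable using fun_of_L2_diff by blast
  have conv: "AE x in lebesgue. convergent (\<lambda>k. ?f k x)"
    using fin dif
  proof eventually_elim
    case (elim x)
    \<comment> \<open>The terms of a convergent series are bounded by some \<open>B\<close>, so the
      increments are at most \<open>sqrt B * (1/2)^k\<close>, hence summable.\<close>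
    have "summable (\<lambda>k. 4^k * (cmod (?D k x))\<^sup>2)"
      by (rule summable_suminf_not_top) (use elim in auto)
    from convergent_imp_Bseq[OF convergentI[OF summable_LIMSEQ_zero[OF this]]]
    obtain B where "\<forall>k. norm (4^k * (cmod (?D k x))\<^sup>2) \<le> B"
      by (rule BseqE)
    then have B: "4^k * (cmod (?D k x))\<^sup>2 \<le> B" for k
      by (metis real_norm_def abs_le_D1)
    have "cmod (?D k x) \<le> sqrt B * (1/2)^k" for k
    proof -
      have p4: "(2^k)\<^sup>2 = (4::real)^k" by (simp add: power2_eq_square flip: power_mult_distrib)
      have "(2^k * cmod (?D k x))\<^sup>2 \<le> B"
        using B[of k] by (simp only: power_mult_distrib p4)
      then have "2^k * cmod (?D k x) \<le> sqrt B"
        by (rule real_le_rsqrt)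
      then show ?thesis by (simp add: power_one_over field_simps)
    qed
    then have "summable (\<lambda>k. ?D k x)"
      by (rule summable_comparison_test'[rotated]) (auto intro: summable_mult)
    then have "convergent (\<lambda>n. \<Sum>k<n. ?D k x)"
      by (simp add: summable_iff_convergent)
    moreover have "(\<Sum>k<n. ?D k x) = ?f n x - ?f 0 x" for n
      using elim sum_lessThan_telescope[of "\<lambda>k. ?f k x" n] by simp
    ultimately have "convergent (\<lambda>n. ?f n x - ?f 0 x)" by simp
    then show ?case by (simp add: convergent_diff_const_right_iff)
  qed
  define F where "F x = lim (\<lambda>k. ?f k x)" for x
  have mF [measurable]: "F \<in> borel_measurable lebesgue"
    unfolding F_def by (rule borel_measurable_lim_metric) measurable
  have lim: "AE x in lebesgue. (\<lambda>k. ?f k x) \<longlonglongrightarrow> F x"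
    using conv unfolding F_def by eventually_elim (simp add: convergent_LIMSEQ_iff)
  have est: "(\<integral>\<^sup>+x. ennreal ((cmod (F x - ?f k x))\<^sup>2) \<partial>lebesgue) \<le> ennreal (((1/4)^k)\<^sup>2)" for k
  proof -
    have "(\<integral>\<^sup>+x. ennreal ((cmod (F x - ?f k x))\<^sup>2) \<partial>lebesgue)
        = (\<integral>\<^sup>+x. liminf (\<lambda>m. ennreal ((cmod (?f m x - ?f k x))\<^sup>2)) \<partial>lebesgue)"
    proof (rule nn_integral_cong_AE, use lim in eventually_elim)
      case (elim x)
      have "(\<lambda>m. ennreal ((cmod (?f m x - ?f k x))\<^sup>2)) \<longlonglongrightarrow> ennreal ((cmod (F x - ?f k x))\<^sup>2)"
        by (intro tendsto_ennrealI tendsto_intros elim)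
      from lim_imp_Liminf[OF _ this] show ?case by simp
    qed
    also have "\<dots> \<le> liminf (\<lambda>m. \<integral>\<^sup>+x. ennreal ((cmod (?f m x - ?f k x))\<^sup>2) \<partial>lebesgue)"
      by (rule nn_integral_liminf) measurable
    also have "(\<lambda>m. \<integral>\<^sup>+x. ennreal ((cmod (?f m x - ?f k x))\<^sup>2) \<partial>lebesgue)
        = (\<lambda>m. ennreal ((norm (X m - X k))\<^sup>2))"
      unfolding norm_L2_nn
    proof
      fix m
      show "(\<integral>\<^sup>+x. ennreal ((cmod (?f m x - ?f k x))\<^sup>2) \<partial>lebesgue)
          = (\<integral>\<^sup>+x. ennreal ((cmod (fun_of_L2 (X m - X k) x))\<^sup>2) \<partial>lebesgue)"
        by (rule nn_integral_cong_AE, use fun_of_L2_diff[of "X m" "X k"] in eventually_elim) simp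
    qed
    also have "liminf \<dots> \<le> limsup \<dots>" by (rule Liminf_le_Limsup) simp
    also have "\<dots> \<le> ennreal (((1/4)^k)\<^sup>2)"
      by (rule Limsup_bounded, rule eventually_sequentiallyI[of k], intro ennreal_leI power_mono C) auto
    finally show ?thesis .
  qed
  have sd: "square_int (\<lambda>x. F x - ?f k x)" for k
    unfolding square_int_iff_nn using le_less_trans[OF est[of k]] by auto
  have sF: "square_int F"
    using square_int_add[OF sd fun_of_L2_square_int, of 0 "X 0"] by simp
  have "norm (L2_of F - X k) \<le> (1/4)^k" for k
  proof -
    have "L2_of F - X k = L2_of (\<lambda>x. F x - ?f k x)"
      by (simp add: L2_of_diff sF fun_of_L2_square_int)
    then have "ennreal ((norm (L2_of F - X k))\<^sup>2) \<le> ennreal (((1/4)^k)\<^sup>2)"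
      using est[of k] norm_L2_of_nn[OF sd, of k] by simp
    then have "(norm (L2_of F - X k))\<^sup>2 \<le> ((1/4)^k)\<^sup>2"
      by (subst (asm) ennreal_le_iff) auto
    then show ?thesis by (rule power2_le_imp_le) simp
  qed
  then show ?thesis by blast
qed

instance L2 :: (euclidean_space) complete_space
proof
  fix X :: "nat \<Rightarrow> 'a L2"
  assume "Cauchy X"
  then have "\<exists>N. \<forall>m\<ge>N. \<forall>n\<ge>N. norm (X m - X n) < (1/4)^k" for k
    unfolding Cauchy_def dist_norm by (simp add: power_one_over)
  then obtain N where N: "\<And>k m n. m \<ge> N k \<Longrightarrow> n \<ge> N k \<Longrightarrow> norm (X m - X n) < (1/4)^k"
    by metis
  \<comment> \<open>The sum makes \<open>R m\<close> exceed \<open>N k\<close> for every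
    \<open>k \<le> m\<close>, so the subsequence along \<open>R\<close> has the geometric rate
    required by \<open>L2_Cauchy_limit\<close>.\<close>
  define R where "R k = k + (\<Sum>j\<le>k. N j)" for k
  have RN: "N k \<le> R m" if "k \<le> m" for k m
    unfolding R_def using member_le_sum[of k "{..m}" N] that by simp
  have "norm (X (R m) - X (R k)) \<le> (1/4)^k" if "m \<ge> k" for k m
    using N[OF RN RN, of k m k] that by simp
  from L2_Cauchy_limit[of "\<lambda>k. X (R k)", OF this]
  obtain L where L: "\<And>k. norm (L - X (R k)) \<le> (1/4)^k" by blast
  have "X \<longlonglongrightarrow> L"
  proof (rule metric_LIMSEQ_I)
    fix e :: real assume "e > 0"
    then obtain k where k: "(1/4)^k < e / 2"
      using real_arch_pow_inv[of "e/2" "1/4"] by auto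
    have "dist (X n) L < e" if "n \<ge> R k" for n
    proof -
      have "norm (X n - X (R k)) < (1/4)^k"
        using N[of k n "R k"] RN[of k k] that by simp
      moreover have "norm (X (R k) - L) \<le> (1/4)^k"
        using L[of k] by (simp add: norm_minus_commute)
      ultimately show ?thesis
        using k norm_triangle_ineq[of "X n - X (R k)" "X (R k) - L"] by (simp add: dist_norm)
    qed
    then show "\<exists>no. \<forall>n\<ge>no. dist (X n) L < e" by blast
  qed
  then show "convergent X" by (rule convergentI)
qed

instance L2 :: (euclidean_space) banach ..

section \<open>Separability\<close>

text \<open>A generator of the Borel sets that is countable (for separability), stable under
  intersection (for Dynkin's theorem) and made of bounded sets (so that indicators are square
  integrable).\<close>

definition rational_boxes :: "'a::euclidean_space set set" where
  "rational_boxes = {box a b | a b. \<forall>i\<in>Basis. a \<bullet> i \<in> \<rat> \<and> b \<bullet> i \<in> \<rat>}"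

lemma countable_rational_boxes: "countable (rational_boxes :: 'a::euclidean_space set set)"
proof -
  let ?v = "\<lambda>f. \<Sum>i\<in>Basis. f i *\<^sub>R i :: 'a"
  have "rational_boxes \<subseteq> (\<lambda>(f, g). box (?v f) (?v g)) ` ((Basis \<rightarrow>\<^sub>E \<rat>) \<times> (Basis \<rightarrow>\<^sub>E \<rat>))"
  proof
    fix B :: "'a set" assume "B \<in> rational_boxes"
    then obtain a b where B: "B = box a b" and r: "\<forall>i\<in>Basis. a \<bullet> i \<in> \<rat> \<and> b \<bullet> i \<in> \<rat>"
      by (auto simp: rational_boxes_def)
    have v: "?v (restrict ((\<bullet>) c) Basis) = c" for c :: 'a
      by (simp add: euclidean_representation)
    show "B \<in> (\<lambda>(f, g). box (?v f) (?v g)) ` ((Basis \<rightarrow>\<^sub>E \<rat>) \<times> (Basis \<rightarrow>\<^sub>E \<rat>))"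
      by (rule image_eqI[where x="(restrict ((\<bullet>) a) Basis, restrict ((\<bullet>) b) Basis)"])
         (use r in \<open>auto simp: B euclidean_representation\<close>)
  qed
  then show ?thesis
    by (rule countable_subset) (intro countable_image countable_SIGMA countable_PiE countable_rat finite_Basis)
qed

lemma Int_stable_rational_boxes: "Int_stable (rational_boxes :: 'a::euclidean_space set set)"
proof (rule Int_stableI)
  fix A B :: "'a set" assume "A \<in> rational_boxes" "B \<in> rational_boxes"
  then obtain a b c d where AB: "A = box a b" "B = box c d"
    and r: "\<forall>i\<in>Basis. a \<bullet> i \<in> \<rat> \<and> b \<bullet> i \<in> \<rat>" "\<forall>i\<in>Basis. c \<bullet> i \<in> \<rat> \<and> d \<bullet> i \<in> \<rat>"
    by (auto simp: rational_boxes_def)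
  show "A \<inter> B \<in> rational_boxes"
    unfolding AB box_Int_box rational_boxes_def mem_Collect_eq
    by (intro exI conjI ballI, rule refl) (use r in \<open>auto simp: max_def min_def\<close>)
qed

lemma sets_borel_eq_rational_boxes:
  "sets (borel :: 'a::euclidean_space measure) = sigma_sets UNIV rational_boxes"
proof -
  have "M \<in> sigma_sets UNIV rational_boxes" if o: "open M" for M :: "'a set"
  proof -
    let ?v = "\<lambda>f. \<Sum>i\<in>Basis. f i *\<^sub>R i :: 'a"
    let ?I = "{f \<in> Basis \<rightarrow>\<^sub>E \<rat> \<times> \<rat>. box (?v (fst \<circ> f)) (?v (snd \<circ> f)) \<subseteq> M}"
    have M: "M = \<Union> ((\<lambda>f. box (?v (fst \<circ> f)) (?v (snd \<circ> f))) ` ?I)"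
      using open_UNION_box[OF o] by (simp add: comp_def)
    have "countable ?I"
      by (intro countable_Collect countable_PiE countable_SIGMA countable_rat finite_Basis)
    moreover have "box (?v (fst \<circ> f)) (?v (snd \<circ> f)) \<in> rational_boxes" if "f \<in> ?I" for f
      unfolding rational_boxes_def mem_Collect_eq
    proof (intro exI conjI ballI, rule refl)
      fix i :: 'a assume i: "i \<in> Basis"
      then have "f i \<in> \<rat> \<times> \<rat>" using that by (auto simp: PiE_def Pi_def)
      with i show "?v (fst \<circ> f) \<bullet> i \<in> \<rat>" "?v (snd \<circ> f) \<bullet> i \<in> \<rat>" by (auto simp: mem_Times_iff)
    qed
    ultimately show ?thesis
      by (subst M) (intro sigma_sets_UNION countable_image, auto intro: sigma_sets.Basic)
  qed
  then have "sigma_sets UNIV {S. open S} \<subseteq> sigma_sets UNIV (rational_boxes :: 'a set set)"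
    by (intro sigma_sets_mono) auto
  moreover have "sigma_sets UNIV (rational_boxes :: 'a set set) \<subseteq> sets borel"
    by (rule sets.sigma_sets_subset[of _ "borel :: 'a measure", unfolded space_borel]) (auto simp: rational_boxes_def)
  ultimately show ?thesis unfolding borel_def by (simp add: subset_antisym)
qed

lemma sum_indicator_fibres:
  fixes s :: "'a \<Rightarrow> 'b::real_vector"
  assumes "finite (range s)"
  shows "(\<Sum>v\<in>range s. indicator (s -` {v}) x *\<^sub>R v) = s x"
proof -
  have "(\<Sum>v\<in>range s. indicator (s -` {v}) x *\<^sub>R v) = (\<Sum>v\<in>range s. if v = s x then v else 0)"
    by (rule sum.cong) (auto simp: indicator_def)
  also have "\<dots> = s x" using assms by (simp add: sum.delta')
  finally show ?thesis .
qed

text \<open>Sections of a Lebesgue measurable function on a product are measurable for almost every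
  parameter only, those of a Borel function for all. Fubini arguments are therefore run on such a
  representative, obtained from real and imaginary parts.\<close>

lemma lebesgue_ex_borel:
  fixes f :: "'a::euclidean_space \<Rightarrow> complex"
  assumes f: "f \<in> borel_measurable lebesgue"
  shows "\<exists>g\<in>borel_measurable borel. AE x in lebesgue. f x = g x"
proof -
  have "(\<lambda>x. Re (f x)) \<in> borel_measurable lebesgue" "(\<lambda>x. Im (f x)) \<in> borel_measurable lebesgue"
    using f by measurable
  from this[THEN completion_ex_borel_measurable_real]
  obtain u v where [measurable]: "u \<in> borel_measurable lborel" "v \<in> borel_measurable lborel"
    and ae: "AE x in lborel. Re (f x) = u x" "AE x in lborel. Im (f x) = v x"
    by blast
  show ?thesis
  proof (rule bexI[of _ "\<lambda>x. Complex (u x) (v x)"])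
    have "u \<in> borel_measurable borel" "v \<in> borel_measurable borel" by simp_all
    then show "(\<lambda>x. Complex (u x) (v x)) \<in> borel_measurable borel"
      unfolding Complex_eq by measurable
    show "AE x in lebesgue. f x = Complex (u x) (v x)"
      using ae[THEN AE_completion] by eventually_elim (simp add: complex_eq_iff)
  qed
qed

lemma square_int_indicator:
  assumes "A \<in> sets lebesgue" "bounded A"
  shows "square_int (\<lambda>x. c * indicator A x)"
proof -
  have "A \<in> lmeasurable" using assms by (intro bounded_set_imp_lmeasurable)
  then have "integrable lebesgue (indicator A :: _ \<Rightarrow> real)"
    by (auto simp: integrable_real_indicator fmeasurable_def)
  moreover have "(cmod (c * indicator A x))\<^sup>2 = (cmod c)\<^sup>2 * indicator A x" for x
    by (simp add: norm_mult power_mult_distrib indicator_def)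
  ultimately show ?thesis
    using assms by (auto simp: square_int_def)
qed

abbreviation cube :: "nat \<Rightarrow> 'a::euclidean_space set" where
  "cube n \<equiv> box (- (real n *\<^sub>R One)) (real n *\<^sub>R One)"

lemma cube_rational_box: "cube n \<in> rational_boxes"
  unfolding rational_boxes_def mem_Collect_eq by (intro exI conjI ballI, rule refl) auto

lemma mem_cube_eventually: "\<exists>N. \<forall>n\<ge>N. (x::'a::euclidean_space) \<in> cube n"
proof -
  obtain N :: nat where N: "norm x < real N" using reals_Archimedean2 by blast
  have "x \<in> cube n" if "n \<ge> N" for n
    unfolding mem_box
  proof
    fix i :: 'a assume i: "i \<in> Basis"
    have "\<bar>x \<bullet> i\<bar> < real n" using Basis_le_norm[OF i, of x] N that by linarith
    then show "- (real n *\<^sub>R One) \<bullet> i < x \<bullet> i \<and> x \<bullet> i < real n *\<^sub>R One \<bullet> i"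
      using i by auto
  qed
  then show ?thesis by blast
qed

text \<open>Dynkin's theorem passes from boxes to Borel sets, each intersected with a cube so that
  complements keep finite measure; simple functions and dominated convergence do the rest. The
  coefficient \<open>c\<close> is part of the hypothesis because \<open>subspace\<close> is meant
  over the reals.\<close>

lemma L2_total:
  fixes M :: "'a::euclidean_space L2 set"
  assumes cl: "closed M" and sub: "subspace M"
    and boxes: "\<And>c A. A \<in> rational_boxes \<Longrightarrow> L2_of (\<lambda>x. c * indicator A x) \<in> M"
  shows "f \<in> M"
proof -
  have bounded_Int: "bounded (A \<inter> cube n)" for n and A :: "'a set"
    by (rule bounded_subset[OF bounded_box]) auto
  have sq: "square_int (\<lambda>x. c * indicator (A \<inter> cube n) x)" if "A \<in> sets borel" for c n and A :: "'a set"
    using that by (intro square_int_indicator bounded_Int) auto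
  have ind: "L2_of (\<lambda>x. c * indicator (A \<inter> cube n) x) \<in> M" if "A \<in> sets borel" for c n and A :: "'a set"
  proof -
    have A: "A \<in> sigma_sets UNIV rational_boxes" using that by (simp add: sets_borel_eq_rational_boxes)
    have "rational_boxes \<subseteq> Pow (UNIV :: 'a set)" by simp
    from Int_stable_rational_boxes this A show ?thesis
    proof (induction rule: sigma_sets_induct_disjoint)
      case (basic A)
      then have "A \<inter> cube n \<in> rational_boxes"
        using Int_stable_rational_boxes cube_rational_box unfolding Int_stable_def by blast
      then show ?case by (rule boxes)
    next
      case empty
      then show ?case using subspace_0[OF sub] by (simp add: L2_of_zero)
    next
      case (compl A)
      then have A: "A \<in> sets borel" by (simp add: sets_borel_eq_rational_boxes)
      have "(\<lambda>x. c * indicator ((UNIV - A) \<inter> cube n) x)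
          = (\<lambda>x. c * indicator ((UNIV :: 'a set) \<inter> cube n) x - c * indicator (A \<inter> cube n) x)"
        by (auto simp: indicator_def)
      then have "L2_of (\<lambda>x. c * indicator ((UNIV - A) \<inter> cube n) x)
          = L2_of (\<lambda>x. c * indicator ((UNIV :: 'a set) \<inter> cube n) x) - L2_of (\<lambda>x. c * indicator (A \<inter> cube n) x)"
        using A by (simp only: L2_of_diff[OF sq sq] sets.top space_borel[symmetric])
      then show ?case
        using compl boxes[OF cube_rational_box] by (simp add: subspace_diff[OF sub])
    next
      case (union A)
      then have A: "A i \<in> sets borel" for i by (auto simp: sets_borel_eq_rational_boxes)
      have part: "L2_of (\<lambda>x. c * indicator ((\<Union>i<m. A i) \<inter> cube n) x) \<in> M" for m
      proof (induction m)
        case 0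
        then show ?case using subspace_0[OF sub] by (simp add: L2_of_zero)
      next
        case (Suc m)
        have "A i \<inter> A m = {}" if "i < m" for i
          using that \<open>disjoint_family A\<close> unfolding disjoint_family_on_def by (metis UNIV_I less_irrefl)
        then have dis: "x \<notin> (\<Union>i<m. A i)" if "x \<in> A m" for x
          using that by blast
        have "(\<lambda>x. c * indicator ((\<Union>i<Suc m. A i) \<inter> cube n) x)
          = (\<lambda>x. c * indicator ((\<Union>i<m. A i) \<inter> cube n) x + c * indicator (A m \<inter> cube n) x)"
        proof
          fix x
          show "c * indicator ((\<Union>i<Suc m. A i) \<inter> cube n) x
            = c * indicator ((\<Union>i<m. A i) \<inter> cube n) x + c * indicator (A m \<inter> cube n) x"
            using dis[of x] by (cases "x \<in> A m") (simp_all add: lessThan_Suc indicator_def)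
        qed
        moreover have "(\<Union>i<m. A i) \<in> sets borel" using A by auto
        ultimately show ?case
          using Suc union(3)[of m] A by (simp add: L2_of_add[OF sq sq] subspace_add[OF sub])
      qed
      have "(\<lambda>m. L2_of (\<lambda>x. c * indicator ((\<Union>i<m. A i) \<inter> cube n) x))
          \<longlonglongrightarrow> L2_of (\<lambda>x. c * indicator ((\<Union>i. A i) \<inter> cube n) x)"
      proof (rule L2_dominated(2))
        show "square_int (\<lambda>x. c * indicator ((UNIV :: 'a set) \<inter> cube n) x)" by (rule sq) simp
        show "(\<lambda>x. c * indicator ((\<Union>i<m. A i) \<inter> cube n) x) \<in> borel_measurable lebesgue" for m
          using A by (intro square_int_measurable sq) auto
        show "(\<lambda>x. c * indicator ((\<Union>i. A i) \<inter> cube n) x) \<in> borel_measurable lebesgue"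
          using A by (intro square_int_measurable sq) auto
        show "AE x in lebesgue. (\<lambda>m. c * indicator ((\<Union>i<m. A i) \<inter> cube n) x)
            \<longlonglongrightarrow> c * indicator ((\<Union>i. A i) \<inter> cube n) x"
          unfolding indicator_inter_arith by (intro AE_I2 tendsto_intros LIMSEQ_indicator_UN)
      qed (auto simp: indicator_def)
      then show ?case by (rule closed_sequentially[OF cl part])
    qed
  qed
  obtain g where g[measurable]: "g \<in> borel_measurable borel" and fg: "AE x in lebesgue. fun_of_L2 f x = g x"
    using lebesgue_ex_borel[OF fun_of_L2_measurable] by blast
  have sg: "square_int g" by (rule square_int_cong_AE[OF fun_of_L2_square_int fg])
  have f: "f = L2_of g"
    using L2_of_cong[OF fun_of_L2_square_int sg fg] by simp
  from borel_measurable_implies_sequence_metric[OF g, of 0]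
  obtain s where s: "\<And>i. simple_function borel (s i)" "\<And>x. (\<lambda>i. s i x) \<longlonglongrightarrow> g x"
    and bd: "\<And>i x. cmod (s i x) \<le> 2 * cmod (g x)"
    by auto
  \<comment> \<open>Cutting the simple function off to \<open>cube i\<close> turns each summand into
    one of the indicators covered by \<open>ind\<close>; the bound \<open>2 * cmod (g x)\<close>
    survives.\<close>
  define t where "t i x = (\<Sum>v\<in>range (s i). v * indicator (s i -` {v} \<inter> cube i) x)" for i x
  have fin: "finite (range (s i))" for i using simple_functionD(1)[OF s(1)[of i]] by simp
  have fib: "s i -` {v} \<in> sets borel" for i v using simple_functionD(2)[OF s(1)[of i], of "{v}"] by simp
  have t_eq: "t i x = indicator (cube i) x * s i x" for i x
  proof -
    have "t i x = indicator (cube i) x * (\<Sum>v\<in>range (s i). indicator (s i -` {v}) x *\<^sub>R v)"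
      unfolding t_def sum_distrib_left by (rule sum.cong) (auto simp: indicator_def)
    then show ?thesis by (simp add: sum_indicator_fibres[OF fin])
  qed
  have sum: "square_int (\<lambda>x. \<Sum>v\<in>B. v * indicator (s i -` {v} \<inter> cube i) x) \<and>
      L2_of (\<lambda>x. \<Sum>v\<in>B. v * indicator (s i -` {v} \<inter> cube i) x) \<in> M" if "finite B" for B i
    using that
  proof induction
    case empty
    then show ?case using subspace_0[OF sub] by (simp add: L2_of_zero)
  next
    case (insert v B)
    then have IH: "square_int (\<lambda>x. \<Sum>v\<in>B. v * indicator (s i -` {v} \<inter> cube i) x)"
      "L2_of (\<lambda>x. \<Sum>v\<in>B. v * indicator (s i -` {v} \<inter> cube i) x) \<in> M"
      by blast+
    have "square_int (\<lambda>x. v * indicator (s i -` {v} \<inter> cube i) x + (\<Sum>v\<in>B. v * indicator (s i -` {v} \<inter> cube i) x))"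
      by (rule square_int_add[OF sq[OF fib] IH(1)])
    moreover have "L2_of (\<lambda>x. v * indicator (s i -` {v} \<inter> cube i) x + (\<Sum>v\<in>B. v * indicator (s i -` {v} \<inter> cube i) x)) \<in> M"
      unfolding L2_of_add[OF sq[OF fib] IH(1)] by (rule subspace_add[OF sub ind[OF fib] IH(2)])
    ultimately show ?case unfolding sum.insert[OF insert(1,2)] by blast
  qed
  have "(\<lambda>i. L2_of (t i)) \<longlonglongrightarrow> L2_of g"
  proof (rule L2_dominated(2))
    show "square_int (\<lambda>x. 2 * g x)" by (rule square_int_scale[OF sg])
    show "t i \<in> borel_measurable lebesgue" for i
      using sum[OF fin, of i] unfolding t_def by (intro square_int_measurable) auto
    show "g \<in> borel_measurable lebesgue" by (rule square_int_measurable[OF sg])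
    show "AE x in lebesgue. (\<lambda>i. t i x) \<longlonglongrightarrow> g x"
    proof (rule AE_I2)
      fix x :: 'a
      obtain N where "\<forall>n\<ge>N. x \<in> cube n" using mem_cube_eventually by blast
      then have "eventually (\<lambda>i. s i x = t i x) sequentially"
        by (intro eventually_sequentiallyI[of N]) (simp add: t_eq)
      then show "(\<lambda>i. t i x) \<longlonglongrightarrow> g x" by (rule Lim_transform_eventually[OF s(2)])
    qed
    show "AE x in lebesgue. cmod (t i x) \<le> cmod (2 * g x)" for i
      using bd[of i] by (auto simp: t_eq norm_mult indicator_def)
  qed
  then show "f \<in> M"
    unfolding f by (rule closed_sequentially[OF cl, rotated]) (use sum[OF fin] in \<open>simp add: t_def[abs_def]\<close>)
qed

lemma L2_total_UNIV:
  fixes M :: "'a::euclidean_space L2 set"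
  assumes "closed M" "subspace M"
    and "\<And>c A. A \<in> rational_boxes \<Longrightarrow> L2_of (\<lambda>x. c * indicator A x) \<in> M"
  shows "M = UNIV"
  using L2_total[OF assms] by auto

lemma L2_countable_dense: "\<exists>D :: 'a::euclidean_space L2 set. countable D \<and> closure D = UNIV"
proof -
  \<comment> \<open>Both coefficients 1 and \<open>\<i>\<close> occur because \<open>D\<close>
    consists of combinations with rational real coefficients.\<close>
  define E :: "'a L2 set" where
    "E = (\<lambda>(c, A). L2_of (\<lambda>x. c * indicator A x)) ` ({1, \<i>} \<times> rational_boxes)"
  define D where "D = (\<lambda>xs. sum_list (map (\<lambda>(q, e). q *\<^sub>R e) xs)) ` lists ((\<rat> :: real set) \<times> E)"
  have cE: "countable E"
    unfolding E_def by (intro countable_image countable_SIGMA countable_rational_boxes) auto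
  have cD: "countable D"
    unfolding D_def by (intro countable_image countable_lists countable_SIGMA countable_rat cE)
  have D_add: "u + v \<in> D" if "u \<in> D" "v \<in> D" for u v
  proof -
    from that obtain xs ys where "xs \<in> lists (\<rat> \<times> E)" "ys \<in> lists (\<rat> \<times> E)"
      and "u = sum_list (map (\<lambda>(q, e). q *\<^sub>R e) xs)" "v = sum_list (map (\<lambda>(q, e). q *\<^sub>R e) ys)"
      unfolding D_def by blast
    then show ?thesis unfolding D_def by (intro image_eqI[of _ _ "xs @ ys"]) auto
  qed
  have D_scale: "q *\<^sub>R u \<in> D" if q: "q \<in> \<rat>" and "u \<in> D" for q u
  proof -
    from that obtain xs where xs: "xs \<in> lists (\<rat> \<times> E)" "u = sum_list (map (\<lambda>(q, e). q *\<^sub>R e) xs)"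
      unfolding D_def by blast
    have "q *\<^sub>R u = sum_list (map (\<lambda>(q, e). q *\<^sub>R e) (map (\<lambda>(p, e). (q * p, e)) xs))"
      unfolding xs(2) by (induction xs) (auto simp: scaleR_right_distrib)
    moreover have "map (\<lambda>(p, e). (q * p, e)) xs \<in> lists (\<rat> \<times> E)"
      using xs(1) q by (auto simp: in_lists_conv_set intro: Rats_mult)
    ultimately show ?thesis unfolding D_def by blast
  qed
  have D0: "0 \<in> D" unfolding D_def by (rule image_eqI[of _ _ "[]"]) auto
  have ED: "E \<subseteq> D"
  proof
    fix e assume "e \<in> E"
    then show "e \<in> D" unfolding D_def by (intro image_eqI[of _ _ "[(1, e)]"]) auto
  qed
  have "subspace (closure D)"
    unfolding subspace_def
  proof safe
    show "0 \<in> closure D" using D0 closure_subset by blast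
    fix u v assume "u \<in> closure D" "v \<in> closure D"
    then obtain a b where "\<forall>n. a n \<in> D" "a \<longlonglongrightarrow> u" "\<forall>n. b n \<in> D" "b \<longlonglongrightarrow> v"
      unfolding closure_sequential by blast
    then show "u + v \<in> closure D"
      unfolding closure_sequential by (intro exI[of _ "\<lambda>n. a n + b n"]) (auto intro: D_add tendsto_add)
  next
    fix r :: real and u assume "u \<in> closure D"
    then obtain a where a: "\<forall>n. a n \<in> D" "a \<longlonglongrightarrow> u"
      unfolding closure_sequential by blast
    \<comment> \<open>A real multiple of a limit of points of \<open>D\<close> is the limit of
      rational multiples of those points.\<close>
    have "r \<in> closure \<rat>" by (simp add: Rats_closure_real)
    then obtain q where q: "\<forall>n. q n \<in> \<rat>" "q \<longlonglongrightarrow> r"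
      unfolding closure_sequential by blast
    show "r *\<^sub>R u \<in> closure D"
      unfolding closure_sequential
      by (rule exI[of _ "\<lambda>n. q n *\<^sub>R a n"]) (use a q in \<open>auto intro: D_scale tendsto_scaleR\<close>)
  qed
  then have "closure D = UNIV"
  proof (rule L2_total_UNIV[OF closed_closure])
    fix c :: complex and A :: "'a set" assume A: "A \<in> rational_boxes"
    then have "A \<in> sets lebesgue" "bounded A" unfolding rational_boxes_def by auto
    note sq = square_int_indicator[OF this]
    have "L2_of (\<lambda>x. c * indicator A x)
        = L2_of (\<lambda>x. of_real (Re c) * (1 * indicator A x) + of_real (Im c) * (\<i> * indicator A x))"
      by (rule arg_cong[of _ _ L2_of], rule ext) (simp add: complex_eq_iff indicator_def)
    also have "\<dots> = Re c *\<^sub>R L2_of (\<lambda>x. 1 * indicator A x) + Im c *\<^sub>R L2_of (\<lambda>x. \<i> * indicator A x)"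
      by (simp only: L2_of_add[OF square_int_scale[OF sq] square_int_scale[OF sq]] L2_of_scaleC[OF sq] scaleR_L2_eq)
    also have "\<dots> \<in> closure D"
    proof (intro subspace_add subspace_scale \<open>subspace (closure D)\<close>)
      have "L2_of (\<lambda>x. 1 * indicator A x) \<in> E" "L2_of (\<lambda>x. \<i> * indicator A x) \<in> E"
        unfolding E_def using A by force+
      then show "L2_of (\<lambda>x. 1 * indicator A x) \<in> closure D" "L2_of (\<lambda>x. \<i> * indicator A x) \<in> closure D"
        using ED closure_subset by blast+
    qed
    finally show "L2_of (\<lambda>x. c * indicator A x) \<in> closure D" .
  qed
  with cD show ?thesis by blast
qed

text \<open>For countable \<open>D\<close> this is a countable union, so topology and measurability
  are controlled by balls with centre in \<open>D\<close> and radius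
  \<open>1 / Suc n\<close>.\<close>

lemma open_eq_Union_balls:
  fixes D S :: "'b::metric_space set"
  assumes D: "closure D = UNIV" and S: "open S"
  shows "S = (\<Union>(d, n)\<in>{(d, n). d \<in> D \<and> ball d (1 / real (Suc n)) \<subseteq> S}. ball d (1 / real (Suc n)))"
proof (intro equalityI subsetI)
  let ?I = "{(d, n). d \<in> D \<and> ball d (1 / real (Suc n)) \<subseteq> S}"
  fix f assume "f \<in> S"
  then obtain e where e: "e > 0" "ball f e \<subseteq> S" using S by (meson openE)
  \<comment> \<open>With radius below \<open>e / 2\<close> the ball around a nearby \<open>d\<close>
    contains \<open>f\<close> and still lies in \<open>ball f e\<close>.\<close>
  obtain n where n: "1 / real (Suc n) < e / 2"
    using nat_approx_posE[of "e/2"] e by auto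
  have "f \<in> closure D" using D by simp
  moreover have "1 / real (Suc n) > 0" by simp
  ultimately obtain d where d: "d \<in> D" "dist d f < 1 / real (Suc n)"
    unfolding closure_approachable by blast
  have "ball d (1 / real (Suc n)) \<subseteq> ball f e"
  proof
    fix g assume "g \<in> ball d (1 / real (Suc n))"
    then show "g \<in> ball f e"
      using d n dist_triangle[of f g d] by (simp add: dist_commute)
  qed
  then show "f \<in> (\<Union>(d, n)\<in>?I. ball d (1 / real (Suc n)))"
    using d e by (intro UN_I[of "(d, n)"]) auto
qed auto

text \<open>Measurability of sums and differences of \<open>L2\<close>-valued functions rests on
  second countability of the range.\<close>

instance L2 :: (euclidean_space) second_countable_topology
proof
  obtain D :: "'a L2 set" where D: "countable D" "closure D = UNIV"
    using L2_countable_dense by blast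
  let ?B = "(\<lambda>(d, n). ball d (1 / real (Suc n))) ` (D \<times> UNIV)"
  have "topological_basis ?B"
  proof (rule topological_basisI)
    fix S :: "'a L2 set" and f assume "open S" "f \<in> S"
    then have "f \<in> (\<Union>(d, n)\<in>{(d, n). d \<in> D \<and> ball d (1 / real (Suc n)) \<subseteq> S}. ball d (1 / real (Suc n)))"
      using open_eq_Union_balls[OF D(2)] by blast
    then show "\<exists>B'\<in>?B. f \<in> B' \<and> B' \<subseteq> S" by blast
  qed auto
  then have "open = generate_topology ?B" by (rule topological_basis_imp_subbasis)
  moreover have "countable ?B" using D by (intro countable_image countable_SIGMA) auto
  ultimately show "\<exists>B::'a L2 set set. countable B \<and> open = generate_topology B" by blast
qed

section \<open>Sections of square-integrable functions on a product\<close>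

text \<open>Completeness of the Lebesgue measure: the preimages under \<open>f\<close> and
  \<open>g\<close> differ by a subset of a null set. The range is a general topological space, so
  that the lemma can serve real, extended and \<open>L2\<close> values alike.\<close>

lemma borel_measurable_lebesgue_AE:
  fixes f g :: "'a::euclidean_space \<Rightarrow> 'b::topological_space"
  assumes f: "f \<in> borel_measurable lebesgue" and ae: "AE x in lebesgue. f x = g x"
  shows "g \<in> borel_measurable lebesgue"
proof (rule borel_measurableI)
  fix S :: "'b set" assume "open S"
  obtain N where N: "N \<in> null_sets lebesgue" "\<And>x. x \<notin> N \<Longrightarrow> f x = g x"
    using ae unfolding completion.AE_iff_null_sets by auto
  have "g -` S = (f -` S - N) \<union> (g -` S \<inter> N)" using N(2) by auto
  moreover have "f -` S \<in> sets lebesgue"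
    using measurable_sets[OF f, of S] \<open>open S\<close> by simp
  moreover have "g -` S \<inter> N \<in> sets lebesgue"
    by (rule completion.complete[OF _ N(1)]) auto
  ultimately have "g -` S \<in> sets lebesgue"
    using null_setsD2[OF N(1)] by (metis sets.Diff sets.Un)
  then show "g -` S \<inter> space lebesgue \<in> sets lebesgue" by simp
qed

lemma L2_on_iff_L2_of:
  assumes "square_int f"
  shows "L2_of f \<in> L2_on S \<longleftrightarrow> (AE x in lebesgue. x \<notin> S \<longrightarrow> f x = 0)"
proof -
  show ?thesis
    unfolding L2_on_def mem_Collect_eq
  proof
    assume "AE x in lebesgue. x \<notin> S \<longrightarrow> fun_of_L2 (L2_of f) x = 0"
    with fun_of_L2_of[OF assms] show "AE x in lebesgue. x \<notin> S \<longrightarrow> f x = 0" by eventually_elim simp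
  next
    assume "AE x in lebesgue. x \<notin> S \<longrightarrow> f x = 0"
    with fun_of_L2_of[OF assms] show "AE x in lebesgue. x \<notin> S \<longrightarrow> fun_of_L2 (L2_of f) x = 0"
      by eventually_elim simp
  qed
qed

lemma L2_on_zero [simp]: "0 \<in> L2_on S"
  unfolding L2_on_def using fun_of_L2_zero by auto

lemma L2_on_add:
  assumes "f \<in> L2_on S" "g \<in> L2_on S"
  shows "f + g \<in> L2_on S"
  using assms fun_of_L2_add[of f g] unfolding L2_on_def mem_Collect_eq
  by eventually_elim simp

lemma L2_on_scaleC:
  assumes "f \<in> L2_on S"
  shows "c *\<^sub>C f \<in> L2_on S"
  using assms fun_of_L2_scaleC[of c f] unfolding L2_on_def mem_Collect_eq
  by eventually_elim simp

text \<open>The orthogonal projection onto \<open>L2_on A\<close>. Membership in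
  \<open>L2_on A\<close> becomes a fixed-point equation for a bounded linear map, which yields
  closedness and can be tested slice by slice.\<close>

definition mask :: "'a::euclidean_space set \<Rightarrow> 'a L2 \<Rightarrow> 'a L2" where
  "mask A f = L2_of (\<lambda>x. indicator A x * fun_of_L2 f x)"

context
  fixes A :: "'a::euclidean_space set"
  assumes A [measurable]: "A \<in> sets lebesgue"
begin

lemma square_int_mask: "square_int (\<lambda>x. indicator A x * fun_of_L2 f x)"
  by (rule square_int_bound[OF fun_of_L2_square_int[of f]]) (auto simp: indicator_def)

lemma fun_of_L2_mask: "AE x in lebesgue. fun_of_L2 (mask A f) x = indicator A x * fun_of_L2 f x"
  unfolding mask_def by (rule fun_of_L2_of[OF square_int_mask])

lemma mask_add: "mask A (f + g) = mask A f + mask A g"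
proof (rule L2_eqI)
  show "AE x in lebesgue. fun_of_L2 (mask A (f + g)) x = fun_of_L2 (mask A f + mask A g) x"
    using fun_of_L2_mask[of "f + g"] fun_of_L2_mask[of f] fun_of_L2_mask[of g] fun_of_L2_add[of f g]
      fun_of_L2_add[of "mask A f" "mask A g"]
    by eventually_elim (simp add: distrib_left)
qed

lemma mask_scaleC: "mask A (c *\<^sub>C f) = c *\<^sub>C mask A f"
proof (rule L2_eqI)
  show "AE x in lebesgue. fun_of_L2 (mask A (c *\<^sub>C f)) x = fun_of_L2 (c *\<^sub>C mask A f) x"
    using fun_of_L2_mask[of "c *\<^sub>C f"] fun_of_L2_mask[of f] fun_of_L2_scaleC[of c f]
      fun_of_L2_scaleC[of c "mask A f"]
    by eventually_elim simp
qed

lemma norm_mask_le: "norm (mask A f) \<le> norm f"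
proof -
  have "ennreal ((norm (mask A f))\<^sup>2) \<le> ennreal ((norm f)\<^sup>2)"
    unfolding norm_L2_nn
  proof (rule nn_integral_mono_AE, use fun_of_L2_mask[of f] in eventually_elim)
    case (elim x)
    then show ?case by (auto simp: indicator_def intro!: ennreal_leI)
  qed
  then have "(norm (mask A f))\<^sup>2 \<le> (norm f)\<^sup>2" by (subst (asm) ennreal_le_iff) auto
  then show ?thesis by (rule power2_le_imp_le) simp
qed

lemma bounded_linear_mask: "bounded_linear (mask A)"
  by (rule bounded_linear_intro[where K=1])
     (simp_all add: mask_add mask_scaleC scaleR_L2_eq norm_mask_le)

lemma mask_in_L2_on: "mask A f \<in> L2_on A"
  unfolding L2_on_def mem_Collect_eq using fun_of_L2_mask[of f] by eventually_elim simp

lemma mask_eq_iff: "mask A f = f \<longleftrightarrow> f \<in> L2_on A"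
proof
  assume "f \<in> L2_on A"
  then have "AE x in lebesgue. x \<notin> A \<longrightarrow> fun_of_L2 f x = 0" by (simp add: L2_on_def)
  with fun_of_L2_mask[of f] have "AE x in lebesgue. fun_of_L2 (mask A f) x = fun_of_L2 f x"
    by eventually_elim (auto simp: indicator_def)
  then show "mask A f = f" by (rule L2_eqI)
qed (metis mask_in_L2_on)

lemma closed_L2_on: "closed (L2_on A)"
proof -
  have "L2_on A = {f. mask A f = f}" by (auto simp: mask_eq_iff)
  also have "closed \<dots>"
    by (intro closed_Collect_eq linear_continuous_on continuous_on_id bounded_linear_mask)
  finally show ?thesis .
qed

end

section \<open>Fubini for the completed Lebesgue measure\<close>

lemma AE_lebesgue_prod:
  assumes "AE p in lebesgue. P (p :: 'a::euclidean_space \<times> 'b::euclidean_space)"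
  shows "AE x in lebesgue. AE y in lebesgue. P (x, y)"
proof -
  have "AE p in (lborel :: ('a \<times> 'b) measure). P p" using assms by (simp add: AE_completion_iff)
  then have "AE p in lborel \<Otimes>\<^sub>M lborel. P p" by (subst lborel_prod)
  from lborel_pair.AE_pair[OF this] show ?thesis by (simp add: AE_completion_iff)
qed

lemma null_sets_snd:
  assumes "N \<in> null_sets (lborel :: 'b::euclidean_space measure)"
  shows "UNIV \<times> N \<in> null_sets (lborel :: ('a::euclidean_space \<times> 'b) measure)"
  using assms unfolding lborel_prod[symmetric] by (intro lborel.times_in_null_sets2) auto

lemma null_sets_fst:
  assumes "N \<in> null_sets (lborel :: 'a::euclidean_space measure)"
  shows "N \<times> UNIV \<in> null_sets (lborel :: ('a \<times> 'b::euclidean_space) measure)"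
  using assms unfolding lborel_prod[symmetric] by (intro lborel.times_in_null_sets1) auto

text \<open>Between completed measures, measurability also demands that preimages of null sets be
  null; for a projection this is \<open>null_sets_snd\<close>.\<close>

lemma measurable_lebesgue_snd [measurable]:
  "(snd :: 'a::euclidean_space \<times> 'b::euclidean_space \<Rightarrow> 'b) \<in> lebesgue \<rightarrow>\<^sub>M lebesgue"
proof (rule completion.measurable_completion2)
  show m: "(snd :: 'a \<times> 'b \<Rightarrow> 'b) \<in> lebesgue \<rightarrow>\<^sub>M lborel"
    by (rule measurable_completion) (use borel_measurable_continuous_onI[OF continuous_on_snd[OF continuous_on_id]] in simp)
  show "null_sets lborel \<subseteq> null_sets (distr lebesgue lborel (snd :: 'a \<times> 'b \<Rightarrow> 'b))"
  proof
    fix N assume N: "N \<in> null_sets (lborel :: 'b measure)"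
    have "snd -` N = (UNIV :: 'a set) \<times> N" by auto
    with N null_sets_completionI[OF null_sets_snd[OF N, where ?'a='a]]
    show "N \<in> null_sets (distr lebesgue lborel (snd :: 'a \<times> 'b \<Rightarrow> 'b))"
      using m by (auto simp: null_sets_def emeasure_distr)
  qed
qed

lemma measurable_lebesgue_fst [measurable]:
  "(fst :: 'a::euclidean_space \<times> 'b::euclidean_space \<Rightarrow> 'a) \<in> lebesgue \<rightarrow>\<^sub>M lebesgue"
proof (rule completion.measurable_completion2)
  show m: "(fst :: 'a \<times> 'b \<Rightarrow> 'a) \<in> lebesgue \<rightarrow>\<^sub>M lborel"
    by (rule measurable_completion) (use borel_measurable_continuous_onI[OF continuous_on_fst[OF continuous_on_id]] in simp)
  show "null_sets lborel \<subseteq> null_sets (distr lebesgue lborel (fst :: 'a \<times> 'b \<Rightarrow> 'a))"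
  proof
    fix N assume N: "N \<in> null_sets (lborel :: 'a measure)"
    have "fst -` N = N \<times> (UNIV :: 'b set)" by auto
    with N null_sets_completionI[OF null_sets_fst[OF N, where ?'b='b]]
    show "N \<in> null_sets (distr lebesgue lborel (fst :: 'a \<times> 'b \<Rightarrow> 'a))"
      using m by (auto simp: null_sets_def emeasure_distr)
  qed
qed

text \<open>The measure \<open>lebesgue\<close> on a product is the completion of the product measure, so Fubini
  is applied to a Borel representative.\<close>

lemma nn_integral_lebesgue_prod:
  fixes f :: "'a::euclidean_space \<times> 'b::euclidean_space \<Rightarrow> ennreal"
  assumes "f \<in> borel_measurable lebesgue"
  shows "(\<integral>\<^sup>+p. f p \<partial>lebesgue) = (\<integral>\<^sup>+x. \<integral>\<^sup>+y. f (x, y) \<partial>lebesgue \<partial>lebesgue)"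
    and "(\<lambda>x. \<integral>\<^sup>+y. f (x, y) \<partial>lebesgue) \<in> borel_measurable lebesgue"
proof -
  obtain g where g: "g \<in> borel_measurable lborel" and ae: "AE p in lborel. f p = g p"
    using completion_ex_borel_measurable[OF assms] by blast
  then have g': "g \<in> borel_measurable (lborel \<Otimes>\<^sub>M lborel)" by (simp only: lborel_prod)
  have AE: "AE x in lebesgue. (\<integral>\<^sup>+y. g (x, y) \<partial>lebesgue) = (\<integral>\<^sup>+y. f (x, y) \<partial>lebesgue)"
    using AE_lebesgue_prod[OF AE_completion[OF ae]]
  proof eventually_elim
    case (elim x)
    then show ?case by (intro nn_integral_cong_AE) auto
  qed
  have "(\<integral>\<^sup>+p. f p \<partial>lebesgue) = (\<integral>\<^sup>+p. g p \<partial>lborel)"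
    unfolding nn_integral_completion by (rule nn_integral_cong_AE[OF ae])
  also have "\<dots> = (\<integral>\<^sup>+x. \<integral>\<^sup>+y. g (x, y) \<partial>lborel \<partial>lborel)"
    by (simp only: lborel.nn_integral_fst[OF g'] lborel_prod)
  also have "\<dots> = (\<integral>\<^sup>+x. \<integral>\<^sup>+y. g (x, y) \<partial>lebesgue \<partial>lebesgue)"
    by (simp only: nn_integral_completion)
  also have "\<dots> = (\<integral>\<^sup>+x. \<integral>\<^sup>+y. f (x, y) \<partial>lebesgue \<partial>lebesgue)"
    by (rule nn_integral_cong_AE[OF AE])
  finally show "(\<integral>\<^sup>+p. f p \<partial>lebesgue) = (\<integral>\<^sup>+x. \<integral>\<^sup>+y. f (x, y) \<partial>lebesgue \<partial>lebesgue)" .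
  have "(\<lambda>x. \<integral>\<^sup>+y. g (x, y) \<partial>lebesgue) \<in> borel_measurable lborel"
    unfolding nn_integral_completion by (rule lborel.borel_measurable_nn_integral_fst[OF g'])
  then show "(\<lambda>x. \<integral>\<^sup>+y. f (x, y) \<partial>lebesgue) \<in> borel_measurable lebesgue"
    by (intro borel_measurable_lebesgue_AE[OF measurable_completion AE])
qed

lemma square_int_slices:
  fixes \<phi> :: "'b::euclidean_space \<times> 'a::euclidean_space \<Rightarrow> complex"
  assumes "square_int \<phi>"
  shows "AE x in lebesgue. square_int (\<lambda>y. \<phi> (x, y))"
proof -
  obtain g where g: "g \<in> borel_measurable borel" and fg: "AE x in lebesgue. \<phi> x = g x"
    using lebesgue_ex_borel[OF square_int_measurable[OF assms]] by blast
  \<comment> \<open>All sections of the Borel representative are measurable; a section of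
    \<open>\<phi>\<close> inherits this where it agrees almost everywhere with that of
    \<open>g\<close>.\<close>
  have gm: "(\<lambda>y. g (x, y)) \<in> borel_measurable lebesgue" for x
  proof (rule measurable_completion)
    have "(\<lambda>y. (x, y)) \<in> borel_measurable (borel :: 'a measure)"
      by (intro borel_measurable_continuous_onI continuous_intros)
    from measurable_compose[OF this g] show "(\<lambda>y. g (x, y)) \<in> borel_measurable lborel" by simp
  qed
  have m: "(\<lambda>p. ennreal ((cmod (\<phi> p))\<^sup>2)) \<in> borel_measurable lebesgue"
    using square_int_measurable[OF assms] by measurable
  have "(\<integral>\<^sup>+x. \<integral>\<^sup>+y. ennreal ((cmod (\<phi> (x, y)))\<^sup>2) \<partial>lebesgue \<partial>lebesgue) \<noteq> \<infinity>"
    using assms unfolding nn_integral_lebesgue_prod(1)[OF m, symmetric] square_int_iff_nn by auto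
  from nn_integral_PInf_AE[OF nn_integral_lebesgue_prod(2)[OF m] this]
    AE_lebesgue_prod[OF fg]
  show ?thesis
  proof eventually_elim
    case (elim x)
    have "(\<lambda>y. \<phi> (x, y)) \<in> borel_measurable lebesgue"
      by (rule borel_measurable_lebesgue_AE[OF gm]) (use elim(2) in eventually_elim, simp)
    with elim(1) show ?case by (simp add: square_int_iff_nn less_top)
  qed
qed

section \<open>Slices as functions with values in \<open>L2\<close>\<close>

lemma slice_L2_of:
  fixes \<phi> :: "real \<times> 'a::euclidean_space \<Rightarrow> complex"
  assumes "square_int \<phi>"
  shows "AE x in lebesgue. slice (L2_of \<phi>) x = L2_of (\<lambda>y. \<phi> (x, y))"
  using AE_lebesgue_prod[OF fun_of_L2_of[OF assms]] square_int_slices[OF assms]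
    square_int_slices[OF fun_of_L2_square_int[of "L2_of \<phi>"]]
  by eventually_elim (simp add: slice_def L2_of_eq_iff)

lemma slice_add: "AE x in lebesgue. slice (F + G) x = slice F x + slice G x"
proof -
  have "AE x in lebesgue. slice (F + G) x = L2_of (\<lambda>y. fun_of_L2 F (x, y) + fun_of_L2 G (x, y))"
    using slice_L2_of[OF square_int_add[OF fun_of_L2_square_int[of F] fun_of_L2_square_int[of G]]]
    by (simp add: L2_of_add fun_of_L2_square_int)
  then show ?thesis
    using square_int_slices[OF fun_of_L2_square_int[of F]] square_int_slices[OF fun_of_L2_square_int[of G]]
    by eventually_elim (simp add: slice_def L2_of_add)
qed

lemma slice_scaleC: "AE x in lebesgue. slice (c *\<^sub>C F) x = c *\<^sub>C slice F x"
proof -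
  have "AE x in lebesgue. slice (c *\<^sub>C F) x = L2_of (\<lambda>y. c * fun_of_L2 F (x, y))"
    using slice_L2_of[OF square_int_scale[OF fun_of_L2_square_int[of F]], of c]
    by (simp add: L2_of_scaleC fun_of_L2_square_int)
  then show ?thesis
    using square_int_slices[OF fun_of_L2_square_int[of F]]
    by eventually_elim (simp add: slice_def L2_of_scaleC)
qed

lemma slice_diff: "AE x in lebesgue. slice (F - G) x = slice F x - slice G x"
  using slice_add[of F "(-1) *\<^sub>C G"] slice_scaleC[of "-1" G]
  by eventually_elim (simp add: scaleC_minus_one)

text \<open>Fubini for the squared modulus. This isometry from functions of two variables to
  \<open>L2\<close>-valued functions of one variable allows equalities to be checked slice by
  slice.\<close>

lemma norm_slices:
  fixes F :: "(real \<times> 'a::euclidean_space) L2"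
  shows "ennreal ((norm F)\<^sup>2) = (\<integral>\<^sup>+x. ennreal ((norm (slice F x))\<^sup>2) \<partial>lebesgue)"
    and "(\<lambda>x. norm (slice F x)) \<in> borel_measurable lebesgue"
proof -
  have m: "(\<lambda>p. ennreal ((cmod (fun_of_L2 F p))\<^sup>2)) \<in> borel_measurable lebesgue" by measurable
  have ae: "AE x in lebesgue. (\<integral>\<^sup>+y. ennreal ((cmod (fun_of_L2 F (x, y)))\<^sup>2) \<partial>lebesgue) = ennreal ((norm (slice F x))\<^sup>2)"
    using square_int_slices[OF fun_of_L2_square_int[of F]]
    by eventually_elim (simp add: slice_def norm_L2_of_nn)
  show "ennreal ((norm F)\<^sup>2) = (\<integral>\<^sup>+x. ennreal ((norm (slice F x))\<^sup>2) \<partial>lebesgue)"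
    unfolding norm_L2_nn[of F] nn_integral_lebesgue_prod(1)[OF m] by (rule nn_integral_cong_AE[OF ae])
  have "(\<lambda>x. ennreal ((norm (slice F x))\<^sup>2)) \<in> borel_measurable lebesgue"
    by (rule borel_measurable_lebesgue_AE[OF nn_integral_lebesgue_prod(2)[OF m] ae])
  then have "(\<lambda>x. sqrt (enn2real (ennreal ((norm (slice F x))\<^sup>2)))) \<in> borel_measurable lebesgue"
    by measurable
  then show "(\<lambda>x. norm (slice F x)) \<in> borel_measurable lebesgue" by simp
qed

lemma slice_eqI:
  assumes "AE x in lebesgue. slice F x = slice G x"
  shows "F = G"
proof -
  have "ennreal ((norm (F - G))\<^sup>2) = (\<integral>\<^sup>+x. 0 \<partial>(lebesgue :: real measure))"
    unfolding norm_slices(1)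
    by (rule nn_integral_cong_AE, use slice_diff[of F G] assms in eventually_elim) simp
  then show ?thesis by simp
qed

lemma square_int_tensor:
  fixes a :: "'a::euclidean_space \<Rightarrow> complex" and h :: "'b::euclidean_space \<Rightarrow> complex"
  assumes a: "square_int a" and h: "square_int h"
  shows "square_int (\<lambda>(x, y). a x * h y)"
proof -
  have [measurable]: "a \<in> borel_measurable lebesgue" "h \<in> borel_measurable lebesgue"
    using a h by (auto dest: square_int_measurable)
  have m: "(\<lambda>p. a (fst p) * h (snd p)) \<in> borel_measurable (lebesgue :: ('a \<times> 'b) measure)"
    by measurable
  have m': "(\<lambda>p. ennreal ((cmod (a (fst p) * h (snd p)))\<^sup>2)) \<in> borel_measurable (lebesgue :: ('a \<times> 'b) measure)"
    using m by measurable
  have "(\<integral>\<^sup>+p. ennreal ((cmod (a (fst p) * h (snd p)))\<^sup>2) \<partial>(lebesgue :: ('a \<times> 'b) measure))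
      = (\<integral>\<^sup>+x. \<integral>\<^sup>+y. ennreal ((cmod (a x))\<^sup>2) * ennreal ((cmod (h y))\<^sup>2) \<partial>lebesgue \<partial>lebesgue)"
    unfolding nn_integral_lebesgue_prod(1)[OF m'] by (simp add: norm_mult power_mult_distrib ennreal_mult)
  also have "\<dots> = (\<integral>\<^sup>+x. ennreal ((cmod (a x))\<^sup>2) \<partial>lebesgue) * (\<integral>\<^sup>+y. ennreal ((cmod (h y))\<^sup>2) \<partial>lebesgue)"
    by (simp add: nn_integral_cmult nn_integral_multc)
  also have "\<dots> < \<infinity>"
    using a h by (simp add: square_int_iff_nn ennreal_mult_less_top)
  finally show ?thesis
    using m by (simp add: square_int_iff_nn case_prod_unfold)
qed

lemma slice_tensor:
  assumes "square_int a"
  shows "AE x in lebesgue. slice (L2_of (\<lambda>(x, y). a x * fun_of_L2 h y)) x = a x *\<^sub>C h"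
  using slice_L2_of[OF square_int_tensor[OF assms fun_of_L2_square_int[of h]]]
  by eventually_elim (simp add: L2_of_scaleC fun_of_L2_square_int)

text \<open>By separability only preimages of balls around a vector \<open>d\<close> matter. A
  constant function is in general not square integrable on the line, so the distance to
  \<open>d\<close> is measured on one cube at a time, where it is the norm of a slice of
  \<open>F\<close> minus a tensor.\<close>

lemma slice_measurable:
  fixes F :: "(real \<times> 'a::euclidean_space) L2"
  shows "slice F \<in> borel_measurable lebesgue"
proof -
  have ex: "\<exists>n. x \<in> cube n" for x :: real
    using mem_cube_eventually[of x] by blast
  have dist_m: "{x. dist (slice F x) d < r} \<in> sets lebesgue" for d r
  proof -
    have "{x \<in> space lebesgue. x \<in> cube n \<and> norm (slice F x - d) < r} \<in> sets lebesgue" for n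
    proof -
      have sq: "square_int (\<lambda>x::real. 1 * indicator (cube n) x)"
        by (rule square_int_indicator) auto
      let ?G = "F - L2_of (\<lambda>(x, y). (1 * indicator (cube n) x) * fun_of_L2 d y)"
      have ae: "AE x in lebesgue. slice ?G x = slice F x - indicator (cube n) x *\<^sub>C d"
        using slice_diff[of F "L2_of (\<lambda>(x, y). (1 * indicator (cube n) x) * fun_of_L2 d y)"] slice_tensor[OF sq, of d]
        by eventually_elim simp
      then have "AE x in lebesgue. norm (slice ?G x) = norm (slice F x - indicator (cube n) x *\<^sub>C d)"
        by eventually_elim simp
      from borel_measurable_lebesgue_AE[OF norm_slices(2) this]
      have [measurable]: "(\<lambda>x. norm (slice F x - indicator (cube n) x *\<^sub>C d)) \<in> borel_measurable lebesgue" .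
      have [measurable]: "cube n \<in> sets (lebesgue :: real measure)" by simp
      have "{x \<in> space lebesgue. x \<in> cube n \<and> norm (slice F x - d) < r}
          = {x \<in> space lebesgue. x \<in> cube n \<and> norm (slice F x - indicator (cube n) x *\<^sub>C d) < r}"
        by auto
      also have "\<dots> \<in> sets lebesgue" by measurable
      finally show ?thesis .
    qed
    then have "(\<Union>n. {x \<in> space lebesgue. x \<in> cube n \<and> norm (slice F x - d) < r}) \<in> sets lebesgue"
      by blast
    also have "(\<Union>n. {x \<in> space lebesgue. x \<in> cube n \<and> norm (slice F x - d) < r}) = {x. dist (slice F x) d < r}"
      using ex by (auto simp: dist_norm)
    finally show ?thesis .
  qed
  obtain D :: "'a L2 set" where D: "countable D" "closure D = UNIV"
    using L2_countable_dense by blast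
  show ?thesis
  proof (rule borel_measurableI)
    fix S :: "'a L2 set" assume S: "open S"
    let ?I = "{(d, n). d \<in> D \<and> ball d (1 / real (Suc n)) \<subseteq> S}"
    have "S = (\<Union>(d, n)\<in>?I. ball d (1 / real (Suc n)))"
      by (rule open_eq_Union_balls[OF D(2) S])
    from arg_cong[OF this, of "\<lambda>S. slice F -` S"]
    have "slice F -` S = slice F -` (\<Union>(d, n)\<in>?I. ball d (1 / real (Suc n)))" .
    also have "\<dots> = (\<Union>(d, n)\<in>?I. {x. dist (slice F x) d < 1 / real (Suc n)})"
      by (auto simp: dist_commute; blast)
    also have "\<dots> \<in> sets lebesgue"
    proof (rule sets.countable_UN')
      have "?I \<subseteq> D \<times> UNIV" by auto
      then show "countable ?I" by (rule countable_subset) (use D in auto)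
    qed (auto intro: dist_m)
    finally show "slice F -` S \<inter> space lebesgue \<in> sets lebesgue" by simp
  qed
qed

lemma ennreal_norm_add_sq_le:
  fixes u v :: "'a::real_normed_vector"
  shows "ennreal ((norm (u + v))\<^sup>2) \<le> 2 * ennreal ((norm u)\<^sup>2) + 2 * ennreal ((norm v)\<^sup>2)"
proof -
  have "(norm (u + v))\<^sup>2 \<le> (norm u + norm v)\<^sup>2" by (intro power_mono norm_triangle_ineq) simp
  also have "\<dots> \<le> 2 * (norm u)\<^sup>2 + 2 * (norm v)\<^sup>2"
    using sum_squares_ge_zero[of "norm u - norm v" 0] by (simp add: power2_eq_square algebra_simps)
  finally have "ennreal ((norm (u + v))\<^sup>2) \<le> ennreal (2 * (norm u)\<^sup>2 + 2 * (norm v)\<^sup>2)" by (rule ennreal_leI)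
  also have "\<dots> = 2 * ennreal ((norm u)\<^sup>2) + 2 * ennreal ((norm v)\<^sup>2)"
    by (simp add: ennreal_mult)
  finally show ?thesis .
qed

text \<open>Surjectivity of the slice map. A simple function with bounded support is a finite sum of
  tensors; these sums are Cauchy by the isometry, and completeness provides the limit
  \<open>F\<close>.\<close>

lemma ex_L2_slices:
  fixes f :: "real \<Rightarrow> 'a::euclidean_space L2"
  assumes f [measurable]: "f \<in> borel_measurable lebesgue"
    and fin: "(\<integral>\<^sup>+x. ennreal ((norm (f x))\<^sup>2) \<partial>lebesgue) < \<infinity>"
  shows "\<exists>F. AE x in lebesgue. slice F x = f x"
proof -
  from borel_measurable_implies_sequence_metric[OF f, of 0]
  obtain s where s: "\<And>i. simple_function lebesgue (s i)" "\<And>x. (\<lambda>i. s i x) \<longlonglongrightarrow> f x"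
    and bd: "\<And>i x. norm (s i x) \<le> 2 * norm (f x)"
    by auto
  \<comment> \<open>The cut-off makes the level sets bounded, so their indicators are square
    integrable first factors of tensors.\<close>
  define t where "t i x = indicator (cube i) x *\<^sub>R s i x" for i and x :: real
  have t_lim: "(\<lambda>i. t i x) \<longlonglongrightarrow> f x" for x
  proof -
    obtain N where "\<forall>n\<ge>N. x \<in> cube n" using mem_cube_eventually by blast
    then have "eventually (\<lambda>i. s i x = t i x) sequentially"
      by (intro eventually_sequentiallyI[of N]) (simp add: t_def)
    then show "(\<lambda>i. t i x) \<longlonglongrightarrow> f x" by (rule Lim_transform_eventually[OF s(2)])
  qed
  have t_bd: "norm (t i x) \<le> 2 * norm (f x)" for i x
    using bd[of i x] by (auto simp: t_def indicator_def)
  have [measurable]: "s i \<in> borel_measurable lebesgue" for i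
    using s(1) by (rule borel_measurable_simple_function)
  have [measurable]: "cube i \<in> sets (lebesgue :: real measure)" for i by simp
  have t_m [measurable]: "t i \<in> borel_measurable lebesgue" for i
    unfolding t_def[abs_def] by measurable
  have "\<exists>G. AE x in lebesgue. slice G x = t i x" for i
  proof -
    have fr: "finite (range (s i))" using simple_functionD(1)[OF s(1)[of i]] by simp
    have fib: "s i -` {v} \<in> sets lebesgue" for v using simple_functionD(2)[OF s(1)[of i], of "{v}"] by simp
    have "\<exists>G. AE x in lebesgue. slice G x = (\<Sum>v\<in>B. indicator (s i -` {v} \<inter> cube i) x *\<^sub>R v)"
      if "finite B" for B
      using that
    proof induction
      case empty
      have "AE x in lebesgue. slice (0 :: (real \<times> 'a) L2) x = 0"
        using slice_scaleC[of 0 0] by eventually_elim simp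
      then show ?case by auto
    next
      case (insert v B)
      then obtain G where G: "AE x in lebesgue. slice G x = (\<Sum>v\<in>B. indicator (s i -` {v} \<inter> cube i) x *\<^sub>R v)"
        by blast
      have sq: "square_int (\<lambda>x. 1 * indicator (s i -` {v} \<inter> cube i) x)"
        by (rule square_int_indicator) (use fib in \<open>auto intro: bounded_subset[OF bounded_box[of "- (real i *\<^sub>R One)" "real i *\<^sub>R One"]]\<close>)
      let ?T = "L2_of (\<lambda>(x, y). 1 * indicator (s i -` {v} \<inter> cube i) x * fun_of_L2 v y)"
      have "AE x in lebesgue. slice (?T + G) x = (\<Sum>v\<in>insert v B. indicator (s i -` {v} \<inter> cube i) x *\<^sub>R v)"
        using slice_add[of ?T G] slice_tensor[OF sq, of v] G
        by eventually_elim (simp add: sum.insert[OF insert(1,2)] scaleR_L2_eq indicator_def)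
      then show ?case by blast
    qed
    from this[OF fr] obtain G where
      G: "AE x in lebesgue. slice G x = (\<Sum>v\<in>range (s i). indicator (s i -` {v} \<inter> cube i) x *\<^sub>R v)"
      by blast
    have "(\<Sum>v\<in>range (s i). indicator (s i -` {v} \<inter> cube i) x *\<^sub>R v) = t i x" for x
    proof -
      have "(\<Sum>v\<in>range (s i). indicator (s i -` {v} \<inter> cube i) x *\<^sub>R v)
          = indicator (cube i) x *\<^sub>R (\<Sum>v\<in>range (s i). indicator (s i -` {v}) x *\<^sub>R v)"
        unfolding scaleR_sum_right by (rule sum.cong) (auto simp: indicator_def)
      then show ?thesis by (simp add: sum_indicator_fibres[OF fr] t_def)
    qed
    with G show ?thesis by auto
  qed
  then obtain G where G: "\<And>i. AE x in lebesgue. slice (G i) x = t i x" by metis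
  define e where "e i = (\<integral>\<^sup>+x. ennreal ((norm (t i x - f x))\<^sup>2) \<partial>lebesgue)" for i
  have "e \<longlonglongrightarrow> (\<integral>\<^sup>+x. 0 \<partial>(lebesgue :: real measure))"
    unfolding e_def
  \<comment> \<open>The majorant is the square of \<open>3 * norm (f x)\<close>: \<open>t i\<close>
    contributes twice the norm of \<open>f x\<close> and \<open>f\<close> itself once.\<close>
  proof (rule nn_integral_dominated_convergence[where w="\<lambda>x. ennreal (9 * (norm (f x))\<^sup>2)"])
    show "(\<lambda>x. ennreal ((norm (t i x - f x))\<^sup>2)) \<in> borel_measurable lebesgue" for i by measurable
    show "(\<lambda>x. ennreal (9 * (norm (f x))\<^sup>2)) \<in> borel_measurable lebesgue" by measurable
    have "(\<integral>\<^sup>+x. ennreal (9 * (norm (f x))\<^sup>2) \<partial>lebesgue) = ennreal 9 * (\<integral>\<^sup>+x. ennreal ((norm (f x))\<^sup>2) \<partial>lebesgue)"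
      by (simp add: ennreal_mult nn_integral_cmult)
    then show "(\<integral>\<^sup>+x. ennreal (9 * (norm (f x))\<^sup>2) \<partial>lebesgue) < \<infinity>"
      using fin by (simp add: ennreal_mult_less_top)
    show "AE x in lebesgue. ennreal ((norm (t i x - f x))\<^sup>2) \<le> ennreal (9 * (norm (f x))\<^sup>2)" for i
    proof (rule AE_I2)
      fix x
      have "norm (t i x - f x) \<le> 3 * norm (f x)"
        using t_bd[of i x] norm_triangle_ineq4[of "t i x" "f x"] by linarith
      then have "(norm (t i x - f x))\<^sup>2 \<le> (3 * norm (f x))\<^sup>2" by (rule power_mono) simp
      then show "ennreal ((norm (t i x - f x))\<^sup>2) \<le> ennreal (9 * (norm (f x))\<^sup>2)"
        by (intro ennreal_leI) (simp add: power_mult_distrib)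
    qed
    show "AE x in lebesgue. (\<lambda>i. ennreal ((norm (t i x - f x))\<^sup>2)) \<longlonglongrightarrow> 0"
    proof (rule AE_I2)
      fix x
      have "(\<lambda>i. ennreal ((norm (t i x - f x))\<^sup>2)) \<longlonglongrightarrow> ennreal ((norm (f x - f x))\<^sup>2)"
        by (intro tendsto_ennrealI tendsto_intros t_lim)
      then show "(\<lambda>i. ennreal ((norm (t i x - f x))\<^sup>2)) \<longlonglongrightarrow> 0" by simp
    qed
  qed auto
  then have e0: "e \<longlonglongrightarrow> 0" by simp
  have diff: "ennreal ((norm (G i - G j))\<^sup>2) \<le> 2 * e i + 2 * e j" for i j
  proof -
    have "ennreal ((norm (G i - G j))\<^sup>2) = (\<integral>\<^sup>+x. ennreal ((norm (t i x - t j x))\<^sup>2) \<partial>lebesgue)"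
      unfolding norm_slices(1)
      by (rule nn_integral_cong_AE, use G[of i] G[of j] slice_diff[of "G i" "G j"] in eventually_elim) simp
    also have "\<dots> \<le> (\<integral>\<^sup>+x. 2 * ennreal ((norm (t i x - f x))\<^sup>2) + 2 * ennreal ((norm (t j x - f x))\<^sup>2) \<partial>lebesgue)"
    proof (rule nn_integral_mono)
      fix x
      show "ennreal ((norm (t i x - t j x))\<^sup>2) \<le> 2 * ennreal ((norm (t i x - f x))\<^sup>2) + 2 * ennreal ((norm (t j x - f x))\<^sup>2)"
        using ennreal_norm_add_sq_le[of "t i x - f x" "f x - t j x"] by (simp add: norm_minus_commute)
    qed
    also have "\<dots> = 2 * e i + 2 * e j"
      unfolding e_def by (subst nn_integral_add) (simp_all add: nn_integral_cmult)
    finally show ?thesis .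
  qed
  have "Cauchy G"
  proof (rule metric_CauchyI)
    fix r :: real assume r: "r > 0"
    \<comment> \<open>A quarter, because \<open>diff\<close> doubles both errors and they are
      added.\<close>
    have "eventually (\<lambda>i. e i < ennreal (r\<^sup>2 / 4)) sequentially"
      by (rule order_tendstoD(2)[OF e0]) (use r in simp)
    then obtain N where N: "\<And>i. i \<ge> N \<Longrightarrow> e i < ennreal (r\<^sup>2 / 4)"
      unfolding eventually_sequentially by blast
    have "dist (G i) (G j) < r" if "i \<ge> N" "j \<ge> N" for i j
    proof -
      have "ennreal ((norm (G i - G j))\<^sup>2) \<le> 2 * e i + 2 * e j" by (rule diff)
      also have "\<dots> < 2 * ennreal (r\<^sup>2 / 4) + 2 * ennreal (r\<^sup>2 / 4)"
        using N[OF that(1)] N[OF that(2)] by (intro add_strict_mono ennreal_mult_strict_left_mono) auto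
      also have "\<dots> = ennreal (r\<^sup>2)"
        by (simp add: ennreal_mult[symmetric] ennreal_plus[symmetric] del: ennreal_plus flip: ennreal_numeral)
      finally have "(norm (G i - G j))\<^sup>2 < r\<^sup>2"
        by (subst (asm) ennreal_less_iff) auto
      then show ?thesis using r by (simp add: dist_norm power_less_imp_less_base)
    qed
    then show "\<exists>M. \<forall>m\<ge>M. \<forall>n\<ge>M. dist (G m) (G n) < r" by blast
  qed
  then obtain F where F: "G \<longlonglongrightarrow> F"
    using Cauchy_convergent_iff convergent_def by blast
  \<comment> \<open>The left side is free of \<open>i\<close> while the right side tends to 0. This
    identifies the slices of the limit without passing to a subsequence that converges
    pointwise.\<close>
  have "(\<integral>\<^sup>+x. ennreal ((norm (slice F x - f x))\<^sup>2) \<partial>lebesgue) \<le> 2 * ennreal ((norm (F - G i))\<^sup>2) + 2 * e i" for i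
  proof -
    have [measurable]: "slice F \<in> borel_measurable lebesgue" by (rule slice_measurable)
    have "(\<integral>\<^sup>+x. ennreal ((norm (slice F x - f x))\<^sup>2) \<partial>lebesgue)
        \<le> (\<integral>\<^sup>+x. 2 * ennreal ((norm (slice F x - t i x))\<^sup>2) + 2 * ennreal ((norm (t i x - f x))\<^sup>2) \<partial>lebesgue)"
    proof (rule nn_integral_mono)
      fix x
      show "ennreal ((norm (slice F x - f x))\<^sup>2) \<le> 2 * ennreal ((norm (slice F x - t i x))\<^sup>2) + 2 * ennreal ((norm (t i x - f x))\<^sup>2)"
        using ennreal_norm_add_sq_le[of "slice F x - t i x" "t i x - f x"] by simp
    qed
    also have "\<dots> = 2 * (\<integral>\<^sup>+x. ennreal ((norm (slice F x - t i x))\<^sup>2) \<partial>lebesgue) + 2 * e i"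
      unfolding e_def by (subst nn_integral_add) (simp_all add: nn_integral_cmult)
    also have "(\<integral>\<^sup>+x. ennreal ((norm (slice F x - t i x))\<^sup>2) \<partial>lebesgue) = ennreal ((norm (F - G i))\<^sup>2)"
      unfolding norm_slices(1)
      by (rule nn_integral_cong_AE, use G[of i] slice_diff[of F "G i"] in eventually_elim) simp
    finally show ?thesis .
  qed
  moreover have "(\<lambda>i. 2 * ennreal ((norm (F - G i))\<^sup>2) + 2 * e i) \<longlonglongrightarrow> 2 * ennreal ((norm (F - F))\<^sup>2) + 2 * 0"
    by (intro tendsto_add ennreal_tendsto_cmult tendsto_ennrealI tendsto_intros F e0) auto
  ultimately have "(\<integral>\<^sup>+x. ennreal ((norm (slice F x - f x))\<^sup>2) \<partial>lebesgue) \<le> 2 * ennreal ((norm (F - F))\<^sup>2) + 2 * 0"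
    by (intro LIMSEQ_le_const) auto
  then have "(\<integral>\<^sup>+x. ennreal ((norm (slice F x - f x))\<^sup>2) \<partial>lebesgue) = 0" by simp
  moreover have [measurable]: "slice F \<in> borel_measurable lebesgue" by (rule slice_measurable)
  ultimately have "AE x in lebesgue. ennreal ((norm (slice F x - f x))\<^sup>2) = 0"
    by (subst (asm) nn_integral_0_iff_AE) measurable
  then have "AE x in lebesgue. slice F x = f x" by eventually_elim simp
  then show ?thesis by blast
qed

lemma mask_L2_of:
  assumes A: "A \<in> sets lebesgue" and g: "square_int g"
  shows "mask A (L2_of g) = L2_of (\<lambda>y. indicator A y * g y)"
  unfolding mask_def
proof (rule L2_of_cong[OF square_int_mask[OF A]])
  show ae: "AE x in lebesgue. indicator A x * fun_of_L2 (L2_of g) x = indicator A x * g x"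
    using fun_of_L2_of[OF g] by eventually_elim simp
  show "square_int (\<lambda>y. indicator A y * g y)"
    by (rule square_int_cong_AE[OF square_int_mask[OF A] ae])
qed

lemma sets_lebesgue_Times:
  assumes A: "A \<in> sets (lebesgue :: 'a::euclidean_space measure)"
    and B: "B \<in> sets (lebesgue :: 'b::euclidean_space measure)"
  shows "A \<times> B \<in> sets (lebesgue :: ('a \<times> 'b) measure)"
proof -
  have "A \<times> B = (fst -` A \<inter> space lebesgue) \<inter> (snd -` B \<inter> space lebesgue)" by auto
  then show ?thesis
    using measurable_sets[OF measurable_lebesgue_fst[where ?'b='b] A]
      measurable_sets[OF measurable_lebesgue_snd[where ?'a='a] B] by simp
qed

lemma slice_mask:
  assumes A: "A \<in> sets lebesgue" and B: "B \<in> sets lebesgue"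
  shows "AE x in lebesgue. slice (mask (A \<times> B) F) x = indicator A x *\<^sub>R mask B (slice F x)"
  using slice_L2_of[OF square_int_mask[OF sets_lebesgue_Times[OF A B]], of F]
    square_int_slices[OF fun_of_L2_square_int[of F]]
  by eventually_elim
     (auto simp: mask_def[of "A \<times> B"] slice_def[of F] mask_L2_of[OF B] indicator_def L2_of_zero)

section \<open>The slab and restriction to the unit interval\<close>

context
  fixes \<Omega> :: "'a::euclidean_space set"
  assumes \<Omega>: "\<Omega> \<in> sets lebesgue"
begin

lemma slab_sets: "{0<..<1::real} \<times> \<Omega> \<in> sets lebesgue"
  by (rule sets_lebesgue_Times[OF _ \<Omega>]) simp

text \<open>Membership is invariance under \<open>mask\<close>, and \<open>slice_mask\<close>
  expresses the mask of the slab through slices.\<close>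

lemma L2_on_slab_iff:
  "F \<in> L2_on ({0<..<1::real} \<times> \<Omega>) \<longleftrightarrow>
     (AE x in lebesgue. if x \<in> {0<..<1} then slice F x \<in> L2_on \<Omega> else slice F x = 0)"
proof -
  let ?M = "mask ({0<..<1::real} \<times> \<Omega>) F"
  have m: "AE x in lebesgue. slice ?M x = indicator {0<..<1} x *\<^sub>R mask \<Omega> (slice F x)"
    by (rule slice_mask[OF _ \<Omega>]) simp
  have eq: "indicator {0<..<1} x *\<^sub>R mask \<Omega> (slice F x) = slice F x
      \<longleftrightarrow> (if x \<in> {0<..<1} then slice F x \<in> L2_on \<Omega> else slice F x = 0)" for x
    using mask_eq_iff[OF \<Omega>, of "slice F x"] by (auto simp: indicator_def)
  have "F \<in> L2_on ({0<..<1::real} \<times> \<Omega>) \<longleftrightarrow> ?M = F"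
    by (simp add: mask_eq_iff[OF slab_sets])
  also have "\<dots> \<longleftrightarrow> (AE x in lebesgue. indicator {0<..<1} x *\<^sub>R mask \<Omega> (slice F x) = slice F x)"
  proof
    assume "?M = F"
    with m show "AE x in lebesgue. indicator {0<..<1} x *\<^sub>R mask \<Omega> (slice F x) = slice F x"
      by (auto elim: AE_mp)
  next
    assume "AE x in lebesgue. indicator {0<..<1} x *\<^sub>R mask \<Omega> (slice F x) = slice F x"
    with m have "AE x in lebesgue. slice ?M x = slice F x" by eventually_elim simp
    then show "?M = F" by (rule slice_eqI)
  qed
  finally show ?thesis by (simp only: eq)
qed

lemma restrict01_unique:
  assumes "F \<in> L2_on ({0<..<1::real} \<times> \<Omega>)" "G \<in> L2_on ({0<..<1::real} \<times> \<Omega>)"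
    and "AE x in lebesgue. x \<in> {0<..<1} \<longrightarrow> slice F x = slice G x"
  shows "F = G"
proof (rule slice_eqI)
  show "AE x in lebesgue. slice F x = slice G x"
    using assms(1,2)[unfolded L2_on_slab_iff] assms(3) by eventually_elim (auto split: if_splits)
qed

lemma restrict01_eqI:
  assumes "F \<in> L2_on ({0<..<1::real} \<times> \<Omega>)" "AE x in lebesgue. x \<in> {0<..<1} \<longrightarrow> slice F x = f x"
  shows "restrict01 \<Omega> f = F"
  unfolding restrict01_def
proof (rule the_equality)
  fix G assume "G \<in> L2_on ({0<..<1::real} \<times> \<Omega>) \<and> (AE x in lebesgue. x \<in> {0<..<1} \<longrightarrow> slice G x = f x)"
  then have G: "G \<in> L2_on ({0<..<1::real} \<times> \<Omega>)" "AE x in lebesgue. x \<in> {0<..<1} \<longrightarrow> slice G x = f x" by auto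
  show "G = F"
    by (rule restrict01_unique[OF G(1) assms(1)], use G(2) assms(2) in eventually_elim) simp
qed (use assms in auto)

text \<open>Set to zero off (0,1), \<open>f\<close> is square integrable on the whole line and
  \<open>ex_L2_slices\<close> applies; uniqueness then evaluates the description operator in
  \<open>restrict01\<close>.\<close>

lemma restrict01_ex:
  assumes m [measurable]: "f \<in> borel_measurable lebesgue" and v: "\<And>x. f x \<in> L2_on \<Omega>"
    and i: "set_integrable lebesgue {0<..<1} (\<lambda>x. (norm (f x))\<^sup>2)"
  shows "restrict01 \<Omega> f \<in> L2_on ({0<..<1} \<times> \<Omega>)"
    and "AE x in lebesgue. x \<in> {0<..<1} \<longrightarrow> slice (restrict01 \<Omega> f) x = f x"
    and "norm (restrict01 \<Omega> f) = HV_norm f"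
proof -
  let ?g = "\<lambda>x. indicator {0<..<1} x *\<^sub>R f x"
  have g2: "(norm (?g x))\<^sup>2 = indicator {0<..<1} x *\<^sub>R (norm (f x))\<^sup>2" for x
    by (simp add: indicator_def)
  have i': "integrable lebesgue (\<lambda>x. (norm (?g x))\<^sup>2)"
    using i unfolding g2 set_integrable_def .
  have nn: "(\<integral>\<^sup>+x. ennreal ((norm (?g x))\<^sup>2) \<partial>lebesgue) = ennreal (\<integral>x. (norm (?g x))\<^sup>2 \<partial>lebesgue)"
    by (rule nn_integral_eq_integral[OF i']) simp
  have "\<exists>F. AE x in lebesgue. slice F x = ?g x"
  proof (rule ex_L2_slices)
    show "?g \<in> borel_measurable lebesgue"
      by (intro borel_measurable_scaleR borel_measurable_indicator m) simp
    show "(\<integral>\<^sup>+x. ennreal ((norm (?g x))\<^sup>2) \<partial>lebesgue) < \<infinity>" unfolding nn by simp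
  qed
  then obtain F where F: "AE x in lebesgue. slice F x = ?g x" by blast
  have FS: "F \<in> L2_on ({0<..<1::real} \<times> \<Omega>)"
    unfolding L2_on_slab_iff using F by eventually_elim (use v in \<open>auto simp: indicator_def\<close>)
  have R: "restrict01 \<Omega> f = F"
    by (rule restrict01_eqI[OF FS], use F in eventually_elim) simp
  show "restrict01 \<Omega> f \<in> L2_on ({0<..<1} \<times> \<Omega>)" using FS R by simp
  show "AE x in lebesgue. x \<in> {0<..<1} \<longrightarrow> slice (restrict01 \<Omega> f) x = f x"
    unfolding R using F by eventually_elim simp
  have "ennreal ((norm F)\<^sup>2) = (\<integral>\<^sup>+x. ennreal ((norm (?g x))\<^sup>2) \<partial>lebesgue)"
    unfolding norm_slices(1) by (rule nn_integral_cong_AE, use F in eventually_elim) simp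
  then have "(norm F)\<^sup>2 = (\<integral>x. (norm (?g x))\<^sup>2 \<partial>lebesgue)"
    unfolding nn by (subst (asm) ennreal_inj) auto
  also have "\<dots> = set_lebesgue_integral lebesgue {0<..<1} (\<lambda>x. (norm (f x))\<^sup>2)"
    unfolding set_lebesgue_integral_def g2 ..
  finally show "norm (restrict01 \<Omega> f) = HV_norm f"
    unfolding R HV_norm_def by (metis norm_ge_zero real_sqrt_unique)
qed

end

section \<open>Test functions on the unit interval\<close>

text \<open>The differentiability half of \<open>test_fun01\<close>, separated from the support
  condition so that exponentials are included.\<close>

definition smooth :: "(real \<Rightarrow> complex) \<Rightarrow> bool" where
  "smooth f \<longleftrightarrow> (\<exists>D :: nat \<Rightarrow> real \<Rightarrow> complex.
     D 0 = f \<and> (\<forall>k t. (D k has_vector_derivative D (Suc k) t) (at t)))"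

text \<open>Choosing derivatives inside \<open>C\<close> and iterating the choice produces all
  orders at once. Products and flat functions then need only a class preserved by one
  differentiation.\<close>

lemma smoothI:
  assumes "f \<in> C" and step: "\<And>g. g \<in> C \<Longrightarrow> \<exists>g'\<in>C. \<forall>t. (g has_vector_derivative g' t) (at t)"
  shows "smooth f"
proof -
  obtain d where d: "\<And>g. g \<in> C \<Longrightarrow> d g \<in> C \<and> (\<forall>t. (g has_vector_derivative d g t) (at t))"
    using step by metis
  have C: "(d ^^ k) f \<in> C" for k by (induction k) (use assms(1) d in auto)
  show ?thesis
    unfolding smooth_def
    by (rule exI[of _ "\<lambda>k. (d ^^ k) f"]) (use d[OF C] in auto)
qed

lemma smooth_deriv:
  assumes "smooth f"
  obtains f' where "smooth f'" "\<And>t. (f has_vector_derivative f' t) (at t)"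
proof -
  from assms obtain D where D: "D 0 = f" "\<And>k t. (D k has_vector_derivative D (Suc k) t) (at t)"
    unfolding smooth_def by blast
  have "smooth (D 1)"
    unfolding smooth_def by (rule exI[of _ "\<lambda>k. D (Suc k)"]) (simp add: D)
  moreover have "(f has_vector_derivative D 1 t) (at t)" for t
    using D(2)[of 0 t] D(1) by simp
  ultimately show ?thesis by (rule that)
qed

lemma smooth_antideriv:
  assumes "smooth w" "\<And>t. (v has_vector_derivative w t) (at t)"
  shows "smooth v"
proof -
  from assms(1) obtain D where D: "D 0 = w" "\<And>k t. (D k has_vector_derivative D (Suc k) t) (at t)"
    unfolding smooth_def by blast
  show ?thesis
    unfolding smooth_def
    by (rule exI[of _ "case_nat v D"]) (use D assms(2) in \<open>auto split: nat.split\<close>)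
qed

lemma smooth_continuous: "smooth f \<Longrightarrow> continuous_on S f"
  by (metis continuous_at_imp_continuous_on has_vector_derivative_continuous smooth_deriv)

lemma smooth_add:
  assumes "smooth f" "smooth g"
  shows "smooth (\<lambda>t. f t + g t)"
proof (rule smoothI[where C="{\<lambda>t. f t + g t | f g. smooth f \<and> smooth g}"])
  fix h assume "h \<in> {\<lambda>t. f t + g t | f g. smooth f \<and> smooth g}"
  then obtain f g where h: "h = (\<lambda>t. f t + g t)" "smooth f" "smooth g" by blast
  obtain f' where f': "smooth f'" "\<And>t. (f has_vector_derivative f' t) (at t)" using smooth_deriv[OF h(2)] by blast
  obtain g' where g': "smooth g'" "\<And>t. (g has_vector_derivative g' t) (at t)" using smooth_deriv[OF h(3)] by blast
  have "\<forall>t. (h has_vector_derivative f' t + g' t) (at t)"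
    unfolding h(1) by (intro allI has_vector_derivative_add f' g')
  with f'(1) g'(1) show "\<exists>h'\<in>{\<lambda>t. f t + g t | f g. smooth f \<and> smooth g}. \<forall>t. (h has_vector_derivative h' t) (at t)"
    by (intro bexI[of _ "\<lambda>t. f' t + g' t"]) auto
qed (use assms in blast)

text \<open>Differentiation does not preserve single products, but by the Leibniz rule it preserves
  finite sums of them.\<close>

inductive_set smooth_products :: "(real \<Rightarrow> complex) set" where
  mult: "smooth f \<Longrightarrow> smooth g \<Longrightarrow> (\<lambda>t. f t * g t) \<in> smooth_products"
| add: "f \<in> smooth_products \<Longrightarrow> g \<in> smooth_products \<Longrightarrow> (\<lambda>t. f t + g t) \<in> smooth_products"

lemma smooth_mult:
  assumes "smooth f" "smooth g"
  shows "smooth (\<lambda>t. f t * g t)"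
proof (rule smoothI[where C=smooth_products])
  show "(\<lambda>t. f t * g t) \<in> smooth_products" by (rule smooth_products.mult[OF assms])
  fix h assume "h \<in> smooth_products"
  then show "\<exists>h'\<in>smooth_products. \<forall>t. (h has_vector_derivative h' t) (at t)"
  proof induction
    case (mult f g)
    obtain f' where f': "smooth f'" "\<And>t. (f has_vector_derivative f' t) (at t)" using smooth_deriv[OF mult(1)] by blast
    obtain g' where g': "smooth g'" "\<And>t. (g has_vector_derivative g' t) (at t)" using smooth_deriv[OF mult(2)] by blast
    have "\<forall>t. ((\<lambda>t. f t * g t) has_vector_derivative f t * g' t + f' t * g t) (at t)"
      by (intro allI has_vector_derivative_mult f' g')
    moreover have "(\<lambda>t. f t * g' t + f' t * g t) \<in> smooth_products"
      by (intro smooth_products.intros mult f' g')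
    ultimately show ?case by (intro bexI[of _ "\<lambda>t. f t * g' t + f' t * g t"])
  next
    case (add f g)
    then obtain f' g' where "f' \<in> smooth_products" "\<forall>t. (f has_vector_derivative f' t) (at t)"
      "g' \<in> smooth_products" "\<forall>t. (g has_vector_derivative g' t) (at t)" by blast
    then show ?case
      by (intro bexI[of _ "\<lambda>t. f' t + g' t"]) (auto intro: has_vector_derivative_add smooth_products.add)
  qed
qed

lemma smooth_const: "smooth (\<lambda>t. c)"
  unfolding smooth_def
  by (rule exI[of _ "\<lambda>k t. if k = 0 then c else 0"]) auto

lemma smooth_exp: "smooth (\<lambda>t. exp (of_real (a * t)))"
  unfolding smooth_def
proof (intro exI[of _ "\<lambda>k t. of_real a ^ k * exp (of_real (a * t))"] conjI allI)
  fix k t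
  have "((\<lambda>t. complex_of_real a ^ k * of_real (exp (a * t))) has_vector_derivative
      complex_of_real a ^ k * of_real (exp (a * t) * a)) (at t)"
    by (intro has_vector_derivative_mult_right has_vector_derivative_of_real)
       (auto intro!: derivative_eq_intros simp: has_real_derivative_iff_has_vector_derivative[symmetric])
  then show "((\<lambda>t. complex_of_real a ^ k * exp (of_real (a * t))) has_vector_derivative
      complex_of_real a ^ Suc k * exp (of_real (a * t))) (at t)"
    unfolding exp_of_real by (simp add: mult_ac)
qed simp

lemma smooth_affine:
  assumes "smooth f"
  shows "smooth (\<lambda>t. f (c + s * t))"
proof -
  from assms obtain D where D: "D 0 = f" "\<And>k t. (D k has_vector_derivative D (Suc k) t) (at t)"
    unfolding smooth_def by blast
  show ?thesis
    unfolding smooth_def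
  proof (intro exI[of _ "\<lambda>k t. of_real s ^ k * D k (c + s * t)"] conjI allI)
    fix k t
    have a: "((\<lambda>t. c + s * t) has_vector_derivative s) (at t)"
      by (auto intro!: derivative_eq_intros simp: has_real_derivative_iff_has_vector_derivative[symmetric])
    have "((D k \<circ> (\<lambda>t. c + s * t)) has_vector_derivative s *\<^sub>R D (Suc k) (c + s * t)) (at t)"
      by (rule vector_diff_chain_at[OF a D(2)])
    then have "((\<lambda>t. of_real s ^ k * D k (c + s * t)) has_vector_derivative of_real s ^ k * (s *\<^sub>R D (Suc k) (c + s * t))) (at t)"
      unfolding comp_def by (rule has_vector_derivative_mult_right)
    then show "((\<lambda>t. of_real s ^ k * D k (c + s * t)) has_vector_derivative of_real s ^ Suc k * D (Suc k) (c + s * t)) (at t)"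
      by (simp add: scaleR_conv_of_real mult_ac)
  qed (simp add: D)
qed

section \<open>Flat functions and bumps\<close>

lemma tendsto_power_exp_neg:
  fixes e :: real
  assumes "e > 0"
  shows "((\<lambda>s. s ^ n * exp (- (e * s))) \<longlongrightarrow> 0) at_top"
proof -
  have "filterlim (\<lambda>s. e * s) at_top at_top"
    by (rule filterlim_tendsto_pos_mult_at_top[OF tendsto_const assms filterlim_ident])
  from filterlim_compose[OF tendsto_power_div_exp_0[of n] this]
  have "((\<lambda>s. (e * s) ^ n / exp (e * s)) \<longlongrightarrow> 0) at_top" .
  then have "((\<lambda>s. (1 / e ^ n) * ((e * s) ^ n / exp (e * s))) \<longlongrightarrow> (1 / e ^ n) * 0) at_top"
    by (rule tendsto_mult_left)
  moreover have "(\<lambda>s. (1 / e ^ n) * ((e * s) ^ n / exp (e * s))) = (\<lambda>s. s ^ n * exp (- (e * s)))"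
    by (rule ext) (use assms in \<open>simp add: power_mult_distrib exp_minus field_simps\<close>)
  ultimately show ?thesis by simp
qed

lemma tendsto_poly_exp_neg:
  fixes e :: real
  assumes "e > 0"
  shows "((\<lambda>s. s ^ n * poly p s * exp (- (e * s))) \<longlongrightarrow> 0) at_top"
proof (induction p arbitrary: n)
  case 0
  then show ?case by simp
next
  case (pCons a p)
  have "((\<lambda>s. a * (s ^ n * exp (- (e * s))) + s ^ Suc n * poly p s * exp (- (e * s))) \<longlongrightarrow> a * 0 + 0) at_top"
    by (intro tendsto_add tendsto_mult_left tendsto_power_exp_neg assms pCons.IH)
  then show ?case by (simp add: algebra_simps)
qed

text \<open>The classical function exp(-e/t), flat at 0, with a polynomial in 1/t as factor so that
  derivatives stay in the family. The rate \<open>e\<close> is a parameter because it will tend to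
  0.\<close>

definition flat :: "real \<Rightarrow> real poly \<Rightarrow> real \<Rightarrow> real" where
  "flat e p t = (if t > 0 then poly p (1 / t) * exp (- (e / t)) else 0)"

text \<open>With X = 1/t the derivative of p(X) exp(-e X) carries the factor X^2 from the inner
  derivative and the combination e p - p'. At 0 the right-hand quotient is a polynomial in s = 1/t
  times exp(-e s), which vanishes as s grows.\<close>

lemma flat_deriv:
  assumes e: "e > 0"
  shows "(flat e p has_real_derivative flat e ([:0, 0, 1:] * (smult e p - pderiv p)) t) (at t)"
proof -
  consider "t > 0" | "t < 0" | "t = 0" by linarith
  then show ?thesis
  proof cases
    case 1
    have "((\<lambda>t. poly p (1 / t) * exp (- (e / t))) has_real_derivative
        poly ([:0, 0, 1:] * (smult e p - pderiv p)) (1 / t) * exp (- (e / t))) (at t)"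
      using 1 by (auto intro!: derivative_eq_intros simp: field_simps power2_eq_square)
    then have "(flat e p has_real_derivative
        poly ([:0, 0, 1:] * (smult e p - pderiv p)) (1 / t) * exp (- (e / t))) (at t)"
      by (rule has_field_derivative_transform_within_open[where S="{0<..}"]) (use 1 in \<open>auto simp: flat_def\<close>)
    then show ?thesis using 1 by (simp add: flat_def)
  next
    case 2
    have "((\<lambda>t. 0) has_real_derivative 0) (at t)" by simp
    then have "(flat e p has_real_derivative 0) (at t)"
      by (rule has_field_derivative_transform_within_open[where S="{..<0}"]) (use 2 in \<open>auto simp: flat_def\<close>)
    then show ?thesis using 2 by (simp add: flat_def)
  next
    case 3
    have "((\<lambda>t. (flat e p t - flat e p 0) / (t - 0)) \<longlongrightarrow> 0) (at 0)"
    proof (rule filterlim_split_at)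
      show "((\<lambda>t. (flat e p t - flat e p 0) / (t - 0)) \<longlongrightarrow> 0) (at_left 0)"
      proof (rule tendsto_eventually)
        show "\<forall>\<^sub>F t in at_left 0. (flat e p t - flat e p 0) / (t - 0) = 0"
          by (auto simp: flat_def eventually_at_left_field intro!: exI[of _ "-1"])
      qed
      have "((\<lambda>t. inverse t ^ 1 * poly p (inverse t) * exp (- (e * inverse t))) \<longlongrightarrow> 0) (at_right 0)"
        by (rule filterlim_compose[OF tendsto_poly_exp_neg[OF e] filterlim_inverse_at_top_right])
      then show "((\<lambda>t. (flat e p t - flat e p 0) / (t - 0)) \<longlongrightarrow> 0) (at_right 0)"
        by (rule Lim_transform_eventually)
           (auto simp: flat_def eventually_at_right_field field_simps intro!: exI[of _ 1])
    qed
    then show ?thesis using 3 by (simp add: has_field_derivative_iff flat_def)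
  qed
qed

lemma smooth_flat:
  assumes "e > 0"
  shows "smooth (\<lambda>t. of_real (flat e p t))"
proof (rule smoothI[where C="range (\<lambda>p t. of_real (flat e p t))"])
  fix g :: "real \<Rightarrow> complex" assume "g \<in> range (\<lambda>p t. of_real (flat e p t))"
  then obtain p where g: "g = (\<lambda>t. of_real (flat e p t))" by blast
  have "(g has_vector_derivative of_real (flat e ([:0, 0, 1:] * (smult e p - pderiv p)) t)) (at t)" for t
    unfolding g by (rule has_vector_derivative_of_real)
      (use flat_deriv[OF assms] in \<open>simp only: has_real_derivative_iff_has_vector_derivative[symmetric]\<close>)
  then show "\<exists>g'\<in>range (\<lambda>p t. of_real (flat e p t)). \<forall>t. (g has_vector_derivative g' t) (at t)"
    by (intro bexI[of _ "\<lambda>t. of_real (flat e ([:0, 0, 1:] * (smult e p - pderiv p)) t)"]) blast+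
qed blast

text \<open>For \<open>e \<rightarrow> 0\<close> these functions increase to the indicator of \<open>(c, d)\<close>, which makes
  mollifiers unnecessary.\<close>

definition bump :: "real \<Rightarrow> real \<Rightarrow> real \<Rightarrow> real \<Rightarrow> real" where
  "bump e c d t = flat e 1 (t - c) * flat e 1 (d - t)"

lemma smooth_bump:
  assumes "e > 0"
  shows "smooth (\<lambda>t. of_real (bump e c d t))"
proof -
  have "smooth (\<lambda>t. of_real (flat e 1 (- c + 1 * t)) * of_real (flat e 1 (d + (- 1) * t)))"
    by (rule smooth_mult[OF smooth_affine[OF smooth_flat[OF assms]] smooth_affine[OF smooth_flat[OF assms]]])
  then show ?thesis by (simp add: bump_def)
qed

lemma bump_eq_0: "t \<notin> {c..d} \<Longrightarrow> bump e c d t = 0"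
  by (auto simp: bump_def flat_def)

lemma bump_pos: "t \<in> {c<..<d} \<Longrightarrow> bump e c d t > 0"
  by (auto simp: bump_def flat_def)

lemma bump_bounds: "e > 0 \<Longrightarrow> bump e c d t \<ge> 0 \<and> bump e c d t \<le> 1"
  by (auto simp: bump_def flat_def intro!: mult_le_one)

text \<open>The same number \<open>1 / Suc n\<close> has two uses: as rate it drives the exponents
  to 0 inside the interval, and as margin it keeps the support away from \<open>c\<close> and
  \<open>d\<close>, even when these are 0 and 1.\<close>

lemma bump_tendsto:
  assumes "c < d"
  shows "(\<lambda>n. bump (1 / Suc n) (c + 1 / Suc n) (d - 1 / Suc n) t) \<longlonglongrightarrow> indicator {c<..<d} t"
proof (cases "t \<in> {c<..<d}")
  case True
  have z: "(\<lambda>n. 1 / real (Suc n)) \<longlonglongrightarrow> 0"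
    using LIMSEQ_inverse_real_of_nat by (simp add: inverse_eq_divide)
  have "(\<lambda>n. exp (- (1 / real (Suc n) / (t - (c + 1 / real (Suc n))))) * exp (- (1 / real (Suc n) / (d - 1 / real (Suc n) - t))))
      \<longlonglongrightarrow> exp (- (0 / (t - (c + 0)))) * exp (- (0 / (d - 0 - t)))"
    by (intro tendsto_intros z) (use True in auto)
  then have l: "(\<lambda>n. exp (- (1 / real (Suc n) / (t - (c + 1 / real (Suc n))))) * exp (- (1 / real (Suc n) / (d - 1 / real (Suc n) - t))))
      \<longlonglongrightarrow> indicator {c<..<d} t"
    using True by simp
  have "\<forall>\<^sub>F n in sequentially. 1 / real (Suc n) < t - c \<and> 1 / real (Suc n) < d - t"
    by (intro eventually_conj order_tendstoD(2)[OF z]) (use True in auto)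
  then have "\<forall>\<^sub>F n in sequentially. exp (- (1 / real (Suc n) / (t - (c + 1 / real (Suc n))))) * exp (- (1 / real (Suc n) / (d - 1 / real (Suc n) - t)))
      = bump (1 / Suc n) (c + 1 / Suc n) (d - 1 / Suc n) t"
    by eventually_elim (simp add: bump_def flat_def del: of_nat_Suc)
  then show ?thesis by (rule Lim_transform_eventually[OF l])
next
  case False
  have "bump (1 / Suc n) (c + 1 / Suc n) (d - 1 / Suc n) t = 0" for n
  proof (rule bump_eq_0)
    have "1 / real (Suc n) > 0" by simp
    with False show "t \<notin> {c + 1 / real (Suc n)..d - 1 / real (Suc n)}"
      unfolding atLeastAtMost_iff greaterThanLessThan_iff by linarith
  qed
  then show ?thesis using False by simp
qed

section \<open>Operations on compactly supported smooth functions\<close>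

lemma test_fun01_iff:
  "test_fun01 f \<longleftrightarrow> smooth f \<and> (\<exists>a b. 0 < a \<and> b < 1 \<and> (\<forall>t. t \<notin> {a..b} \<longrightarrow> f t = 0))"
proof
  assume "test_fun01 f"
  then obtain K where sm: "smooth f" and K: "compact K" "K \<subseteq> {0<..<1}" "\<forall>t. t \<notin> K \<longrightarrow> f t = 0"
    unfolding test_fun01_def smooth_def by blast
  have "\<exists>a b. 0 < a \<and> b < 1 \<and> K \<subseteq> {a..b}"
  proof (cases "K = {}")
    case True
    then show ?thesis by (intro exI[of _ "1/2"]) auto
  next
    case False
    obtain a where "a \<in> K" "\<forall>t\<in>K. a \<le> t" using compact_attains_inf[OF K(1) False] by blast
    moreover obtain b where "b \<in> K" "\<forall>t\<in>K. t \<le> b" using compact_attains_sup[OF K(1) False] by blast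
    ultimately show ?thesis using K(2) by (intro exI[of _ a] exI[of _ b]) auto
  qed
  with sm K(3) show "smooth f \<and> (\<exists>a b. 0 < a \<and> b < 1 \<and> (\<forall>t. t \<notin> {a..b} \<longrightarrow> f t = 0))"
    by (meson subsetD)
next
  assume "smooth f \<and> (\<exists>a b. 0 < a \<and> b < 1 \<and> (\<forall>t. t \<notin> {a..b} \<longrightarrow> f t = 0))"
  then obtain a b where sm: "smooth f" and ab: "0 < a" "b < 1" "\<forall>t. t \<notin> {a..b} \<longrightarrow> f t = 0" by blast
  then have "compact {a..b}" "{a..b} \<subseteq> {0<..<1}" by auto
  with sm ab(3) show "test_fun01 f" unfolding test_fun01_def smooth_def by blast
qed

lemma test_fun01_mult:
  assumes "smooth g" "test_fun01 f"
  shows "test_fun01 (\<lambda>t. g t * f t)"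
  using assms smooth_mult unfolding test_fun01_iff by (metis mult_zero_right)

lemma test_fun01_bump:
  assumes "e > 0" "0 < c" "d < 1"
  shows "test_fun01 (\<lambda>t. of_real (bump e c d t))"
  unfolding test_fun01_iff using smooth_bump[OF assms(1)] bump_eq_0 assms by (metis of_real_0)

lemma test_fun01_bump_seq:
  assumes "0 \<le> c" "d \<le> 1"
  shows "test_fun01 (\<lambda>t. of_real (bump (1 / Suc n) (c + 1 / Suc n) (d - 1 / Suc n) t))"
proof (rule test_fun01_bump)
  have "1 / real (Suc n) > 0" by simp
  then show "0 < c + 1 / real (Suc n)" "d - 1 / real (Suc n) < 1" using assms by linarith+
qed simp

lemma test_fun01_add:
  assumes "test_fun01 f" "test_fun01 g"
  shows "test_fun01 (\<lambda>t. f t + g t)"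
proof -
  obtain a b where f: "smooth f" "0 < a" "b < 1" "\<forall>t. t \<notin> {a..b} \<longrightarrow> f t = 0"
    using assms(1) unfolding test_fun01_iff by blast
  obtain c d where g: "smooth g" "0 < c" "d < 1" "\<forall>t. t \<notin> {c..d} \<longrightarrow> g t = 0"
    using assms(2) unfolding test_fun01_iff by blast
  show ?thesis
    unfolding test_fun01_iff
    by (intro conjI smooth_add f(1) g(1) exI[of _ "min a c"] exI[of _ "max b d"])
       (use f g in \<open>auto simp: min_def max_def\<close>)
qed

lemma test_fun01_cmult: "test_fun01 f \<Longrightarrow> test_fun01 (\<lambda>t. c * f t)"
  by (rule test_fun01_mult[OF smooth_const])

lemma test_fun01_deriv:
  assumes "test_fun01 f" and d: "\<And>t. (f has_vector_derivative f' t) (at t)"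
  shows "test_fun01 f'"
proof -
  obtain a b where f: "smooth f" "0 < a" "b < 1" "\<And>t. t \<notin> {a..b} \<Longrightarrow> f t = 0"
    using assms(1) unfolding test_fun01_iff by blast
  obtain g where g: "smooth g" "\<And>t. (f has_vector_derivative g t) (at t)" using smooth_deriv[OF f(1)] by blast
  have "g = f'" using vector_derivative_unique_at[OF g(2) d] by auto
  moreover have "f' t = 0" if "t \<notin> {a..b}" for t
  proof -
    have "((\<lambda>t. 0) has_vector_derivative 0) (at t)" by simp
    then have "(f has_vector_derivative 0) (at t)"
      by (rule has_vector_derivative_transform_within_open[where S="- {a..b}"]) (use that f(4) in auto)
    then show ?thesis using vector_derivative_unique_at[OF d] by blast
  qed
  ultimately show ?thesis unfolding test_fun01_iff using f(2,3) g(1) by blast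
qed

text \<open>To the right of the support a primitive is constant, equal to the total integral; mean
  zero is what makes it compactly supported again.\<close>

lemma test_fun01_antideriv:
  assumes w: "test_fun01 w" and i0: "integral {0..1} w = 0"
  shows "\<exists>v. test_fun01 v \<and> (\<forall>t. (v has_vector_derivative w t) (at t))"
proof -
  obtain a b where w': "smooth w" "0 < a" "b < 1" "\<And>t. t \<notin> {a..b} \<Longrightarrow> w t = 0"
    using w unfolding test_fun01_iff by blast
  \<comment> \<open>Starting at -1, strictly left of the support, makes every
    \<open>t \<ge> a\<close> an interior point of the interval in the fundamental theorem.\<close>
  define v where "v t = integral {-1..t} w" for t
  have int: "w integrable_on {x..y}" for x y
    by (rule integrable_continuous_real[OF smooth_continuous[OF w'(1)]])
  have v0: "v t = 0" if "t < a" for t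
  proof -
    have "integral {-1..t} w = integral {-1..t} (\<lambda>_. 0)"
      by (rule integral_cong) (use that w'(4) in auto)
    then show ?thesis by (simp add: v_def)
  qed
  have v1: "v t = 0" if "t > b" "t \<ge> 1" for t
  proof -
    have "v t = integral {-1..0} w + integral {0..1} w + integral {1..t} w"
      unfolding v_def using that
      by (simp add: Henstock_Kurzweil_Integration.integral_combine[OF _ _ int])
    moreover have "integral {-1..0} w = integral {-1..0} (\<lambda>_::real. 0)"
      by (rule integral_cong) (use w'(2,4) in auto)
    moreover have "integral {1..t} w = integral {1..t} (\<lambda>_. 0)"
      by (rule integral_cong) (use w'(3,4) in auto)
    ultimately show ?thesis using i0 by simp
  qed
  have v1': "v t = 0" if "t > b" for t
  proof (cases "t \<ge> 1")
    case False
    \<comment> \<open>The zero at 1 is carried back to \<open>t\<close>, since \<open>w\<close>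
      vanishes between them.\<close>
    then have "v 1 = v t + integral {t..1} w" if "-1 \<le> t"
      unfolding v_def using that by (simp add: Henstock_Kurzweil_Integration.integral_combine[OF _ _ int])
    moreover have "integral {t..1} w = integral {t..1} (\<lambda>_. 0)"
      by (rule integral_cong) (use that w'(4) in auto)
    ultimately show ?thesis using v1[of 1] w'(2,3) v0[of t] by (cases "-1 \<le> t") auto
  qed (use v1 that in auto)
  have "(v has_vector_derivative w t) (at t)" for t
  proof (cases "t < a")
    case True
    have "((\<lambda>t. 0) has_vector_derivative 0) (at t)" by simp
    then have "(v has_vector_derivative 0) (at t)"
      by (rule has_vector_derivative_transform_within_open[where S="{..<a}"]) (use True v0 in auto)
    then show ?thesis using w'(4)[of t] True by simp
  next
    case False
    have "(v has_vector_derivative w t) (at t within {-1..t+1})"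
      unfolding v_def
      by (rule integral_has_vector_derivative[OF smooth_continuous[OF w'(1)]]) (use False w'(2) in auto)
    moreover have "at t within {-1..t+1} = at t"
      by (rule at_within_interior) (use False w'(2) in simp)
    ultimately show ?thesis by simp
  qed
  then show ?thesis
    using smooth_antideriv[OF w'(1)] v0 v1' w'(2,3) unfolding test_fun01_iff
    by (intro exI[of _ v] conjI exI[of _ a] exI[of _ b]) (auto simp: not_le)
qed

section \<open>The boundary operator and the translation group\<close>

lemma AE_lebesgue_shift:
  assumes "AE x in lebesgue. P (x::real)"
  shows "AE x in lebesgue. P (x + t)"
proof -
  have "negligible {x. \<not> P x}"
    using assms by (simp add: completion.AE_iff_null_sets negligible_iff_null_sets)
  then have "negligible ((+) (- t) ` {x. \<not> P x})" by (rule negligible_translation)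
  moreover have "(+) (- t) ` {x. \<not> P x} = {x. \<not> P (x + t)}"
    by (force simp: image_iff)
  ultimately show ?thesis
    by (simp add: completion.AE_iff_null_sets negligible_iff_null_sets)
qed

lemma measurable_lebesgue_shift: "(\<lambda>x::real. x + t) \<in> lebesgue \<rightarrow>\<^sub>M lebesgue"
  using lebesgue_affine_measurable[where c="\<lambda>_::real. 1" and t=t] by (simp add: add.commute)

lemma nn_integral_lebesgue_shift:
  fixes f :: "real \<Rightarrow> ennreal"
  assumes "f \<in> borel_measurable lebesgue"
  shows "(\<integral>\<^sup>+x. f (x + t) \<partial>lebesgue) = (\<integral>\<^sup>+x. f x \<partial>lebesgue)"
  using nn_integral_real_affine_lebesgue[OF assms, of 1 t] by (simp add: add.commute)

lemma periodic_int:
  fixes p :: "real \<Rightarrow> 'b"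
  assumes "\<And>x. p (x + 1) = p x"
  shows "p (x + of_int n) = p x"
proof (induction n rule: int_induct[where k=0])
  case (step1 i)
  then show ?case using assms[of "x + of_int i"] by (simp add: add.assoc)
next
  case (step2 i)
  then show ?case using assms[of "x + of_int (i - 1)"] by (simp add: add.assoc)
qed simp

text \<open>Only the fractional part \<open>s\<close> of the shift matters. The window from
  \<open>s\<close> to \<open>1 + s\<close> is cut at 1 and its right piece moved back by one period;
  half-open intervals make the pieces fit exactly.\<close>

lemma nn_integral_periodic_shift:
  fixes p :: "real \<Rightarrow> ennreal"
  assumes p [measurable]: "p \<in> borel_measurable lebesgue" and per: "\<And>x. p (x + 1) = p x"
  shows "(\<integral>\<^sup>+x. indicator {0..<1} x * p (x + t) \<partial>lebesgue) = (\<integral>\<^sup>+x. indicator {0..<1} x * p x \<partial>lebesgue)"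
proof -
  define s where "s = frac t"
  have s: "0 \<le> s" "s < 1" by (auto simp: s_def frac_lt_1)
  have pt: "p (x + t) = p (x + s)" for x
    using periodic_int[of p "x + s" "\<lfloor>t\<rfloor>", OF per] by (simp add: s_def frac_def)
  have I [measurable]: "{a..<b} \<in> sets (lebesgue :: real measure)" for a b :: real by simp
  have "(\<integral>\<^sup>+x. indicator {0..<1} x * p (x + t) \<partial>lebesgue) = (\<integral>\<^sup>+x. indicator {s..<1+s} (x + s) * p (x + s) \<partial>lebesgue)"
    unfolding pt by (rule nn_integral_cong) (auto simp: indicator_def)
  also have "\<dots> = (\<integral>\<^sup>+x. indicator {s..<1+s} x * p x \<partial>lebesgue)"
    by (rule nn_integral_lebesgue_shift[of "\<lambda>x. indicator {s..<1+s} x * p x"]) measurable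
  also have "\<dots> = (\<integral>\<^sup>+x. indicator {s..<1} x * p x + indicator {1..<1+s} x * p x \<partial>lebesgue)"
    by (rule nn_integral_cong) (use s in \<open>auto simp: indicator_def\<close>)
  also have "\<dots> = (\<integral>\<^sup>+x. indicator {s..<1} x * p x \<partial>lebesgue) + (\<integral>\<^sup>+x. indicator {1..<1+s} x * p x \<partial>lebesgue)"
    by (rule nn_integral_add) measurable
  also have "(\<integral>\<^sup>+x. indicator {1..<1+s} x * p x \<partial>lebesgue) = (\<integral>\<^sup>+x. indicator {1..<1+s} (x + 1) * p (x + 1) \<partial>lebesgue)"
    by (rule nn_integral_lebesgue_shift[of "\<lambda>x. indicator {1..<1+s} x * p x" 1, symmetric]) measurable
  also have "\<dots> = (\<integral>\<^sup>+x. indicator {0..<s} x * p x \<partial>lebesgue)"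
    unfolding per by (rule nn_integral_cong) (auto simp: indicator_def)
  also have "(\<integral>\<^sup>+x. indicator {s..<1} x * p x \<partial>lebesgue) + (\<integral>\<^sup>+x. indicator {0..<s} x * p x \<partial>lebesgue)
      = (\<integral>\<^sup>+x. indicator {s..<1} x * p x + indicator {0..<s} x * p x \<partial>lebesgue)"
    by (rule nn_integral_add[symmetric]) measurable
  also have "\<dots> = (\<integral>\<^sup>+x. indicator {0..<1} x * p x \<partial>lebesgue)"
    by (rule nn_integral_cong) (use s in \<open>auto simp: indicator_def\<close>)
  finally show ?thesis .
qed

section \<open>Unitary operators on a subspace\<close>

lemma unitary_on_in: "unitary_on S T \<Longrightarrow> f \<in> S \<Longrightarrow> T f \<in> S"
  unfolding unitary_on_def by blast

lemma unitary_on_surj: "unitary_on S T \<Longrightarrow> g \<in> S \<Longrightarrow> \<exists>f\<in>S. T f = g"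
  unfolding unitary_on_def by (metis imageE)

lemma unitary_on_add: "unitary_on S T \<Longrightarrow> f \<in> S \<Longrightarrow> g \<in> S \<Longrightarrow> T (f + g) = T f + T g"
  unfolding unitary_on_def by blast

lemma unitary_on_scaleC: "unitary_on S T \<Longrightarrow> f \<in> S \<Longrightarrow> T (c *\<^sub>C f) = c *\<^sub>C T f"
  unfolding unitary_on_def by blast

lemma unitary_on_cinner: "unitary_on S T \<Longrightarrow> f \<in> S \<Longrightarrow> g \<in> S \<Longrightarrow> cinner (T f) (T g) = cinner f g"
  unfolding unitary_on_def by blast

lemma unitary_on_norm: "unitary_on S T \<Longrightarrow> f \<in> S \<Longrightarrow> norm (T f) = norm f"
  using unitary_on_cinner[of S T f f] by (simp add: cinner_self del: of_real_power)

lemma unitary_on_diff: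
  assumes "unitary_on (L2_on A) T" "f \<in> L2_on A" "g \<in> L2_on A"
  shows "T (f - g) = T f - T g"
proof -
  have "T (f + (-1) *\<^sub>C g) = T f + (-1) *\<^sub>C T g"
    using assms by (simp only: unitary_on_add[OF assms(1)] unitary_on_scaleC[OF assms(1)] L2_on_scaleC)
  then show ?thesis by (simp add: scaleC_minus_one)
qed

lemma unitary_on_inj:
  assumes "unitary_on (L2_on A) T" "f \<in> L2_on A" "g \<in> L2_on A" "T f = T g"
  shows "f = g"
proof -
  have "norm (T (f - g)) = norm (f - g)"
    by (rule unitary_on_norm[OF assms(1) L2_on_diff[OF assms(2,3)]])
  then show ?thesis using assms by (simp add: unitary_on_diff[OF assms(1-3)])
qed

lemma unitary_on_tendsto:
  assumes T: "unitary_on (L2_on A) T" and X: "\<And>n. X n \<in> L2_on A" and f: "f \<in> L2_on A" and lim: "X \<longlonglongrightarrow> f"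
  shows "(\<lambda>n. T (X n)) \<longlonglongrightarrow> T f"
proof -
  have "norm (T (X n) - T f) = norm (X n - f)" for n
    using unitary_on_norm[OF T L2_on_diff[OF X f]] unitary_on_diff[OF T X f] by simp
  then have "(\<lambda>n. norm (T (X n) - T f)) \<longlonglongrightarrow> 0"
    using tendsto_norm_zero[OF LIM_zero[OF lim]] by simp
  then show ?thesis
    by (intro LIM_zero_cancel[of "\<lambda>n. T (X n)"] tendsto_norm_zero_cancel[of "\<lambda>n. T (X n) - T f"])
qed

text \<open>Polarisation: the norm determines the real inner product, and by complex homogeneity
  also the imaginary part, through \<open>cinner_inner\<close>.\<close>

lemma unitary_on_norm_preservingI:
  assumes im: "T ` L2_on A = L2_on A"
    and add: "\<And>f g. f \<in> L2_on A \<Longrightarrow> g \<in> L2_on A \<Longrightarrow> T (f + g) = T f + T g"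
    and scale: "\<And>c f. f \<in> L2_on A \<Longrightarrow> T (c *\<^sub>C f) = c *\<^sub>C T f"
    and norm: "\<And>f. f \<in> L2_on A \<Longrightarrow> norm (T f) = norm f"
  shows "unitary_on (L2_on A) T"
proof -
  have inner: "T f \<bullet> T g = f \<bullet> g" if "f \<in> L2_on A" "g \<in> L2_on A" for f g
    using that by (simp add: dot_norm add[symmetric] norm L2_on_add)
  have "cinner (T f) (T g) = cinner f g" if "f \<in> L2_on A" "g \<in> L2_on A" for f g
    using that by (simp add: cinner_inner scale[symmetric] inner L2_on_scaleC)
  then show ?thesis unfolding unitary_on_def using im add scale by blast
qed

lemma unitary_on_inv_into:
  assumes T: "unitary_on (L2_on A) T"
  shows "unitary_on (L2_on A) (inv_into (L2_on A) T)"
    and "\<And>f. f \<in> L2_on A \<Longrightarrow> T (inv_into (L2_on A) T f) = f"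
    and "\<And>f. f \<in> L2_on A \<Longrightarrow> inv_into (L2_on A) T (T f) = f"
proof -
  let ?I = "inv_into (L2_on A) T"
  have im: "T ` L2_on A = L2_on A" using T by (simp add: unitary_on_def)
  show TI: "T (?I f) = f" if "f \<in> L2_on A" for f
    using f_inv_into_f[of f T "L2_on A"] that im by simp
  have inj: "inj_on T (L2_on A)" by (rule inj_onI) (rule unitary_on_inj[OF T])
  show IT: "?I (T f) = f" if "f \<in> L2_on A" for f
    by (rule inv_into_f_f[OF inj that])
  have I_in: "?I f \<in> L2_on A" if "f \<in> L2_on A" for f
    using inv_into_into[of f T "L2_on A"] that im by simp
  show "unitary_on (L2_on A) ?I"
  proof (rule unitary_on_norm_preservingI)
    show "?I ` L2_on A = L2_on A"
    proof (intro equalityI subsetI)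
      fix f assume "f \<in> L2_on A"
      then show "f \<in> ?I ` L2_on A" using IT[of f] unitary_on_in[OF T] by (metis imageI)
    qed (use I_in in auto)
    fix f g c assume f: "f \<in> L2_on A"
    show "norm (?I f) = norm f" using unitary_on_norm[OF T I_in[OF f]] TI[OF f] by simp
    show "?I (c *\<^sub>C f) = c *\<^sub>C ?I f"
      by (rule unitary_on_inj[OF T])
         (use f in \<open>simp_all add: I_in L2_on_scaleC unitary_on_scaleC[OF T] TI\<close>)
    assume g: "g \<in> L2_on A"
    show "?I (f + g) = ?I f + ?I g"
      by (rule unitary_on_inj[OF T])
         (use f g in \<open>simp_all add: I_in L2_on_add unitary_on_add[OF T] TI\<close>)
  qed
qed

lemma unitary_on_funpow:
  assumes "unitary_on (L2_on A) T"
  shows "unitary_on (L2_on A) (T ^^ n)"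
proof (induction n)
  case 0
  show ?case by (auto simp: unitary_on_def)
next
  case (Suc n)
  have "(T ^^ Suc n) ` L2_on A = T ` ((T ^^ n) ` L2_on A)" by (simp add: image_comp)
  also have "\<dots> = L2_on A" using Suc assms by (simp add: unitary_on_def)
  finally show ?case
    using unitary_on_in[OF Suc]
    by (intro unitary_on_norm_preservingI)
       (simp_all add: unitary_on_add[OF Suc] unitary_on_add[OF assms] unitary_on_scaleC[OF Suc]
         unitary_on_scaleC[OF assms] unitary_on_norm[OF Suc] unitary_on_norm[OF assms])
qed

section \<open>The boundary operator\<close>

locale bdry =
  fixes \<Omega> :: "'a::euclidean_space set" and V :: "'a L2 \<Rightarrow> 'a L2"
  assumes \<Omega>: "\<Omega> \<in> sets lebesgue" and V: "unitary_on (L2_on \<Omega>) V"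
begin

abbreviation "K \<equiv> L2_on \<Omega>"
abbreviation "S \<equiv> L2_on ({0<..<1::real} \<times> \<Omega>)"
abbreviation "U \<equiv> bdry_op \<Omega> V"
abbreviation "HV \<equiv> HV_space \<Omega> U"

lemma K_scaleR: "f \<in> K \<Longrightarrow> r *\<^sub>R f \<in> K"
  by (simp add: scaleR_L2_eq L2_on_scaleC)

text \<open>\<open>h \<mapsto> e\<^sup>-\<^sup>1 (g - W h)\<close> is a contraction.\<close>

lemma fixed_point_K:
  assumes W: "unitary_on K W" and g: "g \<in> K"
  shows "\<exists>h\<in>K. exp 1 *\<^sub>R h + W h = g"
proof -
  let ?T = "\<lambda>h. exp (- 1) *\<^sub>R (g - W h)"
  have "\<exists>!h. h \<in> K \<and> ?T h = h"
  proof (rule Banach_fix[of _ "exp (- 1)"])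
    show "complete K" using closed_L2_on[OF \<Omega>] by (simp add: complete_eq_closed)
    show "K \<noteq> {}" using L2_on_zero by blast
    show "?T ` K \<subseteq> K" using unitary_on_in[OF W] g by (auto intro!: K_scaleR L2_on_diff)
    fix x y assume xy: "x \<in> K" "y \<in> K"
    have "?T x - ?T y = exp (-1) *\<^sub>R W (y - x)"
      by (simp add: unitary_on_diff[OF W xy(2,1)] scaleR_diff_right)
    then show "dist (?T x) (?T y) \<le> exp (- 1) * dist x y"
      using unitary_on_norm[OF W L2_on_diff[OF xy(2,1)]] by (simp add: dist_norm norm_minus_commute)
  qed auto
  then obtain h where h: "h \<in> K" "exp (- 1) *\<^sub>R (g - W h) = h" by blast
  from arg_cong[OF h(2), of "\<lambda>f. exp 1 *\<^sub>R f"] have "exp 1 *\<^sub>R h = (exp 1 * exp (-1)) *\<^sub>R (g - W h)"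
    by simp
  also have "exp 1 * exp (-1) = (1::real)" by (simp add: exp_minus)
  finally show ?thesis using h(1) by (intro bexI[of _ h]) auto
qed

text \<open>With k = V h the equation becomes e k + V^-1 k = g, an instance of
  \<open>fixed_point_K\<close> for the inverse of \<open>V\<close>.\<close>

lemma bdry_surj1:
  assumes "g \<in> K"
  shows "\<exists>h\<in>K. h + exp 1 *\<^sub>R V h = g"
proof -
  note I = unitary_on_inv_into[OF V]
  obtain k where k: "k \<in> K" "exp 1 *\<^sub>R k + inv_into K V k = g"
    using fixed_point_K[OF I(1) assms] by blast
  show ?thesis
    using k I(2)[OF k(1)] unitary_on_in[OF I(1) k(1)] by (intro bexI[of _ "inv_into K V k"]) (auto simp: add.commute)
qed

lemma U_eq: "h \<in> K \<Longrightarrow> U (h + exp 1 *\<^sub>R V h) = exp 1 *\<^sub>R h + V h"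
  by (rule bdry_op_boundary_condition[OF V])

text \<open>The vectors h + e V h and e h + V h have the same squared norm, (1 + e^2) |h|^2 + 2 e
  Re(h, V h), because |V h| = |h|. Surjectivity is solvability of e h + V h = g.\<close>

lemma U_unitary: "unitary_on K U"
proof (rule unitary_on_norm_preservingI)
  have in1: "h + exp 1 *\<^sub>R V h \<in> K" and in2: "exp 1 *\<^sub>R h + V h \<in> K" if "h \<in> K" for h
    using that unitary_on_in[OF V that] by (auto intro!: L2_on_add K_scaleR)
  show "U ` K = K"
  proof (intro equalityI subsetI)
    fix g assume "g \<in> K"
    then obtain h where h: "h \<in> K" "exp 1 *\<^sub>R h + V h = g" using fixed_point_K[OF V] by blast
    then show "g \<in> U ` K" using U_eq[OF h(1)] in1[OF h(1)] by (metis imageI)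
  next
    fix g assume "g \<in> U ` K"
    then obtain k where k: "k \<in> K" "g = U k" by blast
    then obtain h where h: "h \<in> K" "h + exp 1 *\<^sub>R V h = k" using bdry_surj1 by blast
    then show "g \<in> K" using U_eq[OF h(1)] in2[OF h(1)] k by simp
  qed
  fix f g c assume "f \<in> K"
  then obtain h where h: "h \<in> K" "h + exp 1 *\<^sub>R V h = f" using bdry_surj1 by blast
  have "norm (exp 1 *\<^sub>R h + V h) ^ 2 = norm (h + exp 1 *\<^sub>R V h) ^ 2"
    using unitary_on_cinner[OF V h(1) h(1)]
    by (simp add: power2_norm_eq_inner inner_add_left inner_add_right inner_commute inner_L2_def[of h h]
        inner_L2_def[of "V h" "V h"])
  then show "norm (U f) = norm f"
    using U_eq[OF h(1)] h(2) by (simp add: power2_eq_iff_nonneg)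
  have "c *\<^sub>C f = c *\<^sub>C h + exp 1 *\<^sub>R V (c *\<^sub>C h)"
    by (simp add: h(2)[symmetric] unitary_on_scaleC[OF V h(1)] scaleC_add_right scaleC_scaleR_commute)
  then show "U (c *\<^sub>C f) = c *\<^sub>C U f"
    using U_eq[OF L2_on_scaleC[OF h(1), of c]] U_eq[OF h(1)] h(2)
    by (simp add: unitary_on_scaleC[OF V h(1)] scaleC_add_right scaleC_scaleR_commute)
  assume "g \<in> K"
  then obtain k where k: "k \<in> K" "k + exp 1 *\<^sub>R V k = g" using bdry_surj1 by blast
  have "f + g = (h + k) + exp 1 *\<^sub>R V (h + k)"
    by (simp add: h(2)[symmetric] k(2)[symmetric] unitary_on_add[OF V h(1) k(1)] scaleR_add_right)
  then show "U (f + g) = U f + U g"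
    using U_eq[OF L2_on_add[OF h(1) k(1)]] U_eq[OF h(1)] h(2) U_eq[OF k(1)] k(2)
    by (simp add: unitary_on_add[OF V h(1) k(1)] scaleR_add_right)
qed

text \<open>Integer powers, with the inverse taken on \<open>K\<close>, where \<open>U\<close> is a
  bijection.\<close>

definition Upow :: "int \<Rightarrow> 'a L2 \<Rightarrow> 'a L2" where
  "Upow n = (if 0 \<le> n then U ^^ nat n else inv_into K U ^^ nat (- n))"

lemma Upow_unitary: "unitary_on K (Upow n)"
  unfolding Upow_def using unitary_on_funpow[OF U_unitary] unitary_on_funpow[OF unitary_on_inv_into(1)[OF U_unitary]]
  by simp

lemma Upow_0 [simp]: "Upow 0 f = f"
  by (simp add: Upow_def)

lemma Upow_Suc:
  assumes "f \<in> K"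
  shows "Upow (n + 1) f = U (Upow n f)"
proof (cases "0 \<le> n")
  case True
  then have "nat (n + 1) = Suc (nat n)" by simp
  with True show ?thesis by (simp add: Upow_def)
next
  case False
  define m where "m = nat (- n - 1)"
  have n: "n = - int m - 1" using False by (simp add: m_def)
  have "(inv_into K U ^^ m) f \<in> K"
    by (rule unitary_on_in[OF unitary_on_funpow[OF unitary_on_inv_into(1)[OF U_unitary]] assms])
  then have "U ((inv_into K U ^^ Suc m) f) = (inv_into K U ^^ m) f"
    using unitary_on_inv_into(2)[OF U_unitary] by simp
  moreover have "Upow n f = (inv_into K U ^^ Suc m) f"
    by (simp add: Upow_def n nat_add_distrib)
  moreover have "Upow (n + 1) f = (inv_into K U ^^ m) f"
    by (cases "m = 0") (simp_all add: Upow_def n)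
  ultimately show ?thesis by simp
qed

section \<open>Functions on the line with the boundary condition as period rule\<close>

lemma HV_measurable: "f \<in> HV \<Longrightarrow> f \<in> borel_measurable lebesgue"
  and HV_K: "f \<in> HV \<Longrightarrow> f x \<in> K"
  and HV_step: "f \<in> HV \<Longrightarrow> f (x + 1) = U (f x)"
  and HV_int: "f \<in> HV \<Longrightarrow> set_integrable lebesgue {0<..<1} (\<lambda>x. (norm (f x))\<^sup>2)"
  unfolding HV_space_def by auto

lemma HV_norm_step: "f \<in> HV \<Longrightarrow> norm (f (x + 1)) = norm (f x)"
  by (simp add: HV_step unitary_on_norm[OF U_unitary HV_K])

text \<open>Finiteness is tested over [0,1), a full period as in
  \<open>nn_integral_periodic_shift\<close>, whereas \<open>HV_space\<close> integrates over the
  open interval; the two differ by the null set {0}.\<close>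

lemma HV_I:
  assumes m [measurable]: "f \<in> borel_measurable lebesgue" and "\<And>x. f x \<in> K" "\<And>x. f (x + 1) = U (f x)"
    and fin: "(\<integral>\<^sup>+x. indicator {0..<1} x * ennreal ((norm (f x))\<^sup>2) \<partial>lebesgue) < \<infinity>"
  shows "f \<in> HV"
proof -
  have [measurable]: "{0<..<1::real} \<in> sets lebesgue" by simp
  have "integrable lebesgue (\<lambda>x. indicator {0<..<1} x *\<^sub>R (norm (f x))\<^sup>2)"
  proof (rule integrableI_bounded)
    show "(\<lambda>x. indicator {0<..<1} x *\<^sub>R (norm (f x))\<^sup>2) \<in> borel_measurable lebesgue" by measurable
    have "(\<integral>\<^sup>+x. ennreal (norm (indicator {0<..<1} x *\<^sub>R (norm (f x))\<^sup>2)) \<partial>lebesgue)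
        \<le> (\<integral>\<^sup>+x. indicator {0..<1} x * ennreal ((norm (f x))\<^sup>2) \<partial>lebesgue)"
      by (rule nn_integral_mono) (auto simp: indicator_def)
    then show "(\<integral>\<^sup>+x. ennreal (norm (indicator {0<..<1} x *\<^sub>R (norm (f x))\<^sup>2)) \<partial>lebesgue) < \<infinity>"
      using fin by (rule le_less_trans)
  qed
  then show ?thesis using assms unfolding HV_space_def set_integrable_def by blast
qed

lemma HV_nn:
  assumes "f \<in> HV"
  shows "(\<integral>\<^sup>+x. indicator {0..<1} x * ennreal ((norm (f x))\<^sup>2) \<partial>lebesgue) = ennreal ((HV_norm f)\<^sup>2)"
proof -
  have i: "integrable lebesgue (\<lambda>x. indicator {0<..<1} x *\<^sub>R (norm (f x))\<^sup>2)"
    using HV_int[OF assms] unfolding set_integrable_def .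
  have "AE x in lebesgue. x \<noteq> (0::real)"
    by (rule AE_not_in[of "{0::real}", simplified]) simp
  then have "(\<integral>\<^sup>+x. indicator {0..<1} x * ennreal ((norm (f x))\<^sup>2) \<partial>lebesgue)
      = (\<integral>\<^sup>+x. ennreal (indicator {0<..<1} x *\<^sub>R (norm (f x))\<^sup>2) \<partial>lebesgue)"
    by (intro nn_integral_cong_AE, eventually_elim) (auto simp: indicator_def)
  also have "\<dots> = ennreal (\<integral>x. indicator {0<..<1} x *\<^sub>R (norm (f x))\<^sup>2 \<partial>lebesgue)"
    by (rule nn_integral_eq_integral[OF i]) (auto simp: indicator_def)
  also have "(\<integral>x. indicator {0<..<1} x *\<^sub>R (norm (f x))\<^sup>2 \<partial>lebesgue) = (HV_norm f)\<^sup>2"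
    unfolding HV_norm_def set_lebesgue_integral_def
    by (subst real_sqrt_pow2) (auto intro!: integral_nonneg_AE simp: indicator_def)
  finally show ?thesis .
qed

lemma HV_add:
  assumes f: "f \<in> HV" and g: "g \<in> HV"
  shows "(\<lambda>x. f x + g x) \<in> HV"
proof (rule HV_I)
  have [measurable]: "f \<in> borel_measurable lebesgue" "g \<in> borel_measurable lebesgue"
    using f g by (auto intro: HV_measurable)
  have [measurable]: "{0..<1::real} \<in> sets lebesgue" by simp
  show "(\<lambda>x. f x + g x) \<in> borel_measurable lebesgue" by measurable
  show "f x + g x \<in> K" for x by (intro L2_on_add HV_K f g)
  show "f (x + 1) + g (x + 1) = U (f x + g x)" for x
    by (simp add: HV_step f g unitary_on_add[OF U_unitary HV_K[OF f] HV_K[OF g]])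
  have "(\<integral>\<^sup>+x. indicator {0..<1} x * ennreal ((norm (f x + g x))\<^sup>2) \<partial>lebesgue)
      \<le> (\<integral>\<^sup>+x. 2 * (indicator {0..<1} x * ennreal ((norm (f x))\<^sup>2)) + 2 * (indicator {0..<1} x * ennreal ((norm (g x))\<^sup>2)) \<partial>lebesgue)"
  proof (rule nn_integral_mono)
    fix x
    show "indicator {0..<1} x * ennreal ((norm (f x + g x))\<^sup>2)
        \<le> 2 * (indicator {0..<1} x * ennreal ((norm (f x))\<^sup>2)) + 2 * (indicator {0..<1} x * ennreal ((norm (g x))\<^sup>2))"
      using ennreal_norm_add_sq_le[of "f x" "g x"]
      by (simp add: indicator_def)
  qed
  also have "\<dots> = 2 * ennreal ((HV_norm f)\<^sup>2) + 2 * ennreal ((HV_norm g)\<^sup>2)"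
    unfolding HV_nn[OF f, symmetric] HV_nn[OF g, symmetric]
    by (subst nn_integral_add) (simp_all add: nn_integral_cmult)
  also have "\<dots> < \<infinity>" by (simp add: ennreal_mult_less_top)
  finally show "(\<integral>\<^sup>+x. indicator {0..<1} x * ennreal ((norm (f x + g x))\<^sup>2) \<partial>lebesgue) < \<infinity>" .
qed

lemma measurable_L2_scaleC:
  fixes f :: "real \<Rightarrow> 'a L2"
  assumes "f \<in> borel_measurable lebesgue"
  shows "(\<lambda>x. c *\<^sub>C f x) \<in> borel_measurable lebesgue"
  by (rule measurable_compose[OF assms borel_measurable_continuous_onI])
     (intro linear_continuous_on bounded_linear_scaleC)

lemma HV_scaleC:
  assumes f: "f \<in> HV"
  shows "(\<lambda>x. c *\<^sub>C f x) \<in> HV"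
proof (rule HV_I)
  have [measurable]: "f \<in> borel_measurable lebesgue" using f by (rule HV_measurable)
  have [measurable]: "{0..<1::real} \<in> sets lebesgue" by simp
  show "(\<lambda>x. c *\<^sub>C f x) \<in> borel_measurable lebesgue" by (rule measurable_L2_scaleC[OF HV_measurable[OF f]])
  show "c *\<^sub>C f x \<in> K" for x by (intro L2_on_scaleC HV_K f)
  show "c *\<^sub>C f (x + 1) = U (c *\<^sub>C f x)" for x
    by (simp add: HV_step f unitary_on_scaleC[OF U_unitary HV_K[OF f]])
  have "(\<integral>\<^sup>+x. indicator {0..<1} x * ennreal ((norm (c *\<^sub>C f x))\<^sup>2) \<partial>lebesgue)
      = (\<integral>\<^sup>+x. ennreal ((cmod c)\<^sup>2) * (indicator {0..<1} x * ennreal ((norm (f x))\<^sup>2)) \<partial>lebesgue)"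
    by (rule nn_integral_cong) (auto simp: indicator_def power_mult_distrib ennreal_mult)
  also have "\<dots> = ennreal ((cmod c)\<^sup>2) * ennreal ((HV_norm f)\<^sup>2)"
    unfolding HV_nn[OF f, symmetric] by (rule nn_integral_cmult) measurable
  also have "\<dots> < \<infinity>" by (simp add: ennreal_mult_less_top)
  finally show "(\<integral>\<^sup>+x. indicator {0..<1} x * ennreal ((norm (c *\<^sub>C f x))\<^sup>2) \<partial>lebesgue) < \<infinity>" .
qed

lemma HV_shift:
  assumes f: "f \<in> HV"
  shows "(\<lambda>x. f (x - t)) \<in> HV" "HV_norm (\<lambda>x. f (x - t)) = HV_norm f"
proof -
  have [measurable]: "f \<in> borel_measurable lebesgue" using f by (rule HV_measurable)
  have m: "(\<lambda>x. f (x + (- t))) \<in> borel_measurable lebesgue"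
    by (rule measurable_compose[OF measurable_lebesgue_shift HV_measurable[OF f]])
  have nn: "(\<integral>\<^sup>+x. indicator {0..<1} x * ennreal ((norm (f (x - t)))\<^sup>2) \<partial>lebesgue) = ennreal ((HV_norm f)\<^sup>2)"
    using nn_integral_periodic_shift[of "\<lambda>x. ennreal ((norm (f x))\<^sup>2)" "- t"]
    by (simp add: HV_norm_step[OF f] HV_nn[OF f])
  show sh: "(\<lambda>x. f (x - t)) \<in> HV"
  proof (rule HV_I)
    show "(\<lambda>x. f (x - t)) \<in> borel_measurable lebesgue" using m by simp
    show "f (x + 1 - t) = U (f (x - t))" for x using HV_step[OF f, of "x - t"] by (simp add: algebra_simps)
  qed (simp_all add: HV_K[OF f] nn)
  have "ennreal ((HV_norm (\<lambda>x. f (x - t)))\<^sup>2) = ennreal ((HV_norm f)\<^sup>2)"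
    using HV_nn[OF sh] nn by simp
  moreover have "HV_norm f \<ge> 0" for f :: "real \<Rightarrow> 'a L2"
    unfolding HV_norm_def set_lebesgue_integral_def
    by (auto intro!: integral_nonneg_AE simp: indicator_def)
  ultimately show "HV_norm (\<lambda>x. f (x - t)) = HV_norm f"
    by (simp add: power2_eq_iff_nonneg)
qed

lemma
  assumes f: "f \<in> HV"
  shows restrict01_S: "restrict01 \<Omega> f \<in> S"
    and restrict01_slice: "AE x in lebesgue. x \<in> {0<..<1} \<longrightarrow> slice (restrict01 \<Omega> f) x = f x"
    and restrict01_norm: "norm (restrict01 \<Omega> f) = HV_norm f"
  using restrict01_ex[OF \<Omega> HV_measurable[OF f] HV_K[OF f] HV_int[OF f]] by auto

text \<open>Equality at one point of an orbit under integer shifts spreads over the orbit: upwards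
  by applying \<open>U\<close>, downwards by its injectivity. Almost every orbit meets (0,1) outside
  the exceptional set, since there are only countably many shifts.\<close>

lemma HV_AE_eqI:
  assumes f: "f \<in> HV" and g: "g \<in> HV" and ae: "AE x in lebesgue. x \<in> {0<..<1} \<longrightarrow> f x = g x"
  shows "AE x in lebesgue. f x = g x"
proof -
  have up: "f x = g x" if "f (x + of_int n) = g (x + of_int n)" for x n
    using that
  proof (induction n arbitrary: x rule: int_induct[where k=0])
    case (step1 i)
    have "f (x + of_int i + 1) = g (x + of_int i + 1)" using step1 by (simp add: add.assoc)
    then have "f (x + of_int i) = g (x + of_int i)"
      by (intro unitary_on_inj[OF U_unitary HV_K[OF f] HV_K[OF g]]) (simp add: HV_step f g)
    then show ?case by (rule step1)
  next
    case (step2 i)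
    have "f (x + of_int (i - 1) + 1) = g (x + of_int (i - 1) + 1)" 
      using step2(3) HV_step[OF f, of "x + of_int (i - 1)"] HV_step[OF g, of "x + of_int (i - 1)"] by simp
    then show ?case using step2(2)[of x] by (simp add: add.assoc)
  qed simp
  have "AE x in lebesgue. \<forall>n::int. x + of_int n \<in> {0<..<1} \<longrightarrow> f (x + of_int n) = g (x + of_int n)"
    unfolding AE_all_countable using AE_lebesgue_shift[OF ae] by blast
  moreover have "AE x in lebesgue. \<forall>n::int. x + of_int n \<noteq> (0::real)"
  proof -
    have "AE x in lebesgue. x \<noteq> (0::real)"
      by (rule AE_not_in[of "{0::real}", simplified]) simp
    from AE_lebesgue_shift[OF this] show ?thesis unfolding AE_all_countable by blast
  qed
  ultimately show ?thesis
  proof eventually_elim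
    case (elim x)
    have "x + of_int (- \<lfloor>x\<rfloor>) = frac x" by (simp add: frac_def)
    \<comment> \<open>Integers have to be excluded: their representative 0 is not in the open
      interval where equality is assumed.\<close>
    moreover have "frac x \<noteq> 0" using elim(2)[rule_format, of "- \<lfloor>x\<rfloor>"] by (simp add: frac_def)
    then have "frac x \<in> {0<..<1}" using frac_ge_0[of x] frac_lt_1[of x] by auto
    ultimately have "f (x + of_int (- \<lfloor>x\<rfloor>)) = g (x + of_int (- \<lfloor>x\<rfloor>))"
      using elim(1)[rule_format, of "- \<lfloor>x\<rfloor>"] by simp
    then show ?case by (rule up)
  qed
qed

lemma restrict01_eq_iff:
  assumes f: "f \<in> HV" and g: "g \<in> HV"
  shows "restrict01 \<Omega> f = restrict01 \<Omega> g \<longleftrightarrow> (AE x in lebesgue. f x = g x)"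
proof
  assume eq: "restrict01 \<Omega> f = restrict01 \<Omega> g"
  have "AE x in lebesgue. x \<in> {0<..<1} \<longrightarrow> f x = g x"
    using restrict01_slice[OF f, unfolded eq] restrict01_slice[OF g] by eventually_elim auto
  then show "AE x in lebesgue. f x = g x" by (rule HV_AE_eqI[OF f g])
next
  assume ae: "AE x in lebesgue. f x = g x"
  show "restrict01 \<Omega> f = restrict01 \<Omega> g"
    by (rule restrict01_eqI[OF \<Omega> restrict01_S[OF g]], use ae restrict01_slice[OF g] in eventually_elim) simp
qed

lemma restrict01_add:
  assumes f: "f \<in> HV" and g: "g \<in> HV"
  shows "restrict01 \<Omega> (\<lambda>x. f x + g x) = restrict01 \<Omega> f + restrict01 \<Omega> g"
  by (rule restrict01_eqI[OF \<Omega> L2_on_add[OF restrict01_S[OF f] restrict01_S[OF g]]],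
      use restrict01_slice[OF f] restrict01_slice[OF g] slice_add[of "restrict01 \<Omega> f" "restrict01 \<Omega> g"]
      in eventually_elim) simp

lemma restrict01_scaleC:
  assumes f: "f \<in> HV"
  shows "restrict01 \<Omega> (\<lambda>x. c *\<^sub>C f x) = c *\<^sub>C restrict01 \<Omega> f"
  by (rule restrict01_eqI[OF \<Omega> L2_on_scaleC[OF restrict01_S[OF f]]],
      use restrict01_slice[OF f] slice_scaleC[of c "restrict01 \<Omega> f"] in eventually_elim) simp

text \<open>The extension of \<open>g\<close> from \<open>[0,1)\<close> to the line with \<open>wrap g (x + 1) = U (wrap g x)\<close>.\<close>

definition wrap :: "(real \<Rightarrow> 'a L2) \<Rightarrow> real \<Rightarrow> 'a L2" where
  "wrap g x = Upow \<lfloor>x\<rfloor> (g (frac x))"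

lemma wrap_eq:
  assumes "x \<in> {0..<1}"
  shows "wrap g x = g x"
proof -
  have "\<lfloor>x\<rfloor> = 0" "frac x = x" using assms by (simp_all add: floor_eq_iff frac_eq)
  then show ?thesis by (simp add: wrap_def)
qed

lemma wrap_in_HV:
  assumes m: "g \<in> borel_measurable lebesgue" and K: "\<And>x. g x \<in> K"
    and fin: "(\<integral>\<^sup>+x. indicator {0..<1} x * ennreal ((norm (g x))\<^sup>2) \<partial>lebesgue) < \<infinity>"
  shows "wrap g \<in> HV"
proof (rule HV_I)
  \<comment> \<open>\<open>Upow n\<close> is linear on \<open>K\<close> only. Preceded by the
    projection it becomes a bounded operator on the whole space, hence Borel measurable, and the
    countably many values of the floor function are then glued together.\<close>
  have lin: "bounded_linear (\<lambda>k. Upow n (mask \<Omega> k))" for n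
  proof (rule bounded_linear_intro[where K=1])
    fix f h :: "'a L2" and r :: real
    note mi = mask_in_L2_on[OF \<Omega>]
    show "Upow n (mask \<Omega> (f + h)) = Upow n (mask \<Omega> f) + Upow n (mask \<Omega> h)"
      by (simp add: mask_add[OF \<Omega>] unitary_on_add[OF Upow_unitary mi mi])
    show "Upow n (mask \<Omega> (r *\<^sub>R f)) = r *\<^sub>R Upow n (mask \<Omega> f)"
      by (simp add: scaleR_L2_eq mask_scaleC[OF \<Omega>] unitary_on_scaleC[OF Upow_unitary mi])
    show "norm (Upow n (mask \<Omega> f)) \<le> norm f * 1"
      by (simp add: unitary_on_norm[OF Upow_unitary mi] norm_mask_le[OF \<Omega>])
  qed
  have "(\<lambda>x. Upow n (mask \<Omega> (g (x + - of_int n)))) \<in> borel_measurable lebesgue" for n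
    by (rule measurable_compose[OF measurable_compose[OF measurable_lebesgue_shift m]
          borel_measurable_continuous_onI[OF linear_continuous_on[OF lin]]])
  then have "(\<lambda>x. Upow n (g (x - of_int n))) \<in> borel_measurable lebesgue" for n
    using K by (simp add: mask_eq_iff[OF \<Omega>, THEN iffD2])
  moreover have "(floor :: real \<Rightarrow> int) \<in> lebesgue \<rightarrow>\<^sub>M count_space (UNIV :: int set)"
    by (rule measurable_completion) (use measurable_real_floor in simp)
  ultimately have "(\<lambda>x. Upow \<lfloor>x\<rfloor> (g (x - of_int \<lfloor>x\<rfloor>))) \<in> borel_measurable lebesgue"
    by (rule measurable_compose_countable)
  then show "wrap g \<in> borel_measurable lebesgue"
    by (simp add: wrap_def[abs_def] frac_def)
  show "wrap g x \<in> K" for x unfolding wrap_def by (rule unitary_on_in[OF Upow_unitary K])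
  show "wrap g (x + 1) = U (wrap g x)" for x
    unfolding wrap_def by (simp add: Upow_Suc[OF K] frac_def)
  have "(\<integral>\<^sup>+x. indicator {0..<1} x * ennreal ((norm (wrap g x))\<^sup>2) \<partial>lebesgue)
      = (\<integral>\<^sup>+x. indicator {0..<1} x * ennreal ((norm (g x))\<^sup>2) \<partial>lebesgue)"
  proof (rule nn_integral_cong)
    fix x
    show "indicator {0..<1} x * ennreal ((norm (wrap g x))\<^sup>2) = indicator {0..<1} x * ennreal ((norm (g x))\<^sup>2)"
      by (simp add: indicator_def wrap_eq)
  qed
  with fin show "(\<integral>\<^sup>+x. indicator {0..<1} x * ennreal ((norm (wrap g x))\<^sup>2) \<partial>lebesgue) < \<infinity>" by simp
qed

text \<open>\<open>slice F x\<close> is an unspecified vector for \<open>x\<close> in a null set; the projection onto \<open>K\<close>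
  makes the values lie in \<open>K\<close> for every \<open>x\<close>.\<close>

definition ext :: "(real \<times> 'a) L2 \<Rightarrow> real \<Rightarrow> 'a L2" where
  "ext F = wrap (\<lambda>x. indicator {0<..<1} x *\<^sub>R mask \<Omega> (slice F x))"

lemma ext_in_HV: "ext F \<in> HV"
  unfolding ext_def
proof (rule wrap_in_HV)
  have "(\<lambda>x. mask \<Omega> (slice F x)) \<in> borel_measurable lebesgue"
    by (rule measurable_compose[OF slice_measurable borel_measurable_continuous_onI[OF linear_continuous_on[OF bounded_linear_mask[OF \<Omega>]]]])
  then show "(\<lambda>x. indicator {0<..<1} x *\<^sub>R mask \<Omega> (slice F x)) \<in> borel_measurable lebesgue"
    by (intro borel_measurable_scaleR borel_measurable_indicator) simp_all
  show "indicator {0<..<1} x *\<^sub>R mask \<Omega> (slice F x) \<in> K" for x :: real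
    by (intro K_scaleR mask_in_L2_on[OF \<Omega>])
  have "(\<integral>\<^sup>+x. indicator {0..<1} x * ennreal ((norm (indicator {0<..<1} x *\<^sub>R mask \<Omega> (slice F x)))\<^sup>2) \<partial>lebesgue)
      \<le> (\<integral>\<^sup>+x. ennreal ((norm (slice F x))\<^sup>2) \<partial>lebesgue)"
  proof (rule nn_integral_mono)
    fix x :: real
    show "indicator {0..<1} x * ennreal ((norm (indicator {0<..<1} x *\<^sub>R mask \<Omega> (slice F x)))\<^sup>2) \<le> ennreal ((norm (slice F x))\<^sup>2)"
      using norm_mask_le[OF \<Omega>, of "slice F x"] by (auto simp: indicator_def intro!: ennreal_leI power_mono)
  qed
  also have "\<dots> < \<infinity>" unfolding norm_slices(1)[symmetric] by simp
  finally show "(\<integral>\<^sup>+x. indicator {0..<1} x * ennreal ((norm (indicator {0<..<1} x *\<^sub>R mask \<Omega> (slice F x)))\<^sup>2) \<partial>lebesgue) < \<infinity>" .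
qed

lemma ext_slice:
  assumes "F \<in> S"
  shows "AE x in lebesgue. x \<in> {0<..<1} \<longrightarrow> slice F x = ext F x"
  using assms[unfolded L2_on_slab_iff[OF \<Omega>]]
  by eventually_elim (auto simp: ext_def wrap_eq mask_eq_iff[OF \<Omega>, THEN iffD2])

lemma restrict01_ext: "F \<in> S \<Longrightarrow> restrict01 \<Omega> (ext F) = F"
  by (intro restrict01_eqI[OF \<Omega>] ext_slice)

lemma ext_restrict01:
  assumes "f \<in> HV"
  shows "AE x in lebesgue. ext (restrict01 \<Omega> f) x = f x"
  using restrict01_eq_iff[OF ext_in_HV assms, of "restrict01 \<Omega> f"] restrict01_ext[OF restrict01_S[OF assms]] by simp

lemma restrict01_image: "restrict01 \<Omega> ` HV = S"
proof (intro equalityI subsetI)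
  fix F assume "F \<in> S"
  then show "F \<in> restrict01 \<Omega> ` HV" by (intro image_eqI[OF _ ext_in_HV[of F]]) (simp add: restrict01_ext)
qed (use restrict01_S in auto)

section \<open>Translation as a unitary group\<close>

definition transl :: "real \<Rightarrow> (real \<times> 'a) L2 \<Rightarrow> (real \<times> 'a) L2" where
  "transl t F = restrict01 \<Omega> (\<lambda>x. ext F (x - t))"

text \<open>The particular extension \<open>ext\<close> is immaterial: any two extensions agree
  almost everywhere on the line, and translation preserves null sets.\<close>

lemma transl_restrict01:
  assumes f: "f \<in> HV"
  shows "transl t (restrict01 \<Omega> f) = restrict01 \<Omega> (\<lambda>x. f (x - t))"
  unfolding transl_def restrict01_eq_iff[OF HV_shift(1)[OF ext_in_HV] HV_shift(1)[OF f]]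
  using AE_lebesgue_shift[OF ext_restrict01[OF f], of "- t"] by simp

lemma transl_S: "transl t F \<in> S"
  unfolding transl_def by (intro restrict01_S HV_shift(1) ext_in_HV)

lemma transl_0: "F \<in> S \<Longrightarrow> transl 0 F = F"
  by (simp add: transl_def restrict01_ext)

lemma transl_add:
  shows "transl (s + t) F = transl s (transl t F)"
proof -
  have "transl s (transl t F) = restrict01 \<Omega> (\<lambda>x. ext F (x - s - t))"
    unfolding transl_def[of t] by (rule transl_restrict01[OF HV_shift(1)[OF ext_in_HV]])
  then show ?thesis by (simp add: transl_def[of "s + t"] diff_diff_eq)
qed

lemma transl_unitary: "unitary_on S (transl t)"
proof (rule unitary_on_norm_preservingI)
  show "transl t ` S = S"
  proof (intro equalityI subsetI)
    fix F assume "F \<in> S"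
    then have "F = transl t (transl (- t) F)" using transl_add[of t "- t" F] by (simp add: transl_0)
    then show "F \<in> transl t ` S" using transl_S by blast
  qed (use transl_S in auto)
  fix F G c assume "F \<in> S"
  then obtain f where f: "f \<in> HV" "F = restrict01 \<Omega> f" using restrict01_ext ext_in_HV by metis
  show "norm (transl t F) = norm F"
    using f by (simp add: transl_restrict01 restrict01_norm HV_shift)
  show "transl t (c *\<^sub>C F) = c *\<^sub>C transl t F"
    using f by (simp add: transl_restrict01 restrict01_scaleC[symmetric] HV_shift HV_scaleC)
  assume "G \<in> S"
  then obtain g where g: "g \<in> HV" "G = restrict01 \<Omega> g" using restrict01_ext ext_in_HV by metis
  show "transl t (F + G) = transl t F + transl t G"
    using f g by (simp add: transl_restrict01 restrict01_add[symmetric] HV_shift HV_add)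
qed

end

section \<open>Generators of unitary groups\<close>

definition gen :: "'a::euclidean_space L2 set \<Rightarrow> (real \<Rightarrow> 'a L2 \<Rightarrow> 'a L2) \<Rightarrow> ('a L2 \<times> 'a L2) set" where
  "gen S U = {(f, g). f \<in> S \<and> ((\<lambda>t. (U t f - f) /\<^sub>R t) \<longlongrightarrow> (- \<i>) *\<^sub>C g) (at 0)}"

lemma generates_group_on_iff: "generates_group_on S H U \<longleftrightarrow> unitary_group_on S U \<and> H = gen S U"
  by (simp add: generates_group_on_def gen_def)

lemma has_vector_derivative_iff_quotient:
  fixes f :: "real \<Rightarrow> 'b::real_normed_vector"
  shows "(f has_vector_derivative D) (at x) \<longleftrightarrow> ((\<lambda>h. (f (x + h) - f x) /\<^sub>R h) \<longlongrightarrow> D) (at 0)"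
proof -
  have eq: "norm (f (x + h) - f x - h *\<^sub>R D) / norm h = norm ((f (x + h) - f x) /\<^sub>R h - D)" if "h \<noteq> 0" for h
  proof -
    have "norm ((f (x + h) - f x) /\<^sub>R h - D) = norm ((f (x + h) - f x - h *\<^sub>R D) /\<^sub>R h)"
      using that by (simp add: scaleR_diff_right)
    then show ?thesis by (simp add: divide_inverse mult.commute)
  qed
  have "(f has_vector_derivative D) (at x) \<longleftrightarrow> ((\<lambda>h. norm (f (x + h) - f x - h *\<^sub>R D) / norm h) \<longlongrightarrow> 0) (at 0)"
    unfolding has_vector_derivative_def has_derivative_at by (simp add: bounded_linear_scaleR_left)
  also have "\<dots> \<longleftrightarrow> ((\<lambda>h. norm ((f (x + h) - f x) /\<^sub>R h - D)) \<longlongrightarrow> 0) (at 0)"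
  proof (rule filterlim_cong[OF refl refl])
    show "\<forall>\<^sub>F h in at 0. norm (f (x + h) - f x - h *\<^sub>R D) / norm h = norm ((f (x + h) - f x) /\<^sub>R h - D)"
      unfolding eventually_at_filter by (rule always_eventually) (use eq in blast)
  qed
  also have "\<dots> \<longleftrightarrow> ((\<lambda>h. (f (x + h) - f x) /\<^sub>R h) \<longlongrightarrow> D) (at 0)"
    by (subst tendsto_norm_zero_iff) (rule LIM_zero_iff)
  finally show ?thesis .
qed

text \<open>Stated for an arbitrary group, because uniqueness compares the translation group with
  any other group that has the same generator.\<close>

locale unitary_group =
  fixes A :: "'a::euclidean_space set" and T :: "real \<Rightarrow> 'a L2 \<Rightarrow> 'a L2"
  assumes A: "A \<in> sets lebesgue" and group: "unitary_group_on (L2_on A) T"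
begin

abbreviation "S \<equiv> L2_on A"
abbreviation "B \<equiv> gen S T"

lemma T_unitary: "unitary_on S (T t)"
  and T_0: "f \<in> S \<Longrightarrow> T 0 f = f"
  and T_add: "f \<in> S \<Longrightarrow> T (s + t) f = T s (T t f)"
  and T_cont: "f \<in> S \<Longrightarrow> continuous_on UNIV (\<lambda>t. T t f)"
  using group unfolding unitary_group_on_def by auto

lemma T_tendsto_0: "f \<in> S \<Longrightarrow> ((\<lambda>t. T t f) \<longlongrightarrow> f) (at 0)"
proof -
  assume f: "f \<in> S"
  have "((\<lambda>t. T t f) \<longlongrightarrow> T 0 f) (at 0)" using T_cont[OF f] unfolding continuous_on_def by blast
  then show "((\<lambda>t. T t f) \<longlongrightarrow> f) (at 0)" by (simp only: T_0[OF f])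
qed

lemma gen_S:
  assumes "(f, g) \<in> B"
  shows "f \<in> S" "g \<in> S"
proof -
  show f: "f \<in> S" using assms by (simp add: gen_def)
  have lim: "((\<lambda>t. (T t f - f) /\<^sub>R t) \<longlongrightarrow> (- \<i>) *\<^sub>C g) (at 0)" using assms by (simp add: gen_def)
  have "(- \<i>) *\<^sub>C g \<in> S"
    by (rule Lim_in_closed_set[OF closed_L2_on[OF A] _ _ lim])
       (auto simp: scaleR_L2_eq intro!: always_eventually L2_on_scaleC L2_on_diff unitary_on_in[OF T_unitary] f)
  from L2_on_scaleC[OF this, of "\<i>"] show "g \<in> S" by simp
qed

lemma gen_lim: "(f, g) \<in> B \<Longrightarrow> ((\<lambda>t. (T t f - f) /\<^sub>R t) \<longlongrightarrow> (- \<i>) *\<^sub>C g) (at 0)"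
  by (simp add: gen_def)

lemma gen_add:
  assumes "(f, g) \<in> B" "(u, v) \<in> B"
  shows "(f + u, g + v) \<in> B"
proof -
  have "((\<lambda>t. (T t f - f) /\<^sub>R t + (T t u - u) /\<^sub>R t) \<longlongrightarrow> (- \<i>) *\<^sub>C g + (- \<i>) *\<^sub>C v) (at 0)"
    by (intro tendsto_add gen_lim assms)
  also have "(\<lambda>t. (T t f - f) /\<^sub>R t + (T t u - u) /\<^sub>R t) = (\<lambda>t. (T t (f + u) - (f + u)) /\<^sub>R t)"
    using assms by (auto simp: unitary_on_add[OF T_unitary] gen_S algebra_simps)
  finally show ?thesis
    using assms by (simp only: scaleC_add_right[symmetric]) (simp add: gen_def L2_on_add)
qed

lemma gen_scaleC:
  assumes "(f, g) \<in> B"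
  shows "(c *\<^sub>C f, c *\<^sub>C g) \<in> B"
proof -
  have "((\<lambda>t. c *\<^sub>C ((T t f - f) /\<^sub>R t)) \<longlongrightarrow> c *\<^sub>C ((- \<i>) *\<^sub>C g)) (at 0)"
    by (intro tendsto_scaleC_const gen_lim assms)
  also have "(\<lambda>t. c *\<^sub>C ((T t f - f) /\<^sub>R t)) = (\<lambda>t. (T t (c *\<^sub>C f) - c *\<^sub>C f) /\<^sub>R t)"
    using gen_S[OF assms] by (auto simp: unitary_on_scaleC[OF T_unitary] scaleC_scaleR_commute scaleC_diff_right)
  finally show ?thesis
    using gen_S[OF assms] by (simp add: gen_def L2_on_scaleC mult.commute)
qed

lemma gen_diff:
  assumes "(f, g) \<in> B" "(u, v) \<in> B"
  shows "(f - u, g - v) \<in> B"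
  using gen_add[OF assms(1) gen_scaleC[OF assms(2), of "-1"]] by (simp add: scaleC_minus_one)

lemma subspace_gen: "subspace B"
  unfolding subspace_def
proof safe
  have "T t 0 = 0" for t using unitary_on_scaleC[OF T_unitary L2_on_zero, of t 0] by simp
  then show "0 \<in> B" by (simp add: gen_def zero_prod_def)
  fix a b c d assume "(a, b) \<in> B" "(c, d) \<in> B"
  then show "(a, b) + (c, d) \<in> B" by (simp add: gen_add)
next
  fix r :: real and a b assume "(a, b) \<in> B"
  then show "r *\<^sub>R (a, b) \<in> B" by (simp add: scaleR_L2_eq gen_scaleC)
qed

text \<open>By the group law the difference quotient at time \<open>t\<close> is \<open>T t\<close>
  applied to the one at time 0, and \<open>T t\<close> is an isometry.\<close>

lemma gen_invariant:
  assumes "(f, g) \<in> B"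
  shows "(T t f, T t g) \<in> B"
    and "((\<lambda>t. T t f) has_vector_derivative (- \<i>) *\<^sub>C T t g) (at t)"
proof -
  note S = gen_S[OF assms]
  have q: "(T (t + h) f - T t f) /\<^sub>R h = T t ((T h f - f) /\<^sub>R h)" for h
    by (simp add: T_add S scaleR_L2_eq unitary_on_scaleC[OF T_unitary] unitary_on_diff[OF T_unitary] L2_on_diff unitary_on_in[OF T_unitary])
  have "((\<lambda>h. (T h f - f) /\<^sub>R h - (- \<i>) *\<^sub>C g) \<longlongrightarrow> 0) (at 0)"
    using gen_lim[OF assms] by (rule LIM_zero)
  then have "((\<lambda>h. norm ((T h f - f) /\<^sub>R h - (- \<i>) *\<^sub>C g)) \<longlongrightarrow> 0) (at 0)"
    by (rule tendsto_norm_zero)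
  also have "(\<lambda>h. norm ((T h f - f) /\<^sub>R h - (- \<i>) *\<^sub>C g)) = (\<lambda>h. norm ((T (t + h) f - T t f) /\<^sub>R h - (- \<i>) *\<^sub>C T t g))"
  proof
    fix h
    have mem: "(T h f - f) /\<^sub>R h \<in> S" "(- \<i>) *\<^sub>C g \<in> S"
      unfolding scaleR_L2_eq by (intro L2_on_scaleC L2_on_diff unitary_on_in[OF T_unitary] S)+
    have "(T (t + h) f - T t f) /\<^sub>R h - (- \<i>) *\<^sub>C T t g = T t ((T h f - f) /\<^sub>R h - (- \<i>) *\<^sub>C g)"
      unfolding q unitary_on_scaleC[OF T_unitary S(2), symmetric] unitary_on_diff[OF T_unitary mem] ..
    then show "norm ((T h f - f) /\<^sub>R h - (- \<i>) *\<^sub>C g) = norm ((T (t + h) f - T t f) /\<^sub>R h - (- \<i>) *\<^sub>C T t g)"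
      using unitary_on_norm[OF T_unitary L2_on_diff[OF mem]] by simp
  qed
  finally have lim: "((\<lambda>h. (T (t + h) f - T t f) /\<^sub>R h) \<longlongrightarrow> (- \<i>) *\<^sub>C T t g) (at 0)"
    by (intro LIM_zero_cancel[of "\<lambda>h. (T (t + h) f - T t f) /\<^sub>R h"] tendsto_norm_zero_cancel[of "\<lambda>h. (T (t + h) f - T t f) /\<^sub>R h - (- \<i>) *\<^sub>C T t g"])
  then show "((\<lambda>t. T t f) has_vector_derivative (- \<i>) *\<^sub>C T t g) (at t)"
    unfolding has_vector_derivative_iff_quotient .
  have "T (t + h) f = T h (T t f)" for h using T_add[OF S(1), of h t] by (simp add: add.commute)
  with lim show "(T t f, T t g) \<in> B" by (simp add: gen_def unitary_on_in[OF T_unitary S(1)])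
qed

lemma gen_symmetric:
  assumes fg: "(f, g) \<in> B" and uv: "(u, v) \<in> B"
  shows "cinner v f = cinner u g"
proof -
  note S = gen_S[OF fg] gen_S[OF uv]
  \<comment> \<open>A discrete product rule: the sum telescopes to the difference of
    \<open>cinner (T t u) (T t f)\<close> and \<open>cinner u f\<close>, divided by
    \<open>t\<close>, which is zero by unitarity.\<close>
  have eq: "cinner ((T t u - u) /\<^sub>R t) (T t f) + cinner u ((T t f - f) /\<^sub>R t) = 0" for t
    using unitary_on_cinner[OF T_unitary S(3,1), of t]
    by (simp add: scaleR_L2_eq cinner_scaleC_left cinner_scaleC_right cinner_diff_left cinner_diff_right flip: distrib_left)
  have "((\<lambda>t. cinner ((T t u - u) /\<^sub>R t) (T t f) + cinner u ((T t f - f) /\<^sub>R t))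
      \<longlongrightarrow> cinner ((- \<i>) *\<^sub>C v) f + cinner u ((- \<i>) *\<^sub>C g)) (at 0)"
    by (intro tendsto_add tendsto_cinner gen_lim fg uv T_tendsto_0 S tendsto_const)
  then have "((\<lambda>t::real. 0) \<longlongrightarrow> cinner ((- \<i>) *\<^sub>C v) f + cinner u ((- \<i>) *\<^sub>C g)) (at 0)"
    unfolding eq .
  from LIM_const_eq[OF this] have "cinner ((- \<i>) *\<^sub>C v) f + cinner u ((- \<i>) *\<^sub>C g) = 0" by simp
  then show ?thesis by (simp add: cinner_scaleC_left cinner_scaleC_right)
qed

text \<open>The mean value inequality for the orbit of \<open>f\<close>. The bound involves only
  \<open>g\<close>, so it is stable when pairs of the graph converge; this permits the exchange of
  limits in \<open>closed_gen\<close>.\<close>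

lemma gen_quotient_bound:
  assumes fg: "(f, g) \<in> B" and bd: "\<And>s. \<bar>s\<bar> \<le> \<bar>t\<bar> \<Longrightarrow> norm (T s g - g) \<le> b" and t: "t \<noteq> 0"
  shows "norm ((T t f - f) /\<^sub>R t - (- \<i>) *\<^sub>C g) \<le> b"
proof -
  note S = gen_S[OF fg]
  have "norm (T t f - T 0 f - (t - 0) *\<^sub>R ((- \<i>) *\<^sub>C T 0 g)) \<le> norm (t - 0) * b"
  proof (rule vector_differentiable_bound_linearization[where S="closed_segment 0 t"])
    fix s assume "s \<in> closed_segment 0 t"
    show "((\<lambda>t. T t f) has_vector_derivative (- \<i>) *\<^sub>C T s g) (at s within closed_segment 0 t)"
      by (rule has_vector_derivative_at_within[OF gen_invariant(2)[OF fg]])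
    have "\<bar>s\<bar> \<le> \<bar>t\<bar>" using \<open>s \<in> closed_segment 0 t\<close> by (auto simp: closed_segment_eq_real_ivl split: if_splits)
    moreover have "(- \<i>) *\<^sub>C T s g - (- \<i>) *\<^sub>C T 0 g = (- \<i>) *\<^sub>C (T s g - g)"
      by (simp only: scaleC_diff_right T_0[OF S(2)])
    then have "norm ((- \<i>) *\<^sub>C T s g - (- \<i>) *\<^sub>C T 0 g) = norm (T s g - g)"
      by (simp only: norm_scaleC) simp
    ultimately show "norm ((- \<i>) *\<^sub>C T s g - (- \<i>) *\<^sub>C T 0 g) \<le> b" using bd by simp
  qed auto
  then have "norm (T t f - f - t *\<^sub>R ((- \<i>) *\<^sub>C g)) \<le> \<bar>t\<bar> * b" by (simp add: T_0 S)
  moreover have "T t f - f - t *\<^sub>R ((- \<i>) *\<^sub>C g) = t *\<^sub>R ((T t f - f) /\<^sub>R t - (- \<i>) *\<^sub>C g)"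
    using t by (simp add: scaleR_diff_right del: scaleC_minus_left)
  then have "norm (T t f - f - t *\<^sub>R ((- \<i>) *\<^sub>C g)) = \<bar>t\<bar> * norm ((T t f - f) /\<^sub>R t - (- \<i>) *\<^sub>C g)"
    by (simp only: norm_scaleR)
  ultimately show ?thesis using t by simp
qed

lemma closed_gen: "closed B"
  unfolding closed_sequential_limits
proof (intro allI impI, elim conjE)
  fix X L assume X: "\<forall>n. X n \<in> B" and XL: "X \<longlonglongrightarrow> L"
  obtain f g where L: "L = (f, g)" by (cases L)
  define fn gn where "fn n = fst (X n)" and "gn n = snd (X n)" for n
  have Xn: "(fn n, gn n) \<in> B" for n using X by (simp add: fn_def gn_def)
  have lim: "fn \<longlonglongrightarrow> f" "gn \<longlonglongrightarrow> g"
    using tendsto_fst[OF XL] tendsto_snd[OF XL] by (simp_all add: fn_def[abs_def] gn_def[abs_def] L)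
  have S: "f \<in> S" "g \<in> S"
    using closed_sequentially[OF closed_L2_on[OF A] _ lim(1)] closed_sequentially[OF closed_L2_on[OF A] _ lim(2)]
      gen_S[OF Xn] by auto
  have "((\<lambda>t. (T t f - f) /\<^sub>R t) \<longlongrightarrow> (- \<i>) *\<^sub>C g) (at 0)"
  proof (rule LIM_I)
    fix e :: real assume e: "e > 0"
    obtain d where d: "d > 0" "\<And>s. s \<noteq> 0 \<Longrightarrow> \<bar>s\<bar> < d \<Longrightarrow> norm (T s g - g) < e / 2"
      using LIM_D[OF T_tendsto_0[OF S(2)], of "e/2"] e by auto
    have d': "norm (T s g - g) \<le> e / 2" if "\<bar>s\<bar> < d" for s
      using d(2)[of s] that T_0[OF S(2)] e by (cases "s = 0") auto
    have "norm ((T t f - f) /\<^sub>R t - (- \<i>) *\<^sub>C g) \<le> e / 2" if t: "t \<noteq> 0" "\<bar>t\<bar> < d" for t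
    proof -
      \<comment> \<open>Replacing \<open>gn n\<close> by \<open>g\<close> costs
        \<open>norm (gn n - g)\<close> twice, once under the isometry \<open>T s\<close> and once
        outside.\<close>
      have qb: "norm ((T t (fn n) - fn n) /\<^sub>R t - (- \<i>) *\<^sub>C gn n) \<le> e / 2 + 2 * norm (gn n - g)" for n
      proof (rule gen_quotient_bound[OF Xn _ t(1)])
        fix s assume s: "\<bar>s\<bar> \<le> \<bar>t\<bar>"
        have "T s (gn n) - gn n = T s (gn n - g) + (T s g - g) - (gn n - g)"
          by (simp add: unitary_on_diff[OF T_unitary gen_S(2)[OF Xn] S(2)])
        then have "norm (T s (gn n) - gn n) \<le> norm (T s (gn n - g)) + norm (T s g - g) + norm (gn n - g)"
          using norm_triangle_ineq4[of "T s (gn n - g) + (T s g - g)" "gn n - g"]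
            norm_triangle_ineq[of "T s (gn n - g)" "T s g - g"] by simp
        then show "norm (T s (gn n) - gn n) \<le> e / 2 + 2 * norm (gn n - g)"
          using unitary_on_norm[OF T_unitary L2_on_diff[OF gen_S(2)[OF Xn] S(2)]] d'[of s] s t by simp
      qed
      have l1: "(\<lambda>n. e / 2 + 2 * norm (gn n - g)) \<longlonglongrightarrow> e / 2 + 2 * norm (g - g)"
        by (intro tendsto_intros lim)
      have Tl: "(\<lambda>n. T t (fn n)) \<longlonglongrightarrow> T t f"
        by (rule unitary_on_tendsto[OF T_unitary gen_S(1)[OF Xn] S(1) lim(1)])
      have l2: "(\<lambda>n. norm ((T t (fn n) - fn n) /\<^sub>R t - (- \<i>) *\<^sub>C gn n)) \<longlonglongrightarrow> norm ((T t f - f) /\<^sub>R t - (- \<i>) *\<^sub>C g)"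
        by (intro tendsto_intros tendsto_scaleC_const lim Tl)
      have "norm ((T t f - f) /\<^sub>R t - (- \<i>) *\<^sub>C g) \<le> e / 2 + 2 * norm (g - g)"
        by (rule LIMSEQ_le[OF l2 l1]) (use qb in blast)
      then show ?thesis by simp
    qed
    then show "\<exists>d>0. \<forall>t. t \<noteq> 0 \<and> norm (t - 0) < d \<longrightarrow> norm ((T t f - f) /\<^sub>R t - (- \<i>) *\<^sub>C g) < e"
      using d(1) e by (intro exI[of _ d]) force
  qed
  then show "L \<in> B" using S by (simp add: L gen_def)
qed

text \<open>Symmetry makes \<open>cinner v u\<close> real, so the cross term with an imaginary
  multiple of \<open>u\<close> vanishes.\<close>

lemma gen_resolvent_norm:
  assumes "(u, v) \<in> B" "\<sigma> = 1 \<or> \<sigma> = (-1::real)"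
  shows "(norm (v + (\<i> * of_real \<sigma>) *\<^sub>C u))\<^sup>2 = (norm v)\<^sup>2 + (norm u)\<^sup>2"
proof -
  have "cinner v u = cnj (cinner v u)"
    using gen_symmetric[OF assms(1,1)] cinner_commute[of u v] by simp
  then have "Im (cinner v u) = 0" by (simp add: complex_eq_iff)
  then have "v \<bullet> ((\<i> * of_real \<sigma>) *\<^sub>C u) = 0"
    by (simp add: inner_L2_def cinner_scaleC_right)
  then have "(norm (v + (\<i> * of_real \<sigma>) *\<^sub>C u))\<^sup>2 = (norm v)\<^sup>2 + (norm ((\<i> * of_real \<sigma>) *\<^sub>C u))\<^sup>2"
    unfolding power2_norm_eq_inner by (simp add: inner_add_left inner_add_right inner_commute)
  then show ?thesis using assms(2) by (auto simp: norm_mult)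
qed

text \<open>By \<open>gen_resolvent_norm\<close> the map \<open>(u, v) \<mapsto> v \<plusminus> i u\<close> is isometric on the graph, so the
  range over a closed graph is closed.\<close>

lemma closure_range:
  assumes C: "C \<subseteq> B" "subspace C" and \<sigma>: "\<sigma> = 1 \<or> \<sigma> = (-1::real)"
    and G: "G \<in> closure ((\<lambda>(u, v). v + (\<i> * of_real \<sigma>) *\<^sub>C u) ` C)"
  shows "\<exists>(u, v)\<in>closure C. v + (\<i> * of_real \<sigma>) *\<^sub>C u = G"
proof -
  obtain X where X: "\<And>n. X n \<in> (\<lambda>(u, v). v + (\<i> * of_real \<sigma>) *\<^sub>C u) ` C" "X \<longlonglongrightarrow> G"
    using G unfolding closure_sequential by blast
  have "\<exists>u v. (u, v) \<in> C \<and> X n = v + (\<i> * of_real \<sigma>) *\<^sub>C u" for n using X(1)[of n] by auto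
  then obtain u v where uv: "\<And>n. (u n, v n) \<in> C" "\<And>n. X n = v n + (\<i> * of_real \<sigma>) *\<^sub>C u n" by metis
  have "Cauchy X" by (rule LIMSEQ_imp_Cauchy[OF X(2)])
  have le: "norm (u m - u n) \<le> norm (X m - X n) \<and> norm (v m - v n) \<le> norm (X m - X n)" for m n
  proof -
    have "(u m - u n, v m - v n) \<in> B"
      using subspace_diff[OF C(2) uv(1)[of m] uv(1)[of n]] C(1) by auto
    from gen_resolvent_norm[OF this \<sigma>]
    have "(norm (X m - X n))\<^sup>2 = (norm (v m - v n))\<^sup>2 + (norm (u m - u n))\<^sup>2"
      by (simp add: uv(2) scaleC_diff_right algebra_simps)
    then have "(norm (v m - v n))\<^sup>2 \<le> (norm (X m - X n))\<^sup>2" "(norm (u m - u n))\<^sup>2 \<le> (norm (X m - X n))\<^sup>2"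
      by simp_all
    then show ?thesis by (auto intro: power2_le_imp_le)
  qed
  have "Cauchy u" "Cauchy v"
    using \<open>Cauchy X\<close> le unfolding Cauchy_def dist_norm by (meson order_le_less_trans)+
  then obtain a b where ab: "u \<longlonglongrightarrow> a" "v \<longlonglongrightarrow> b"
    by (meson Cauchy_convergent_iff convergent_def)
  have "(\<lambda>n. (u n, v n)) \<longlonglongrightarrow> (a, b)" by (intro tendsto_Pair ab)
  then have "(a, b) \<in> closure C" unfolding closure_sequential using uv(1) by (intro exI[of _ "\<lambda>n. (u n, v n)"]) blast
  moreover have "X \<longlonglongrightarrow> b + (\<i> * of_real \<sigma>) *\<^sub>C a"
    unfolding uv(2)[abs_def] by (intro tendsto_add tendsto_scaleC_const ab)
  then have "b + (\<i> * of_real \<sigma>) *\<^sub>C a = G" using X(2) LIMSEQ_unique by blast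
  ultimately show ?thesis by blast
qed

text \<open>Over the closure of \<open>C\<close> the map (u, v) to v + i u already reaches all of
  \<open>S\<close>, and it is injective on \<open>B\<close> by \<open>gen_resolvent_norm\<close>;
  hence \<open>B\<close> has no further elements.\<close>

lemma gen_eq_closure:
  assumes C: "C \<subseteq> B" "subspace C"
    and dense: "S \<subseteq> closure ((\<lambda>(u, v). v + (\<i> * of_real 1) *\<^sub>C u) ` C)"
  shows "B = closure C"
proof
  show cl: "closure C \<subseteq> B" using closure_minimal[OF C(1) closed_gen] .
  show "B \<subseteq> closure C"
  proof
    fix p assume p: "p \<in> B"
    obtain f g where fg: "p = (f, g)" by (cases p)
    have "g + (\<i> * of_real 1) *\<^sub>C f \<in> S" using gen_S[of f g] p fg by (intro L2_on_add L2_on_scaleC) auto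
    then obtain u v where uv: "(u, v) \<in> closure C" "v + (\<i> * of_real 1) *\<^sub>C u = g + (\<i> * of_real 1) *\<^sub>C f"
      using closure_range[OF C, of 1 "g + (\<i> * of_real 1) *\<^sub>C f"] dense by blast
    have "(f - u, g - v) \<in> B" using p fg uv(1) cl by (auto intro: gen_diff)
    from gen_resolvent_norm[OF this, of 1] uv(2)
    have "(norm (g - v))\<^sup>2 + (norm (f - u))\<^sup>2 = 0" by (simp add: scaleC_diff_right algebra_simps)
    then show "p \<in> closure C" using fg uv(1) by (simp add: add_nonneg_eq_0_iff)
  qed
qed

text \<open>The basic criterion for self-adjointness: a symmetric operator for which both shifts by
  i and -i are onto has no proper symmetric extension, and its adjoint adds nothing.\<close>

lemma selfadjoint_gen:
  assumes C: "C \<subseteq> B" "subspace C"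
    and dense: "\<And>\<sigma>. \<sigma> = 1 \<or> \<sigma> = (-1::real) \<Longrightarrow> S \<subseteq> closure ((\<lambda>(u, v). v + (\<i> * of_real \<sigma>) *\<^sub>C u) ` C)"
    and dom: "S \<subseteq> closure (fst ` B)"
  shows "selfadjoint_on S B"
  unfolding selfadjoint_on_def
proof (intro conjI dom equalityI subsetI)
  fix p assume "p \<in> B"
  then show "p \<in> {(f, g). f \<in> S \<and> g \<in> S \<and> (\<forall>(u, v)\<in>B. cinner v f = cinner u g)}"
    using gen_S gen_symmetric by auto
next
  fix p assume "p \<in> {(f, g). f \<in> S \<and> g \<in> S \<and> (\<forall>(u, v)\<in>B. cinner v f = cinner u g)}"
  moreover obtain f g where p: "p = (f, g)" by (cases p)
  ultimately have fg: "f \<in> S" "g \<in> S" and adj': "\<forall>(u, v)\<in>B. cinner v f = cinner u g" by simp_all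
  have adj: "cinner v f = cinner u g" if "(u, v) \<in> B" for u v using bspec[OF adj' that] by simp
  have B: "B = closure C" by (rule gen_eq_closure[OF C dense]) simp
  have rng: "\<exists>u v. (u, v) \<in> B \<and> v + (\<i> * of_real \<sigma>) *\<^sub>C u = G" if "\<sigma> = 1 \<or> \<sigma> = -1" "G \<in> S" for \<sigma> G
    using closure_range[OF C that(1)] dense[OF that(1)] that(2) unfolding B by blast
  \<comment> \<open>Surjectivity for the sign -1 provides a pair of the graph with the same image as
    the pair (f, g) of the adjoint; the difference of the two satisfies the adjoint relation with
    eigenvalue i.\<close>
  have "g + (\<i> * of_real (-1)) *\<^sub>C f \<in> S" using fg by (intro L2_on_add L2_on_scaleC)
  then obtain u v where uv: "(u, v) \<in> B" "v + (\<i> * of_real (-1)) *\<^sub>C u = g + (\<i> * of_real (-1)) *\<^sub>C f"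
    using rng[of "-1"] by blast
  then have gv: "g - v = \<i> *\<^sub>C (f - u)" by (simp add: scaleC_diff_right algebra_simps)
  have fu: "f - u \<in> S" using fg gen_S[OF uv(1)] by (auto intro: L2_on_diff)
  then obtain a b where ab: "(a, b) \<in> B" "b + (\<i> * of_real 1) *\<^sub>C a = f - u"
    using rng[of 1] by blast
  \<comment> \<open>The remaining vector \<open>f - u\<close> is orthogonal to the range for the
    sign +1, hence to itself.\<close>
  have "cinner b (f - u) = cinner a (g - v)"
    using adj[OF ab(1)] gen_symmetric[OF uv(1) ab(1)] by (simp add: cinner_diff_right)
  also have "cinner a (g - v) = - \<i> * cinner a (f - u)"
    unfolding gv by (simp add: cinner_scaleC_right)
  finally have "cinner (b + (\<i> * of_real 1) *\<^sub>C a) (f - u) = 0"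
    by (simp add: cinner_add_left cinner_scaleC_left)
  then have "cinner (f - u) (f - u) = 0" by (simp only: ab(2))
  then have "f = u" by (simp add: cinner_self)
  moreover from this gv have "g = v" by simp
  ultimately show "p \<in> B" using uv(1) p by simp
qed

end

lemma unitary_group_unique:
  assumes A: "A \<in> sets lebesgue" and T: "unitary_group_on (L2_on A) T" and W: "unitary_group_on (L2_on A) W"
    and eq: "gen (L2_on A) T = gen (L2_on A) W" and dom: "L2_on A \<subseteq> closure (fst ` gen (L2_on A) T)"
    and f: "f \<in> L2_on A"
  shows "T t f = W t f"
proof -
  interpret T: unitary_group A T using A T by unfold_locales
  interpret W: unitary_group A W using A W by unfold_locales
  have base: "T t f = W t f" if fg: "(f, g) \<in> gen (L2_on A) T" for f g t
  proof -
    have fg': "(f, g) \<in> gen (L2_on A) W" using fg eq by simp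
    let ?u = "\<lambda>t. T t f - W t f" and ?v = "\<lambda>t. T t g - W t g"
    have d: "(?u has_vector_derivative (- \<i>) *\<^sub>C ?v t) (at t)" for t
      unfolding scaleC_diff_right
      by (rule has_vector_derivative_diff[OF T.gen_invariant(2)[OF fg] W.gen_invariant(2)[OF fg']])
    have uv: "(?u t, ?v t) \<in> gen (L2_on A) T" for t
      using T.gen_diff[OF T.gen_invariant(1)[OF fg]] W.gen_invariant(1)[OF fg'] eq by simp
    \<comment> \<open>The derivative is twice the real part of -i times
      \<open>cinner (?v t) (?u t)\<close>. The difference of the two orbits stays in the common
      generator, so by symmetry this inner product is real.\<close>
    have "((\<lambda>t. ?u t \<bullet> ?u t) has_real_derivative 0) (at t)" for t
    proof -
      have "((\<lambda>t. ?u t \<bullet> ?u t) has_vector_derivative ?u t \<bullet> ((- \<i>) *\<^sub>C ?v t) + ((- \<i>) *\<^sub>C ?v t) \<bullet> ?u t) (at t)"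
        by (rule bounded_bilinear.has_vector_derivative[OF bounded_bilinear_inner d d])
      moreover have "cinner (?v t) (?u t) = cnj (cinner (?v t) (?u t))"
        using T.gen_symmetric[OF uv uv] cinner_commute[of "?u t" "?v t"] by simp
      then have "Im (cinner (?v t) (?u t)) = 0" by (simp add: complex_eq_iff)
      then have z: "((- \<i>) *\<^sub>C ?v t) \<bullet> ?u t = 0"
        by (simp only: inner_L2_def cinner_scaleC_left) simp
      moreover have "?u t \<bullet> ((- \<i>) *\<^sub>C ?v t) = 0" using z by (simp only: inner_commute)
      ultimately show ?thesis
        by (simp only: has_real_derivative_iff_has_vector_derivative add_0)
    qed
    then have "?u t \<bullet> ?u t = ?u 0 \<bullet> ?u 0" using DERIV_isconst_all[of "\<lambda>t. ?u t \<bullet> ?u t"] by blast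
    also have "?u 0 = 0" using T.T_0 W.T_0 T.gen_S[OF fg] by simp
    finally show ?thesis by simp
  qed
  obtain X where X: "\<And>n. X n \<in> fst ` gen (L2_on A) T" "X \<longlonglongrightarrow> f"
    using dom f unfolding closure_sequential by (metis closure_sequential subsetD)
  have XS: "X n \<in> L2_on A" for n using X(1)[of n] T.gen_S by auto
  have "T t (X n) = W t (X n)" for n using X(1)[of n] base by auto
  then show ?thesis
    using LIMSEQ_unique[OF unitary_on_tendsto[OF T.T_unitary XS f X(2), of t]]
      unitary_on_tendsto[OF W.T_unitary XS f X(2), of t] by simp
qed

section \<open>Tensor products and the generator of the translation group\<close>

text \<open>Boundedness is required on (0,1) only, since \<open>tensor01\<close> cuts off outside;
  this admits the exponentials.\<close>

definition slab_fun :: "(real \<Rightarrow> complex) \<Rightarrow> bool" where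
  "slab_fun a \<longleftrightarrow> a \<in> borel_measurable lebesgue \<and> (\<exists>B. \<forall>x\<in>{0<..<1}. cmod (a x) \<le> B)"

lemma slab_fun_continuous:
  assumes "continuous_on UNIV a"
  shows "slab_fun a"
proof -
  have "a \<in> borel_measurable borel" using assms by (rule borel_measurable_continuous_onI)
  then have m: "a \<in> borel_measurable lebesgue" by (intro measurable_completion) simp
  have "compact (a ` {0..1})"
    by (intro compact_continuous_image continuous_on_subset[OF assms]) auto
  then obtain B where "\<forall>z\<in>a ` {0..1}. cmod z \<le> B" using compact_imp_bounded bounded_iff by blast
  with m show ?thesis unfolding slab_fun_def by (auto intro!: exI[of _ B])
qed

lemma slab_fun_smooth: "smooth a \<Longrightarrow> slab_fun a"
  by (intro slab_fun_continuous smooth_continuous)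

lemma square_int_slab_fun:
  assumes "slab_fun a"
  shows "square_int (\<lambda>x. indicator {0<..<1} x * a x)"
proof -
  obtain B where B: "\<forall>x\<in>{0<..<1}. cmod (a x) \<le> B" and m: "a \<in> borel_measurable lebesgue"
    using assms unfolding slab_fun_def by blast
  have "B \<ge> 0" using order_trans[OF norm_ge_zero B[rule_format, of "1/2"]] by simp
  show ?thesis
  proof (rule square_int_bound)
    show "square_int (\<lambda>x::real. of_real B * indicator {0<..<1} x)"
      by (rule square_int_indicator) auto
    show "(\<lambda>x. indicator {0<..<1} x * a x) \<in> borel_measurable lebesgue"
      by (intro borel_measurable_times borel_measurable_indicator m) simp
  qed (use B \<open>B \<ge> 0\<close> in \<open>auto simp: indicator_def\<close>)
qed

lemma tensor01_eq:
  "tensor01 a h = L2_of (\<lambda>(x, y). (indicator {0<..<1} x * a x) * fun_of_L2 h y)"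
  unfolding tensor01_def by (rule arg_cong[of _ _ L2_of]) (auto simp: indicator_def)

lemma slice_tensor01:
  assumes "slab_fun a"
  shows "AE x in lebesgue. slice (tensor01 a h) x = (if x \<in> {0<..<1} then a x *\<^sub>C h else 0)"
  using slice_tensor[OF square_int_slab_fun[OF assms], of h] unfolding tensor01_eq[symmetric]
  by eventually_elim (auto simp: indicator_def)

lemma slab_fun_add: "slab_fun a \<Longrightarrow> slab_fun b \<Longrightarrow> slab_fun (\<lambda>x. a x + b x)"
  unfolding slab_fun_def
proof safe
  fix B C assume "\<forall>x\<in>{0<..<1}. cmod (a x) \<le> B" "\<forall>x\<in>{0<..<1}. cmod (b x) \<le> C"
  then show "\<exists>B. \<forall>x\<in>{0<..<1}. cmod (a x + b x) \<le> B"
    by (intro exI[of _ "B + C"]) (auto intro: norm_triangle_mono)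
qed auto

lemma slab_fun_mult: "slab_fun a \<Longrightarrow> slab_fun b \<Longrightarrow> slab_fun (\<lambda>x. a x * b x)"
  unfolding slab_fun_def
proof safe
  fix B C assume *: "\<forall>x\<in>{0<..<1}. cmod (a x) \<le> B" "\<forall>x\<in>{0<..<1}. cmod (b x) \<le> C"
  have "B \<ge> 0" using order_trans[OF norm_ge_zero *(1)[rule_format, of "1/2"]] by simp
  with * show "\<exists>B. \<forall>x\<in>{0<..<1}. cmod (a x * b x) \<le> B"
    by (intro exI[of _ "B * C"]) (auto simp: norm_mult intro: mult_mono)
qed auto

lemma slab_fun_const: "slab_fun (\<lambda>x. c)"
  by (rule slab_fun_continuous) simp

lemma slab_fun_cmult: "slab_fun a \<Longrightarrow> slab_fun (\<lambda>x. c * a x)"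
  by (rule slab_fun_mult[OF slab_fun_const])

lemma slab_fun_indicator: "slab_fun (indicator {c<..<d})"
  unfolding slab_fun_def by (auto intro!: borel_measurable_indicator exI[of _ 1] simp: indicator_def)

lemma tensor01_cong: "(\<And>x. x \<in> {0<..<1} \<Longrightarrow> a x = b x) \<Longrightarrow> tensor01 a h = tensor01 b h"
  unfolding tensor01_def by (rule arg_cong[of _ _ L2_of]) auto

lemma tensor01_add_fun:
  assumes "slab_fun a" "slab_fun b"
  shows "tensor01 (\<lambda>x. a x + b x) h = tensor01 a h + tensor01 b h"
  by (rule slice_eqI, use slice_tensor01[OF assms(1), of h] slice_tensor01[OF assms(2), of h]
      slice_tensor01[OF slab_fun_add[OF assms], of h] slice_add[of "tensor01 a h" "tensor01 b h"]
      in eventually_elim) (simp add: scaleC_add_left)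

lemma tensor01_cmult:
  assumes "slab_fun a"
  shows "tensor01 (\<lambda>x. c * a x) h = c *\<^sub>C tensor01 a h"
  by (rule slice_eqI, use slice_tensor01[OF assms, of h] slice_tensor01[OF slab_fun_cmult[OF assms], of c h]
      slice_scaleC[of c "tensor01 a h"] in eventually_elim) simp

lemma tensor01_scaleC:
  assumes "slab_fun a"
  shows "tensor01 a (c *\<^sub>C h) = c *\<^sub>C tensor01 a h"
  by (rule slice_eqI, use slice_tensor01[OF assms, of h] slice_tensor01[OF assms, of "c *\<^sub>C h"]
      slice_scaleC[of c "tensor01 a h"] in eventually_elim) (simp add: mult.commute)

lemma tensor01_add:
  assumes "slab_fun a"
  shows "tensor01 a (h + k) = tensor01 a h + tensor01 a k"
  by (rule slice_eqI, use slice_tensor01[OF assms, of h] slice_tensor01[OF assms, of k]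
      slice_tensor01[OF assms, of "h + k"] slice_add[of "tensor01 a h" "tensor01 a k"]
      in eventually_elim) (simp add: scaleC_add_right)

lemma tensor01_tendsto:
  assumes m: "\<And>n. a n \<in> borel_measurable lebesgue" and B: "\<And>n x. x \<in> {0<..<1} \<Longrightarrow> cmod (a n x) \<le> B"
    and lim: "\<And>x. x \<in> {0<..<1} \<Longrightarrow> (\<lambda>n. a n x) \<longlonglongrightarrow> b x" and mb: "b \<in> borel_measurable lebesgue"
  shows "(\<lambda>n. tensor01 (a n) h) \<longlonglongrightarrow> tensor01 b h"
  unfolding tensor01_eq
proof (rule L2_dominated(2))
  have "B \<ge> 0" using order_trans[OF norm_ge_zero B[of "1/2" 0]] by simp
  have s: "slab_fun (a n)" for n using m B unfolding slab_fun_def by blast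
  have bB: "cmod (b x) \<le> B" if "x \<in> {0<..<1}" for x
    by (rule LIMSEQ_le_const2[OF tendsto_norm[OF lim[OF that]]]) (use B that in auto)
  then have sb: "slab_fun b" using mb unfolding slab_fun_def by blast
  show "square_int (\<lambda>(x :: real, y). (indicator {0<..<1} x * complex_of_real B) * fun_of_L2 h y)"
    by (rule square_int_tensor[OF square_int_slab_fun[OF slab_fun_const] fun_of_L2_square_int])
  show "(\<lambda>(x, y). (indicator {0<..<1} x * a n x) * fun_of_L2 h y) \<in> borel_measurable lebesgue" for n
    by (rule square_int_measurable[OF square_int_tensor[OF square_int_slab_fun[OF s] fun_of_L2_square_int]])
  show "(\<lambda>(x, y). (indicator {0<..<1} x * b x) * fun_of_L2 h y) \<in> borel_measurable lebesgue"
    by (rule square_int_measurable[OF square_int_tensor[OF square_int_slab_fun[OF sb] fun_of_L2_square_int]])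
  show "AE p in lebesgue. (\<lambda>n. (case p of (x, y) \<Rightarrow> (indicator {0<..<1} x * a n x) * fun_of_L2 h y))
      \<longlonglongrightarrow> (case p of (x, y) \<Rightarrow> (indicator {0<..<1} x * b x) * fun_of_L2 h y)"
  proof (rule AE_I2)
    fix p :: "real \<times> 'a"
    obtain x y where p: "p = (x, y)" by (cases p)
    have "(\<lambda>n. indicator {0<..<1} x * a n x) \<longlonglongrightarrow> indicator {0<..<1} x * b x"
      by (cases "x \<in> {0<..<1}") (auto simp: lim)
    then show "(\<lambda>n. (case p of (x, y) \<Rightarrow> (indicator {0<..<1} x * a n x) * fun_of_L2 h y))
      \<longlonglongrightarrow> (case p of (x, y) \<Rightarrow> (indicator {0<..<1} x * b x) * fun_of_L2 h y)"
      unfolding p by (auto intro: tendsto_mult_right)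
  qed
  show "AE p in lebesgue. cmod (case p of (x, y) \<Rightarrow> (indicator {0<..<1} x * a n x) * fun_of_L2 h y)
      \<le> cmod (case p of (x, y) \<Rightarrow> (indicator {0<..<1} x * complex_of_real B) * fun_of_L2 h y)" for n
  proof (rule AE_I2)
    fix p :: "real \<times> 'a"
    obtain x y where p: "p = (x, y)" by (cases p)
    show "cmod (case p of (x, y) \<Rightarrow> (indicator {0<..<1} x * a n x) * fun_of_L2 h y)
      \<le> cmod (case p of (x, y) \<Rightarrow> (indicator {0<..<1} x * complex_of_real B) * fun_of_L2 h y)"
      using B[of x n] \<open>B \<ge> 0\<close> by (cases "x \<in> {0<..<1}") (auto simp: p norm_mult intro!: mult_right_mono)
  qed
qed

context bdry
begin

lemma tensor01_S:
  assumes "slab_fun a" "h \<in> K"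
  shows "tensor01 a h \<in> S"
  unfolding L2_on_slab_iff[OF \<Omega>]
  using slice_tensor01[OF assms(1), of h] by eventually_elim (use assms(2) in \<open>auto intro: L2_on_scaleC\<close>)

text \<open>\<open>L2_total\<close> is applied to the preimage of \<open>M\<close> under the
  projection onto the slab. That projection sends the indicator of a box to a tensor of an interval
  with a vector of \<open>K\<close>, which absorbs the coefficient.\<close>

lemma tensor01_total:
  assumes cl: "closed M" and sub: "subspace M"
    and ind: "\<And>c d h. 0 \<le> c \<Longrightarrow> c < d \<Longrightarrow> d \<le> 1 \<Longrightarrow> h \<in> K \<Longrightarrow> tensor01 (indicator {c<..<d}) h \<in> M"
  shows "S \<subseteq> M"
proof
  fix F assume F: "F \<in> S"
  let ?m = "mask ({0<..<1::real} \<times> \<Omega>)"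
  note bl = bounded_linear_mask[OF slab_sets[OF \<Omega>]]
  have "F \<in> ?m -` M"
  proof (rule L2_total)
    show "closed (?m -` M)" by (rule continuous_closed_vimage[OF cl]) (intro linear_continuous_at bl)
    show "subspace (?m -` M)"
      by (rule linear_subspace_vimage[OF bounded_linear.linear[OF bl] sub])
    fix c :: complex and A :: "(real \<times> 'a) set" assume "A \<in> rational_boxes"
    then obtain p q where "A = box p q" by (auto simp: rational_boxes_def)
    then obtain a b a' b' where A: "A = {a<..<b} \<times> box a' b'"
      by (metis box_prod box_real(1))
    have b': "box a' b' \<in> sets lebesgue" by simp
    define g where "g y = c * indicator (box a' b') y" for y
    have g: "square_int g" unfolding g_def by (rule square_int_indicator) auto
    define h where "h = mask \<Omega> (L2_of g)"
    have h: "h \<in> K" unfolding h_def by (rule mask_in_L2_on[OF \<Omega>])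
    have sA: "square_int (\<lambda>x. c * indicator A x)"
      unfolding \<open>A = box p q\<close> by (rule square_int_indicator) auto
    have "?m (L2_of (\<lambda>x. c * indicator A x)) = tensor01 (indicator {max a 0<..<min b 1}) h"
    proof (rule slice_eqI)
      show "AE x in lebesgue. slice (?m (L2_of (\<lambda>x. c * indicator A x))) x = slice (tensor01 (indicator {max a 0<..<min b 1}) h) x"
        using slice_mask[OF _ \<Omega>, of "{0<..<1}" "L2_of (\<lambda>x. c * indicator A x)", simplified]
          slice_L2_of[OF sA] slice_tensor01[OF slab_fun_indicator, of "max a 0" "min b 1" h]
      proof eventually_elim
        case (elim x)
        have "(\<lambda>y. c * indicator A (x, y)) = (\<lambda>y. indicator {a<..<b} x * g y)"
          by (auto simp: A g_def indicator_def)
        then have "L2_of (\<lambda>y. c * indicator A (x, y)) = indicator {a<..<b} x *\<^sub>C L2_of g"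
          by (simp only: L2_of_scaleC[OF g])
        with elim show ?case
          by (auto simp: h_def mask_scaleC[OF \<Omega>] indicator_def scaleR_L2_eq)
      qed
    qed
    also have "\<dots> \<in> M"
    \<comment> \<open>The box may miss the slab. The interval is then empty and the tensor zero, a
      case not covered by \<open>ind\<close>.\<close>
    proof (cases "max a 0 < min b 1")
      case True
      then show ?thesis by (intro ind h) auto
    next
      case False
      then have "tensor01 (indicator {max a 0<..<min b 1}) h = tensor01 (\<lambda>x. 0 * 0) h"
        by (intro tensor01_cong) (auto simp: indicator_def)
      also have "\<dots> = 0" by (subst tensor01_cmult[OF slab_fun_const]) simp
      finally show ?thesis using subspace_0[OF sub] by simp
    qed
    finally show "L2_of (\<lambda>x. c * indicator A x) \<in> ?m -` M" by simp
  qed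
  moreover have "?m F = F" using F mask_eq_iff[OF slab_sets[OF \<Omega>]] by blast
  ultimately show "F \<in> M" by simp
qed

section \<open>Differentiability of translation along a path\<close>

lemma restrict01_wrap:
  assumes "F \<in> S" "AE x in lebesgue. x \<in> {0<..<1} \<longrightarrow> slice F x = p x"
  shows "restrict01 \<Omega> (wrap p) = F"
  by (rule restrict01_eqI[OF \<Omega> assms(1)], use assms(2) in eventually_elim) (auto simp: wrap_eq)

lemma wrap_continuous_in_HV:
  assumes c: "continuous_on UNIV p" and K: "\<And>x. p x \<in> K"
  shows "wrap p \<in> HV"
proof (rule wrap_in_HV[OF _ K])
  have "p \<in> borel_measurable borel" using c by (rule borel_measurable_continuous_onI)
  then show "p \<in> borel_measurable lebesgue" by (intro measurable_completion) simp
  have "compact (p ` {0..1})" by (intro compact_continuous_image continuous_on_subset[OF c]) auto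
  then obtain B where B: "\<forall>z\<in>p ` {0..1}. norm z \<le> B" using compact_imp_bounded bounded_iff by blast
  have "(\<integral>\<^sup>+x. indicator {0..<1} x * ennreal ((norm (p x))\<^sup>2) \<partial>lebesgue)
      \<le> (\<integral>\<^sup>+x. ennreal (B\<^sup>2) * indicator {0..<1} x \<partial>(lebesgue :: real measure))"
    by (rule nn_integral_mono) (use B in \<open>auto simp: indicator_def intro!: ennreal_leI power_mono\<close>)
  also have "\<dots> < \<infinity>" by (simp add: nn_integral_cmult_indicator ennreal_mult_less_top)
  finally show "(\<integral>\<^sup>+x. indicator {0..<1} x * ennreal ((norm (p x))\<^sup>2) \<partial>lebesgue) < \<infinity>" .
qed

lemma wrap_step: "(\<And>x. p x \<in> K) \<Longrightarrow> wrap p (x + 1) = U (wrap p x)"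
  unfolding wrap_def by (simp add: Upow_Suc frac_def)

text \<open>The boundary condition makes \<open>wrap p\<close> Lipschitz across the integers, which supplies the
  bound for dominated convergence of the difference quotients.\<close>

lemma path_quotient_tendsto:
  assumes d: "\<And>x. (p has_vector_derivative p' x) (at x)" and cp': "continuous_on UNIV p'"
    and K: "\<And>x. p x \<in> K" "\<And>x. p' x \<in> K" and bc: "p 1 = U (p 0)"
  shows "((\<lambda>t. (transl t (restrict01 \<Omega> (wrap p)) - restrict01 \<Omega> (wrap p)) /\<^sub>R t)
     \<longlongrightarrow> - restrict01 \<Omega> (wrap p')) (at 0)"
proof -
  let ?f = "wrap p" and ?f' = "wrap p'"
  have cp: "continuous_on UNIV p"
    using has_vector_derivative_continuous[OF d] by (intro continuous_at_imp_continuous_on) blast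
  have f: "?f \<in> HV" and f': "?f' \<in> HV" 
    by (rule wrap_continuous_in_HV[OF cp K(1)], rule wrap_continuous_in_HV[OF cp' K(2)])
  have "compact (p' ` {0..1})" by (intro compact_continuous_image continuous_on_subset[OF cp']) auto
  then obtain L where "\<forall>z\<in>p' ` {0..1}. norm z \<le> L" using compact_imp_bounded bounded_iff by blast
  then have L: "norm (p' x) \<le> L" if "x \<in> {0..1}" for x using that by blast
  have L0: "L \<ge> 0" using order_trans[OF norm_ge_zero L[of 0]] by simp
  have lip: "norm (p x - p y) \<le> L * \<bar>x - y\<bar>" if "x \<in> {0..1}" "y \<in> {0..1}" for x y
  proof -
    have "norm (p x - p y) \<le> L * norm (x - y)"
    proof (rule differentiable_bound[where S="{0..1}" and f'="\<lambda>x h. h *\<^sub>R p' x"])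
      fix z :: real assume z: "z \<in> {0..1}"
      show "(p has_derivative (\<lambda>h. h *\<^sub>R p' z)) (at z within {0..1})"
        using has_vector_derivative_at_within[OF d, of z "{0..1}"] unfolding has_vector_derivative_def .
      show "onorm (\<lambda>h. h *\<^sub>R p' z) \<le> L"
      proof (rule onorm_bound[OF L0])
        show "norm (h *\<^sub>R p' z) \<le> L * norm h" for h
          using mult_right_mono[OF L[OF z] norm_ge_zero[of h]] by (simp add: mult.commute)
      qed
    qed (rule convex_real_interval that)+
    then show ?thesis by simp
  qed
  \<comment> \<open>At the right endpoint \<open>wrap\<close> takes the value
    \<open>U (p 0)\<close>; by the boundary condition this is \<open>p 1\<close>, so the formula
    extends to the closed interval.\<close>
  have f1: "?f x = p x" if "x \<in> {0..1}" for x
  proof (cases "x = 1")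
    case True
    then show ?thesis using wrap_step[of p 0, OF K(1)] wrap_eq[of 0 p] bc by simp
  qed (use that wrap_eq[of x p] in auto)
  \<comment> \<open>With \<open>t\<close> at most 1 in modulus the segment from \<open>x\<close> to
    \<open>x - t\<close> crosses at most one integer.\<close>
  have Lip: "norm (?f (x - t) - ?f x) \<le> L * \<bar>t\<bar>" if x: "x \<in> {0<..<1}" and t: "\<bar>t\<bar> \<le> 1" for x t
  proof -
    consider "x - t \<in> {0..1}" | "x - t < 0" | "x - t > 1" by fastforce
    then show ?thesis
    proof cases
      case 1
      then show ?thesis using lip[of "x - t" x] x by (simp add: f1)
    next
      case 2
      have y: "x - t + 1 \<in> {0..1}" using 2 t x by auto
      \<comment> \<open>Applying the isometry \<open>U\<close> brings \<open>x - t\<close> back into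
        the period. Inserting \<open>p 1 = U (p 0)\<close> splits the difference at the boundary,
        and the two lengths add up to the modulus of \<open>t\<close>.\<close>
      have "norm (?f (x - t) - ?f x) = norm (U (?f (x - t)) - U (?f x))"
        by (simp add: unitary_on_diff[OF U_unitary, symmetric] unitary_on_norm[OF U_unitary] HV_K[OF f] L2_on_diff)
      also have "U (?f (x - t)) - U (?f x) = (p (x - t + 1) - p 1) + U (p 0 - p x)"
        using wrap_step[of p "x - t", OF K(1)] f1[OF y] f1[of x] x
        by (simp add: bc unitary_on_diff[OF U_unitary K(1) K(1)])
      also have "norm \<dots> \<le> norm (p (x - t + 1) - p 1) + norm (p 0 - p x)"
        using norm_triangle_ineq[of "p (x - t + 1) - p 1" "U (p 0 - p x)"]
        by (simp add: unitary_on_norm[OF U_unitary] L2_on_diff K)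
      also have "\<dots> \<le> L * \<bar>x - t + 1 - 1\<bar> + L * \<bar>0 - x\<bar>"
        using x y by (intro add_mono lip) auto
      also have "\<dots> = L * \<bar>t\<bar>" using 2 x by (simp add: algebra_simps)
      finally show ?thesis .
    next
      case 3
      have y: "x - t - 1 \<in> {0..1}" using 3 t x by auto
      have "?f (x - t) = U (p (x - t - 1))"
        using wrap_step[of p "x - t - 1", OF K(1)] f1[OF y] by simp
      then have "?f (x - t) - ?f x = U (p (x - t - 1) - p 0) + (p 1 - p x)"
        using f1[of x] x by (simp add: bc unitary_on_diff[OF U_unitary K(1) K(1)])
      also have "norm \<dots> \<le> norm (p (x - t - 1) - p 0) + norm (p 1 - p x)"
        using norm_triangle_ineq[of "U (p (x - t - 1) - p 0)" "p 1 - p x"]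
        by (simp add: unitary_on_norm[OF U_unitary] L2_on_diff K)
      also have "\<dots> \<le> L * \<bar>x - t - 1 - 0\<bar> + L * \<bar>1 - x\<bar>"
        using x y by (intro add_mono lip) auto
      also have "\<dots> = L * \<bar>t\<bar>" using 3 x by (simp add: algebra_simps)
      finally show ?thesis .
    qed
  qed
  \<comment> \<open>One \<open>L\<close> bounds the difference quotient, the other the
    derivative.\<close>
  define M where "M = 2 * L"
  \<comment> \<open>The error of the difference quotient, written with sums and complex multiples so
    that the closure properties of \<open>HV\<close> apply.\<close>
  define h where "h t x = complex_of_real (1 / t) *\<^sub>C (?f (x - t) + (- 1) *\<^sub>C ?f x) + ?f' x" for t x
  have hHV: "h t \<in> HV" for t
    unfolding h_def[abs_def] by (intro HV_add HV_scaleC HV_shift(1) f f')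
  have Rh: "restrict01 \<Omega> (h t) = (transl t (restrict01 \<Omega> ?f) - restrict01 \<Omega> ?f) /\<^sub>R t + restrict01 \<Omega> ?f'" for t
  proof -
    note q = HV_add[OF HV_shift(1)[OF f, of t] HV_scaleC[OF f, of "- 1"]]
    have "restrict01 \<Omega> (\<lambda>x. ?f (x - t) + (- 1) *\<^sub>C ?f x) = transl t (restrict01 \<Omega> ?f) - restrict01 \<Omega> ?f"
      unfolding restrict01_add[OF HV_shift(1)[OF f] HV_scaleC[OF f]] restrict01_scaleC[OF f] transl_restrict01[OF f]
      by (simp add: scaleC_minus_one)
    then show ?thesis
      unfolding h_def[abs_def] restrict01_add[OF HV_scaleC[OF q] f'] restrict01_scaleC[OF q]
      by (simp only: scaleR_L2_eq inverse_eq_divide)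
  qed
  have h_eq: "h t x = (?f (x - t) - ?f x) /\<^sub>R t + ?f' x" for t x
    by (simp add: h_def scaleR_L2_eq scaleC_minus_one divide_inverse del: scaleC_minus_left)
  have "((\<lambda>t. restrict01 \<Omega> (h t)) \<longlongrightarrow> 0) (at 0)"
    unfolding tendsto_at_iff_sequentially
  proof (intro allI impI)
    fix X :: "nat \<Rightarrow> real" assume X0: "\<forall>i. X i \<in> UNIV - {0}" and Xl: "X \<longlonglongrightarrow> 0"
    have "\<forall>\<^sub>F n in sequentially. \<bar>X n\<bar> < 1"
      using order_tendstoD(2)[OF tendsto_rabs[OF Xl], of 1] by simp
    then obtain N where N: "\<And>n. n \<ge> N \<Longrightarrow> \<bar>X n\<bar> < 1" unfolding eventually_sequentially by blast
    \<comment> \<open>Dropping the first \<open>N\<close> terms puts the whole sequence into the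
      range where \<open>Lip\<close> holds; dominated convergence is available for
      sequences.\<close>
    define Y where "Y n = X (n + N)" for n
    have Y1: "\<bar>Y n\<bar> \<le> 1" "Y n \<noteq> 0" for n using N[of "n + N"] X0 by (auto simp: Y_def)
    have Yl: "Y \<longlonglongrightarrow> 0" unfolding Y_def[abs_def] by (rule LIMSEQ_ignore_initial_segment[OF Xl])
    have m: "h t \<in> borel_measurable lebesgue" for t by (rule HV_measurable[OF hHV])
    have f1': "norm (?f' x) \<le> L" if "x \<in> {0<..<1}" for x
      using L[of x] that wrap_eq[of x p'] by simp
    have "(\<lambda>n. \<integral>\<^sup>+x. indicator {0..<1} x * ennreal ((norm (h (Y n) x))\<^sup>2) \<partial>lebesgue)
        \<longlonglongrightarrow> (\<integral>\<^sup>+x. 0 \<partial>(lebesgue :: real measure))"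
    proof (rule nn_integral_dominated_convergence[where w="\<lambda>x. ennreal (M\<^sup>2) * indicator {0..<1} x"])
      have I: "{0..<1::real} \<in> sets lebesgue" by simp
      show "(\<lambda>x. indicator {0..<1} x * ennreal ((norm (h (Y n) x))\<^sup>2)) \<in> borel_measurable lebesgue" for n
        using m[of "Y n"] I by measurable
      show "(\<lambda>x::real. ennreal (M\<^sup>2) * indicator {0..<1} x) \<in> borel_measurable lebesgue"
        using I by measurable
      show "(\<integral>\<^sup>+x. ennreal (M\<^sup>2) * indicator {0..<1} x \<partial>(lebesgue :: real measure)) < \<infinity>"
        by (simp add: nn_integral_cmult_indicator ennreal_mult_less_top)
      have ae0: "AE x in lebesgue. x \<noteq> (0::real)"
        by (rule AE_not_in[of "{0::real}", simplified]) simp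
      show "AE x in lebesgue. indicator {0..<1} x * ennreal ((norm (h (Y n) x))\<^sup>2)
          \<le> ennreal (M\<^sup>2) * indicator {0..<1} x" for n
        using ae0
      proof eventually_elim
        case (elim x)
        have "norm (h (Y n) x) \<le> M" if x: "x \<in> {0<..<1}"
        proof -
          have "norm (h (Y n) x) \<le> norm (?f (x - Y n) - ?f x) / \<bar>Y n\<bar> + norm (?f' x)"
            unfolding h_eq using norm_triangle_ineq[of "(?f (x - Y n) - ?f x) /\<^sub>R Y n" "?f' x"]
            by (simp add: divide_inverse mult.commute)
          also have "norm (?f (x - Y n) - ?f x) / \<bar>Y n\<bar> \<le> L"
            using Lip[OF x Y1(1)[of n]] Y1(2)[of n] by (simp add: divide_le_eq)
          finally show ?thesis using f1'[OF x] by (simp add: M_def)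
        qed
        with elim show ?case by (auto simp: indicator_def intro!: ennreal_leI power_mono)
      qed
      show "AE x in lebesgue. (\<lambda>n. indicator {0..<1} x * ennreal ((norm (h (Y n) x))\<^sup>2)) \<longlonglongrightarrow> 0"
        using ae0
      proof eventually_elim
        case (elim x)
        show ?case
        proof (cases "x \<in> {0<..<1}")
          case False
          with elim show ?thesis by (auto simp: indicator_def)
        next
          case True
          have q: "((\<lambda>h. (p (x + h) - p x) /\<^sub>R h) \<longlongrightarrow> p' x) (at 0)"
            using d[of x] unfolding has_vector_derivative_iff_quotient .
          have Yf: "filterlim (\<lambda>n. - Y n) (at 0) sequentially"
            unfolding filterlim_at using tendsto_minus[OF Yl] Y1(2) by auto
          from filterlim_compose[OF q Yf]
          have "(\<lambda>n. - ((p (x + - Y n) - p x) /\<^sub>R (- Y n)) + p' x) \<longlonglongrightarrow> - p' x + p' x"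
            by (intro tendsto_intros)
          then have l: "(\<lambda>n. (p (x - Y n) - p x) /\<^sub>R Y n + p' x) \<longlonglongrightarrow> 0" by simp
          have "\<forall>\<^sub>F n in sequentially. \<bar>Y n\<bar> < min x (1 - x)"
            using order_tendstoD(2)[OF tendsto_rabs[OF Yl], of "min x (1 - x)"] True by auto
          then have "\<forall>\<^sub>F n in sequentially. (p (x - Y n) - p x) /\<^sub>R Y n + p' x = h (Y n) x"
          proof eventually_elim
            case (elim n)
            then have "x - Y n \<in> {0..1}" by auto
            then show ?case using True wrap_eq[of x p'] by (simp add: h_eq f1)
          qed
          from Lim_transform_eventually[OF l this]
          have "(\<lambda>n. ennreal ((norm (h (Y n) x))\<^sup>2)) \<longlonglongrightarrow> ennreal ((norm (0 :: 'a L2))\<^sup>2)"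
            by (intro tendsto_ennrealI tendsto_intros)
          with True show ?thesis by simp
        qed
      qed
    qed auto
    then have "(\<lambda>n. ennreal ((norm (restrict01 \<Omega> (h (Y n))))\<^sup>2)) \<longlonglongrightarrow> ennreal 0"
      by (simp add: HV_nn[OF hHV] restrict01_norm[OF hHV])
    then have "(\<lambda>n. (norm (restrict01 \<Omega> (h (Y n))))\<^sup>2) \<longlonglongrightarrow> 0"
      by (subst (asm) tendsto_ennreal_iff) auto
    then have "(\<lambda>n. sqrt ((norm (restrict01 \<Omega> (h (Y n))))\<^sup>2)) \<longlonglongrightarrow> sqrt 0"
      by (rule tendsto_real_sqrt)
    then have "(\<lambda>n. restrict01 \<Omega> (h (Y n))) \<longlonglongrightarrow> 0"
      by (intro tendsto_norm_zero_cancel[of "\<lambda>n. restrict01 \<Omega> (h (Y n))"]) simp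
    then have "(\<lambda>n. ((\<lambda>t. restrict01 \<Omega> (h t)) \<circ> X) (n + N)) \<longlonglongrightarrow> 0" by (simp add: Y_def)
    then show "((\<lambda>t. restrict01 \<Omega> (h t)) \<circ> X) \<longlonglongrightarrow> 0" by (rule LIMSEQ_offset)
  qed
  then have "((\<lambda>t. restrict01 \<Omega> (h t) - restrict01 \<Omega> ?f') \<longlongrightarrow> 0 - restrict01 \<Omega> ?f') (at 0)"
    by (intro tendsto_intros)
  then show ?thesis by (simp add: Rh)
qed

end

section \<open>Integration in the opposite order\<close>

lemma AE_lebesgue_prod_swap:
  assumes "AE p in lebesgue. P (p :: 'a::euclidean_space \<times> 'b::euclidean_space)"
  shows "AE y in lebesgue. AE x in lebesgue. P (x, y)"
proof -
  have "AE p in (lborel :: ('a \<times> 'b) measure). P p" using assms by (simp add: AE_completion_iff)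
  \<comment> \<open>The exceptional set itself may fail to be Borel. A Borel null set containing it
    is measurable for the product, so the order of the quantifiers can be exchanged.\<close>
  then obtain N where N: "N \<in> null_sets (lborel :: ('a \<times> 'b) measure)" "{p. \<not> P p} \<subseteq> N"
    unfolding eventually_ae_filter by auto
  have Ns: "N \<in> sets (lborel \<Otimes>\<^sub>M lborel)" using null_setsD2[OF N(1)] by (simp only: lborel_prod)
  have "AE p in lborel \<Otimes>\<^sub>M lborel. p \<notin> N"
    using AE_not_in[OF N(1)] by (subst lborel_prod)
  from lborel_pair.AE_pair[OF this] have "AE x in lborel. AE y in lborel. (x, y) \<notin> N" .
  moreover have "Measurable.pred (lborel \<Otimes>\<^sub>M lborel) (\<lambda>p. p \<notin> N)"
    using Ns by measurable
  ultimately have "AE y in lborel. AE x in lborel. (x, y) \<notin> N"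
    by (subst lborel_pair.AE_commute[symmetric]) (simp_all add: pred_def)
  then have "AE y in lborel. AE x in lborel. P (x, y)"
    using N(2) by (auto elim!: eventually_mono)
  then show ?thesis by (simp add: AE_completion_iff)
qed

text \<open>Fubini with the x-integral inside, carried out for a Borel representative. Measurability
  of the sections of \<open>G\<close> lets their integrals be compared with those of the
  representative.\<close>

lemma integral_lebesgue_prod_eq_0:
  fixes G :: "'a::euclidean_space \<times> 'b::euclidean_space \<Rightarrow> complex"
  assumes i: "integrable lebesgue G" and z: "\<And>y. (\<integral>x. G (x, y) \<partial>lebesgue) = 0"
    and m: "\<And>y. (\<lambda>x. G (x, y)) \<in> borel_measurable lebesgue"
  shows "(\<integral>p. G p \<partial>lebesgue) = 0"
proof -
  obtain g where g: "g \<in> borel_measurable borel" and ae: "AE p in lebesgue. G p = g p"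
    using lebesgue_ex_borel[OF borel_measurable_integrable[OF i]] by blast
  have gl: "g \<in> borel_measurable lborel" using g by simp
  have gL: "g \<in> borel_measurable lebesgue" by (rule measurable_completion[OF gl])
  have "integrable lebesgue g" by (rule integrable_cong_AE_imp[OF i gL]) (use ae in eventually_elim, simp)
  then have ig: "integrable (lborel \<Otimes>\<^sub>M lborel) g"
    using integrable_completion[OF gl] by (simp only: lborel_prod)
  have "(\<integral>p. G p \<partial>lebesgue) = (\<integral>p. g p \<partial>lebesgue)"
    by (rule integral_cong_AE[OF borel_measurable_integrable[OF i] gL ae])
  also have "\<dots> = (\<integral>p. g p \<partial>(lborel \<Otimes>\<^sub>M lborel))"
    by (simp only: integral_completion[OF gl] lborel_prod)
  also have "\<dots> = (\<integral>y. \<integral>x. g (x, y) \<partial>lborel \<partial>lborel)"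
    using lborel_pair.integral_snd[of "\<lambda>x y. g (x, y)"] ig by simp
  also have "\<dots> = (\<integral>y. 0 \<partial>(lborel :: 'b measure))"
  proof (rule integral_cong_AE)
    have g': "g \<in> borel_measurable (lborel \<Otimes>\<^sub>M lborel)" using gl by (simp only: lborel_prod)
    then have "(\<lambda>(y, x). g (x, y)) \<in> borel_measurable (lborel \<Otimes>\<^sub>M lborel)"
      using measurable_pair_swap[OF g'] by (simp add: case_prod_unfold)
    then show "(\<lambda>y. \<integral>x. g (x, y) \<partial>lborel) \<in> borel_measurable lborel"
      by (rule lborel.borel_measurable_lebesgue_integral)
    have "AE y in lborel. AE x in lebesgue. G (x, y) = g (x, y)"
      using AE_lebesgue_prod_swap[OF ae] by (simp only: AE_completion_iff)
    then show "AE y in lborel. (\<integral>x. g (x, y) \<partial>lborel) = 0"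
    proof eventually_elim
      case (elim y)
      have gy: "(\<lambda>x. g (x, y)) \<in> borel_measurable lborel"
      proof -
        have "(\<lambda>x. (x, y)) \<in> borel_measurable (borel :: 'a measure)"
          by (intro borel_measurable_continuous_onI continuous_intros)
        from measurable_compose[OF this g] show ?thesis by simp
      qed
      have "(\<integral>x. g (x, y) \<partial>lborel) = (\<integral>x. g (x, y) \<partial>lebesgue)"
        by (rule integral_completion[OF gy, symmetric])
      also have "\<dots> = (\<integral>x. G (x, y) \<partial>lebesgue)"
        by (rule integral_cong_AE[OF measurable_completion[OF gy] m]) (use elim in eventually_elim, simp)
      finally show ?case by (simp add: z)
    qed
  qed simp
  finally show ?thesis by simp
qed

lemma subspace_closure_normed:
  fixes M :: "'b::real_normed_vector set"
  assumes "subspace M"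
  shows "subspace (closure M)"
  unfolding subspace_def
proof safe
  show "0 \<in> closure M" using subspace_0[OF assms] closure_subset by blast
  fix u v assume "u \<in> closure M" "v \<in> closure M"
  then obtain a b where "\<forall>n. a n \<in> M" "a \<longlonglongrightarrow> u" "\<forall>n. b n \<in> M" "b \<longlonglongrightarrow> v"
    unfolding closure_sequential by blast
  then show "u + v \<in> closure M"
    unfolding closure_sequential by (intro exI[of _ "\<lambda>n. a n + b n"]) (auto intro: subspace_add[OF assms] tendsto_add)
next
  fix r :: real and u assume "u \<in> closure M"
  then obtain a where "\<forall>n. a n \<in> M" "a \<longlonglongrightarrow> u" unfolding closure_sequential by blast
  then show "r *\<^sub>R u \<in> closure M"
    unfolding closure_sequential by (intro exI[of _ "\<lambda>n. r *\<^sub>R a n"]) (auto intro: subspace_scale[OF assms] tendsto_scaleR)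
qed

context bdry
begin

lemma V_0 [simp]: "V 0 = 0" and U_0 [simp]: "U 0 = 0"
  using unitary_on_scaleC[OF V L2_on_zero, of 0] unitary_on_scaleC[OF U_unitary L2_on_zero, of 0] by simp_all

lemma restrict01_wrap_tensor:
  assumes a: "slab_fun a" and h: "h \<in> K"
  shows "restrict01 \<Omega> (wrap (\<lambda>x. a x *\<^sub>C h)) = tensor01 a h"
  by (rule restrict01_wrap[OF tensor01_S[OF a h]], use slice_tensor01[OF a, of h] in eventually_elim) simp

lemma test_fun01_endpoints: "test_fun01 b \<Longrightarrow> b 0 = 0 \<and> b 1 = 0"
  unfolding test_fun01_iff by auto

lemma has_vector_derivative_scaleC:
  assumes "(b has_vector_derivative b') (at x)"
  shows "((\<lambda>x. b x *\<^sub>C h) has_vector_derivative b' *\<^sub>C h) (at x)"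
  by (rule bounded_linear.has_vector_derivative[OF bounded_linear_scaleC_left assms])

lemma continuous_on_scaleC_fun:
  assumes "continuous_on A b"
  shows "continuous_on A (\<lambda>x. b x *\<^sub>C h)"
  by (rule bounded_linear.continuous_on[OF bounded_linear_scaleC_left assms])

lemma test_quotient_tendsto:
  assumes b: "test_fun01 b" and d: "\<And>t. (b has_vector_derivative b' t) (at t)" and h: "h \<in> K"
  shows "((\<lambda>t. (transl t (tensor01 b h) - tensor01 b h) /\<^sub>R t) \<longlongrightarrow> - tensor01 b' h) (at 0)"
proof -
  have b': "test_fun01 b'" by (rule test_fun01_deriv[OF b d])
  have sm: "smooth b" "smooth b'" using b b' by (auto simp: test_fun01_iff)
  have "((\<lambda>t. (transl t (restrict01 \<Omega> (wrap (\<lambda>x. b x *\<^sub>C h))) - restrict01 \<Omega> (wrap (\<lambda>x. b x *\<^sub>C h))) /\<^sub>R t)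
     \<longlongrightarrow> - restrict01 \<Omega> (wrap (\<lambda>x. b' x *\<^sub>C h))) (at 0)"
    by (rule path_quotient_tendsto)
       (use test_fun01_endpoints[OF b] h in \<open>simp_all add: has_vector_derivative_scaleC d continuous_on_scaleC_fun
          smooth_continuous sm L2_on_scaleC\<close>)
  then show ?thesis by (simp only: restrict01_wrap_tensor[OF slab_fun_smooth[OF sm(1)] h] restrict01_wrap_tensor[OF slab_fun_smooth[OF sm(2)] h])
qed

text \<open>Serves both strong continuity of the group and density of the domain of its
  generator.\<close>

lemma closed_subspace_test_total:
  assumes cl: "closed M" and sub: "subspace M"
    and t: "\<And>b h. test_fun01 b \<Longrightarrow> h \<in> K \<Longrightarrow> tensor01 b h \<in> M"
  shows "S \<subseteq> M"
proof (rule tensor01_total[OF cl sub])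
  fix c d :: real and h assume cd: "0 \<le> c" "c < d" "d \<le> 1" and h: "h \<in> K"
  let ?b = "\<lambda>n x. complex_of_real (bump (1 / Suc n) (c + 1 / Suc n) (d - 1 / Suc n) x)"
  have tb: "test_fun01 (?b n)" for n by (rule test_fun01_bump_seq[OF cd(1,3)])
  have "(\<lambda>n. tensor01 (?b n) h) \<longlonglongrightarrow> tensor01 (indicator {c<..<d}) h"
  proof (rule tensor01_tendsto[where B=1])
    show "?b n \<in> borel_measurable lebesgue" for n
      using slab_fun_smooth[of "?b n"] tb[of n] unfolding slab_fun_def test_fun01_iff by blast
    show "cmod (?b n x) \<le> 1" for n x using bump_bounds[of "1 / Suc n"] by simp
    show "(\<lambda>n. ?b n x) \<longlonglongrightarrow> indicator {c<..<d} x" for x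
      using tendsto_of_real[OF bump_tendsto[OF cd(2), of x], where 'a=complex] by (simp add: of_real_indicator)
    show "(indicator {c<..<d} :: real \<Rightarrow> complex) \<in> borel_measurable lebesgue"
      using slab_fun_indicator unfolding slab_fun_def by blast
  qed
  then show "tensor01 (indicator {c<..<d}) h \<in> M"
    by (rule closed_sequentially[OF cl t[OF tb h]])
qed

text \<open>As all \<open>transl t\<close> are isometries, the vectors with continuous orbit at 0
  form a closed subspace. It contains the test tensors, whose orbits are even differentiable
  there.\<close>

lemma transl_tendsto_0:
  assumes "F \<in> S"
  shows "((\<lambda>t. transl t F) \<longlongrightarrow> F) (at 0)"
proof -
  let ?M = "{F \<in> S. ((\<lambda>t. transl t F) \<longlongrightarrow> F) (at 0)}"
  have "closed ?M"
    unfolding closed_sequential_limits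
  proof (intro allI impI, elim conjE)
    fix X L assume X: "\<forall>n. X n \<in> ?M" and XL: "X \<longlonglongrightarrow> L"
    have L: "L \<in> S" by (rule closed_sequentially[OF closed_L2_on[OF slab_sets[OF \<Omega>]] _ XL]) (use X in auto)
    have "((\<lambda>t. transl t L) \<longlongrightarrow> L) (at 0)"
    proof (rule LIM_I)
      fix e :: real assume e: "e > 0"
      obtain n where n: "norm (X n - L) < e / 3"
        using LIMSEQ_D[OF XL, of "e/3"] e by auto
      have "((\<lambda>t. transl t (X n)) \<longlongrightarrow> X n) (at 0)" and Xn: "X n \<in> S" using X by auto
      from LIM_D[OF this(1), of "e/3"] e obtain d where d: "d > 0"
        "\<And>t. t \<noteq> 0 \<Longrightarrow> norm (t - 0) < d \<Longrightarrow> norm (transl t (X n) - X n) < e / 3" by auto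
      have "norm (transl t L - L) < e" if "t \<noteq> 0" "norm (t - 0) < d" for t
      proof -
        have "norm (transl t L - transl t (X n)) = norm (L - X n)"
          using unitary_on_norm[OF transl_unitary L2_on_diff[OF L Xn]] unitary_on_diff[OF transl_unitary L Xn] by simp
        moreover have "norm (transl t L - L) \<le> norm (transl t L - transl t (X n)) + norm (transl t (X n) - X n) + norm (X n - L)"
          using norm_triangle_ineq[of "transl t L - transl t (X n) + (transl t (X n) - X n)" "X n - L"]
            norm_triangle_ineq[of "transl t L - transl t (X n)" "transl t (X n) - X n"] by simp
        ultimately show ?thesis using d(2)[OF that] n by (simp add: norm_minus_commute)
      qed
      then show "\<exists>d>0. \<forall>t. t \<noteq> 0 \<and> norm (t - 0) < d \<longrightarrow> norm (transl t L - L) < e" using d(1) by blast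
    qed
    with L show "L \<in> ?M" by simp
  qed
  moreover have "subspace ?M"
    unfolding subspace_def
  proof (intro conjI ballI allI)
    have "transl t 0 = 0" for t using unitary_on_scaleC[OF transl_unitary L2_on_zero, of t 0] by simp
    then show "0 \<in> ?M" by simp
    fix F G r assume F: "F \<in> ?M"
    have "((\<lambda>t. r *\<^sub>R transl t F) \<longlongrightarrow> r *\<^sub>R F) (at 0)" using F by (intro tendsto_intros) auto
    then show "r *\<^sub>R F \<in> ?M"
      using F by (simp add: scaleR_L2_eq unitary_on_scaleC[OF transl_unitary] L2_on_scaleC)
    assume G: "G \<in> ?M"
    have "((\<lambda>t. transl t F + transl t G) \<longlongrightarrow> F + G) (at 0)" using F G by (intro tendsto_intros) auto
    then show "F + G \<in> ?M" using F G by (simp add: unitary_on_add[OF transl_unitary] L2_on_add)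
  qed
  moreover have "tensor01 b h \<in> ?M" if b: "test_fun01 b" and h: "h \<in> K" for b h
  proof -
    have sm: "smooth b" using b by (simp add: test_fun01_iff)
    obtain b' where "\<And>t. (b has_vector_derivative b' t) (at t)" using smooth_deriv[OF sm] by blast
    from test_quotient_tendsto[OF b this h]
    have "((\<lambda>t. t *\<^sub>R ((transl t (tensor01 b h) - tensor01 b h) /\<^sub>R t) + tensor01 b h) \<longlongrightarrow> 0 *\<^sub>R (- tensor01 b' h) + tensor01 b h) (at 0)"
      by (intro tendsto_intros)
    then have "((\<lambda>t. t *\<^sub>R ((transl t (tensor01 b h) - tensor01 b h) /\<^sub>R t) + tensor01 b h) \<longlongrightarrow> tensor01 b h) (at 0)" by simp
    moreover have "\<forall>\<^sub>F t in at 0. t *\<^sub>R ((transl t (tensor01 b h) - tensor01 b h) /\<^sub>R t) + tensor01 b h = transl t (tensor01 b h)"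
      unfolding eventually_at_filter by (rule always_eventually) auto
    ultimately have "((\<lambda>t. transl t (tensor01 b h)) \<longlongrightarrow> tensor01 b h) (at 0)"
      by (rule Lim_transform_eventually)
    then show ?thesis using tensor01_S[OF slab_fun_smooth[OF sm] h] by simp
  qed
  ultimately have "S \<subseteq> ?M" by (rule closed_subspace_test_total)
  then show ?thesis using assms by blast
qed

lemma transl_group: "unitary_group_on S transl"
  unfolding unitary_group_on_def
proof (intro conjI allI ballI)
  fix F assume F: "F \<in> S"
  show "continuous_on UNIV (\<lambda>t. transl t F)"
  proof (rule continuous_at_imp_continuous_on, rule ballI)
    fix t
    have "((\<lambda>h. transl h (transl t F)) \<longlongrightarrow> transl t F) (at 0)" by (rule transl_tendsto_0[OF transl_S])
    then have "((\<lambda>h. transl (t + h) F) \<longlongrightarrow> transl t F) (at 0)" by (simp add: transl_add[symmetric] add.commute)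
    then show "isCont (\<lambda>t. transl t F) t" by (simp add: isCont_def LIM_offset_zero_iff)
  qed
qed (simp_all add: transl_unitary transl_0 transl_add)

end

lemma smooth_exp_fun: "smooth (\<lambda>x. exp (of_real x))"
  using smooth_exp[of 1] by simp

lemma smooth_exp_reflect: "smooth (\<lambda>x. exp (of_real (1 - x)))"
  using smooth_affine[OF smooth_exp_fun, of 1 "-1"] by simp

lemma exp_fun_deriv: "((\<lambda>x. exp (complex_of_real (s * x))) has_vector_derivative of_real s * exp (of_real (s * x))) (at x)"
proof -
  have "((\<lambda>x. complex_of_real (exp (s * x))) has_vector_derivative of_real (exp (s * x) * s)) (at x)"
    by (intro has_vector_derivative_of_real)
       (auto intro!: derivative_eq_intros simp: has_real_derivative_iff_has_vector_derivative[symmetric])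
  then show ?thesis unfolding exp_of_real by (simp add: mult.commute)
qed

lemma exp_reflect_deriv: "((\<lambda>x. exp (complex_of_real (1 - x))) has_vector_derivative - exp (of_real (1 - x))) (at x)"
proof -
  have "((\<lambda>x. complex_of_real (exp (1 - x))) has_vector_derivative of_real (- exp (1 - x))) (at x)"
    by (intro has_vector_derivative_of_real)
       (auto intro!: derivative_eq_intros simp: has_real_derivative_iff_has_vector_derivative[symmetric])
  then show ?thesis unfolding exp_of_real by simp
qed

context bdry
begin

section \<open>The core spanned by tensors\<close>

abbreviation "E0 \<equiv> tensor01 (\<lambda>x. exp (of_real x)) :: 'a L2 \<Rightarrow> _"
abbreviation "E1 \<equiv> tensor01 (\<lambda>x. exp (of_real (1 - x))) :: 'a L2 \<Rightarrow> _"

text \<open>The part of the core spanned by elementary tensors. For a general element of \<open>\<D>\<close> the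
  difference quotients are not estimated directly; it enters the generator by duality, see
  \<open>dx1_graph_gen\<close>.\<close>

definition tensor_core :: "((real \<times> 'a) L2 \<times> (real \<times> 'a) L2) set" where
  "tensor_core =
     {(tensor01 b h, (- \<i>) *\<^sub>C tensor01 b' h) | b b' h.
        test_fun01 b \<and> (\<forall>t. (b has_vector_derivative b' t) (at t)) \<and> h \<in> K} \<union>
     {(E0 h + E1 (V h), (- \<i>) *\<^sub>C (E0 h - E1 (V h))) | h. h \<in> K}"

lemma tensor_core_cases:
  assumes "p \<in> tensor_core"
  obtains b b' h where "p = (tensor01 b h, (- \<i>) *\<^sub>C tensor01 b' h)" "test_fun01 b"
      "\<And>t. (b has_vector_derivative b' t) (at t)" "h \<in> K"
    | h where "p = (E0 h + E1 (V h), (- \<i>) *\<^sub>C (E0 h - E1 (V h)))" "h \<in> K"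
  using assms unfolding tensor_core_def by blast

lemma exp_quotient_tendsto:
  assumes h: "h \<in> K"
  shows "((\<lambda>t. (transl t (E0 h + E1 (V h)) - (E0 h + E1 (V h))) /\<^sub>R t) \<longlongrightarrow> - (E0 h - E1 (V h))) (at 0)"
proof -
  have Vh: "V h \<in> K" by (rule unitary_on_in[OF V h])
  let ?p = "\<lambda>x. exp (complex_of_real x) *\<^sub>C h + exp (complex_of_real (1 - x)) *\<^sub>C V h"
  let ?p' = "\<lambda>x. exp (complex_of_real x) *\<^sub>C h + (- exp (complex_of_real (1 - x))) *\<^sub>C V h"
  have "slab_fun (\<lambda>x. - exp (complex_of_real (1 - x)))"
    using slab_fun_cmult[OF slab_fun_smooth[OF smooth_exp_reflect], of "-1"] by simp
  note sl = slab_fun_smooth[OF smooth_exp_fun] slab_fun_smooth[OF smooth_exp_reflect] this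
  have r: "restrict01 \<Omega> (wrap ?p) = E0 h + E1 (V h)"
    by (rule restrict01_wrap[OF L2_on_add[OF tensor01_S[OF sl(1) h] tensor01_S[OF sl(2) Vh]]],
        use slice_tensor01[OF sl(1), of h] slice_tensor01[OF sl(2), of "V h"] slice_add[of "E0 h" "E1 (V h)"]
        in eventually_elim) simp
  have r': "restrict01 \<Omega> (wrap ?p') = E0 h - E1 (V h)"
    by (rule restrict01_wrap[OF L2_on_diff[OF tensor01_S[OF sl(1) h] tensor01_S[OF sl(2) Vh]]],
        use slice_tensor01[OF sl(1), of h] slice_tensor01[OF sl(2), of "V h"] slice_diff[of "E0 h" "E1 (V h)"]
        in eventually_elim) simp
  have e1: "exp (1::complex) *\<^sub>C f = exp 1 *\<^sub>R f" for f :: "'a L2"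
    unfolding scaleR_L2_eq using exp_of_real[of 1, where 'a=complex] by simp
  have "((\<lambda>t. (transl t (restrict01 \<Omega> (wrap ?p)) - restrict01 \<Omega> (wrap ?p)) /\<^sub>R t)
     \<longlongrightarrow> - restrict01 \<Omega> (wrap ?p')) (at 0)"
  proof (rule path_quotient_tendsto)
    fix x
    show "(?p has_vector_derivative ?p' x) (at x)"
      using exp_fun_deriv[of 1 x]
      by (intro has_vector_derivative_add has_vector_derivative_scaleC exp_reflect_deriv) simp
    show "?p x \<in> K" "?p' x \<in> K"
      by (intro L2_on_add L2_on_scaleC h Vh)+
  next
    show "continuous_on UNIV ?p'"
      by (intro continuous_on_add continuous_on_scaleC_fun smooth_continuous[OF smooth_exp_fun]
          continuous_on_minus smooth_continuous[OF smooth_exp_reflect])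
    \<comment> \<open>The endpoint values are e h + V h and h + e V h, related by the defining
      equation of the boundary operator.\<close>
    show "?p 1 = U (?p 0)"
      using U_eq[OF h] by (simp add: e1)
  qed
  then show ?thesis by (simp only: r r')
qed

end

sublocale bdry \<subseteq> G: unitary_group "{0<..<1::real} \<times> \<Omega>" transl
  by unfold_locales (use slab_sets[OF \<Omega>] transl_group in auto)

context bdry
begin

lemma tensor_core_gen: "tensor_core \<subseteq> gen S transl"
proof
  fix p assume "p \<in> tensor_core"
  then show "p \<in> gen S transl"
  proof (cases rule: tensor_core_cases)
    case (1 b b' h)
    then have "slab_fun b" by (auto simp: test_fun01_iff intro: slab_fun_smooth)
    with test_quotient_tendsto[OF 1(2,3,4)] 1 show ?thesis by (simp add: gen_def tensor01_S)
  next
    case (2 h)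
    have "E0 h + E1 (V h) \<in> S"
      using 2 by (intro L2_on_add tensor01_S slab_fun_smooth smooth_exp_fun smooth_exp_reflect unitary_on_in[OF V])
    with exp_quotient_tendsto[OF 2(2)] 2 show ?thesis by (simp add: gen_def scaleC_diff_right)
  qed
qed

section \<open>Density of the ranges\<close>

abbreviation "tspan \<equiv> span tensor_core"

lemma tspan_gen: "tspan \<subseteq> gen S transl"
  by (rule span_minimal[OF tensor_core_gen G.subspace_gen])

lemma integral_bump_pos: "integral {0..1} (bump 1 (1/4) (3/4)) > 0"
proof -
  have c: "continuous_on {0..1} (bump 1 (1/4) (3/4))"
  proof -
    have "continuous_on {0..1} (\<lambda>t. Re (of_real (bump 1 (1/4) (3/4) t)))"
      by (intro continuous_on_Re smooth_continuous smooth_bump) simp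
    then show ?thesis by simp
  qed
  have nn: "\<And>t. t \<in> {0..1} \<Longrightarrow> 0 \<le> bump 1 (1/4) (3/4) t" using bump_bounds[of 1] by auto
  have "integral {0..1} (bump 1 (1/4) (3/4)) \<noteq> 0"
  proof
    assume "integral {0..1} (bump 1 (1/4) (3/4)) = 0"
    then have "\<forall>t\<in>{0..1}. bump 1 (1/4) (3/4) t = 0"
      using integral_eq_0_iff[OF c _ nn] by simp
    then show False using bump_pos[of "1/2" "1/4" "3/4" 1] by force
  qed
  then show ?thesis
    using integral_nonneg[OF integrable_continuous_real[OF c] nn] by linarith
qed

text \<open>With \<open>b = e\<^bsup>\<sigma>x\<^esup> v\<close> one has \<open>b' - \<sigma> b = e\<^bsup>\<sigma>x\<^esup> v'\<close>. Hence, modulo the closed range, \<open>e\<^bsup>\<sigma>x\<^esup> a \<otimes> k\<close>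
  depends only on the mean of \<open>a\<close>. The exponential parts of the core put \<open>e\<^bsup>-\<sigma>x\<^esup> \<otimes> k\<close> into the range,
  which is the case \<open>a = e\<^bsup>-2\<sigma>x\<^esup>\<close> of positive mean, so everything is in the range.\<close>

lemma dense_range:
  assumes \<sigma>: "\<sigma> = 1 \<or> \<sigma> = (-1::real)"
  shows "S \<subseteq> closure ((\<lambda>(u, v). v + (\<i> * of_real \<sigma>) *\<^sub>C u) ` tspan)"
proof -
  let ?L = "\<lambda>(u :: (real \<times> 'a) L2, v). v + (\<i> * of_real \<sigma>) *\<^sub>C u"
  define M where "M = closure (?L ` tspan)"
  have lin: "linear ?L"
    by (rule linearI) (auto simp: scaleC_add_right scaleC_scaleR_commute scaleR_add_right)
  have sub: "subspace M"
    unfolding M_def by (intro subspace_closure_normed linear_subspace_image[OF lin] subspace_span)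
  have cl: "closed M" unfolding M_def by simp
  have base: "v + (\<i> * of_real \<sigma>) *\<^sub>C u \<in> M" if "(u, v) \<in> tensor_core" for u v
  proof -
    have "?L (u, v) \<in> ?L ` tspan" by (rule imageI[OF span_base[OF that]])
    then have "?L (u, v) \<in> M" unfolding M_def by (rule subsetD[OF closure_subset])
    then show ?thesis by simp
  qed
  define e where "e s x = exp (complex_of_real (s * x))" for s x
  have e_sm: "smooth (e s)" for s unfolding e_def by (rule smooth_exp)
  have e_slab: "slab_fun (e s)" for s by (rule slab_fun_smooth[OF e_sm])
  have e_add: "e s x * e t x = e (s + t) x" for s t x
    by (simp add: e_def exp_add[symmetric] distrib_right)
  have e_d: "(e s has_vector_derivative of_real s * e s x) (at x)" for s x
    unfolding e_def by (rule exp_fun_deriv)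
  have mean_zero: "tensor01 (\<lambda>x. e \<sigma> x * w x) k \<in> M"
    if w: "test_fun01 w" "integral {0..1} w = 0" and k: "k \<in> K" for w k
  proof -
    obtain v where v: "test_fun01 v" "\<And>t. (v has_vector_derivative w t) (at t)"
      using test_fun01_antideriv[OF w] by blast
    let ?b = "\<lambda>x. e \<sigma> x * v x" and ?b' = "\<lambda>x. e \<sigma> x * w x + of_real \<sigma> * e \<sigma> x * v x"
    have b: "test_fun01 ?b" by (rule test_fun01_mult[OF e_sm v(1)])
    have d: "(?b has_vector_derivative ?b' t) (at t)" for t
      by (rule has_vector_derivative_mult[OF e_d v(2)])
    have sw: "slab_fun (\<lambda>x. e \<sigma> x * w x)" and sv: "slab_fun ?b"
      using b test_fun01_mult[OF e_sm w(1)] by (auto simp: test_fun01_iff intro: slab_fun_smooth)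
    \<comment> \<open>The factor \<open>\<i>\<close> cancels the \<open>- \<i>\<close> in the second
      component of the core.\<close>
    let ?h = "\<i> *\<^sub>C k"
    have h: "?h \<in> K" by (rule L2_on_scaleC[OF k])
    have "(tensor01 ?b ?h, (- \<i>) *\<^sub>C tensor01 ?b' ?h) \<in> tensor_core"
      unfolding tensor_core_def using b d h by blast
    from base[OF this] have "(- \<i>) *\<^sub>C tensor01 ?b' ?h + (\<i> * of_real \<sigma>) *\<^sub>C tensor01 ?b ?h \<in> M" .
    also have "tensor01 ?b' ?h = tensor01 (\<lambda>x. e \<sigma> x * w x) ?h + of_real \<sigma> *\<^sub>C tensor01 ?b ?h"
      using tensor01_add_fun[OF sw slab_fun_cmult[OF sv], of "of_real \<sigma>" ?h] tensor01_cmult[OF sv, of "of_real \<sigma>" ?h]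
      by (simp add: mult.assoc)
    also have "(- \<i>) *\<^sub>C (tensor01 (\<lambda>x. e \<sigma> x * w x) ?h + of_real \<sigma> *\<^sub>C tensor01 ?b ?h) + (\<i> * of_real \<sigma>) *\<^sub>C tensor01 ?b ?h
        = (- \<i>) *\<^sub>C tensor01 (\<lambda>x. e \<sigma> x * w x) ?h"
      by (simp add: scaleC_add_right)
    also have "\<dots> = tensor01 (\<lambda>x. e \<sigma> x * w x) k"
      by (simp add: tensor01_scaleC[OF sw])
    finally show ?thesis .
  qed
  have exp_in: "tensor01 (e (- \<sigma>)) k \<in> M" if k: "k \<in> K" for k
  proof -
    have sl: "slab_fun (\<lambda>x. exp (complex_of_real x))" "slab_fun (\<lambda>x. exp (complex_of_real (1 - x)))"
      by (intro slab_fun_smooth smooth_exp_fun smooth_exp_reflect)+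
    have tc: "(- \<i>) *\<^sub>C (E0 h - E1 (V h)) + (\<i> * of_real \<sigma>) *\<^sub>C (E0 h + E1 (V h)) \<in> M" if "h \<in> K" for h
      by (rule base) (use that in \<open>auto simp: tensor_core_def\<close>)
    from \<sigma> show ?thesis
    proof
      assume s: "\<sigma> = 1"
      \<comment> \<open>For \<open>\<sigma> = 1\<close> the \<open>E0\<close> parts cancel and
        \<open>2 * \<i>\<close> times \<open>E1 (V h)\<close> remains. The constant removes this
        factor and the e in e^(1-x) = e e^(-x); surjectivity of \<open>V\<close> supplies
        \<open>h\<close>.\<close>
      let ?c = "1 / (2 * \<i> * exp 1)"
      obtain h where h: "h \<in> K" "V h = ?c *\<^sub>C k" using unitary_on_surj[OF V L2_on_scaleC[OF k]] by blast
      have "E1 (V h) = tensor01 (\<lambda>x. exp 1 * e (- 1) x) (V h)"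
        by (rule tensor01_cong) (simp add: e_def exp_diff exp_minus divide_inverse)
      also have "\<dots> = exp 1 *\<^sub>C ?c *\<^sub>C tensor01 (e (- 1)) k"
        unfolding h(2) tensor01_cmult[OF e_slab] tensor01_scaleC[OF e_slab] ..
      finally have "(2 * \<i>) *\<^sub>C E1 (V h) = tensor01 (e (- 1)) k" by simp
      moreover have "(- \<i>) *\<^sub>C (E0 h - E1 (V h)) + (\<i> * of_real \<sigma>) *\<^sub>C (E0 h + E1 (V h)) = (2 * \<i>) *\<^sub>C E1 (V h)"
        using scaleC_add_left[of "\<i>" "\<i>" "E1 (V h)"] by (simp add: s scaleC_add_right scaleC_diff_right)
      ultimately show ?thesis using tc[OF h(1)] s by simp
    next
      assume s: "\<sigma> = -1"
      \<comment> \<open>For \<open>\<sigma> = -1\<close> the \<open>E1\<close> parts cancel instead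
        and \<open>- 2 * \<i>\<close> times \<open>E0 h\<close> remains, with \<open>h\<close> free
        to choose.\<close>
      let ?c = "1 / (- 2 * \<i>)"
      define h where "h = ?c *\<^sub>C k"
      have h: "h \<in> K" unfolding h_def by (rule L2_on_scaleC[OF k])
      have "E0 h = ?c *\<^sub>C tensor01 (e 1) k"
        unfolding h_def tensor01_scaleC[OF sl(1)] by (simp add: e_def[abs_def])
      then have "(- 2 * \<i>) *\<^sub>C E0 h = tensor01 (e 1) k" by (simp only: scaleC_scaleC) simp
      moreover have "(- \<i>) *\<^sub>C (E0 h - E1 (V h)) + (\<i> * of_real \<sigma>) *\<^sub>C (E0 h + E1 (V h)) = (- 2 * \<i>) *\<^sub>C E0 h"
        using scaleC_add_left[of "\<i>" "\<i>" "E0 h"] by (simp add: s scaleC_add_right scaleC_diff_right)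
      ultimately show ?thesis using tc[OF h] s by simp
    qed
  qed
  define I where "I = integral {0..1} (bump 1 (1/4) (3/4))"
  have I: "I > 0" unfolding I_def by (rule integral_bump_pos)
  \<comment> \<open>A test function of mean 1, used to correct any other test function to mean
    zero.\<close>
  define \<rho> where "\<rho> x = bump 1 (1/4) (3/4) x / I" for x
  have rho_t: "test_fun01 (\<lambda>x. complex_of_real (\<rho> x))"
    using test_fun01_cmult[OF test_fun01_bump[of 1 "1/4" "3/4"], of "1 / of_real I"] by (simp add: \<rho>_def)
  have int_test: "(\<lambda>x. complex_of_real (a x)) integrable_on {0..1}" "a integrable_on {0..1}"
    if "test_fun01 (\<lambda>x. complex_of_real (a x))" for a :: "real \<Rightarrow> real"
  proof -
    have c: "continuous_on {0..1} (\<lambda>x. complex_of_real (a x))" 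
      by (rule smooth_continuous) (use that in \<open>simp add: test_fun01_iff\<close>)
    then show "(\<lambda>x. complex_of_real (a x)) integrable_on {0..1}" by (rule integrable_continuous_real)
    have "continuous_on {0..1} (\<lambda>x. Re (complex_of_real (a x)))" by (rule continuous_on_Re[OF c])
    then show "a integrable_on {0..1}" by (intro integrable_continuous_real) simp
  qed
  have int_of_real: "integral {0..1} (\<lambda>x. complex_of_real (a x)) = of_real (integral {0..1} a)"
    if "a integrable_on {0..1}" for a :: "real \<Rightarrow> real"
    using has_integral_linear[OF integrable_integral[OF that] bounded_linear_of_real[where 'a=complex]]
    by (intro integral_unique) (simp add: comp_def)
  have rho1: "integral {0..1} \<rho> = 1"
    using I by (simp add: \<rho>_def[abs_def] I_def integral_divide)
  have tot: "tensor01 (indicator {c<..<d}) k \<in> M" if cd: "0 \<le> c" "c < d" "d \<le> 1" and k: "k \<in> K" for c d k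
  proof -
    define r where "r = tensor01 (\<lambda>x. e \<sigma> x * of_real (\<rho> x)) k"
    \<comment> \<open>Modulo \<open>M\<close>, the weighted tensor of \<open>a\<close> is the mean
      of \<open>a\<close> times the fixed vector \<open>r\<close>.\<close>
    define Q where "Q a \<longleftrightarrow> tensor01 (\<lambda>x. e \<sigma> x * of_real (a x)) k - integral {0..1} a *\<^sub>R r \<in> M" for a
    have rsl: "slab_fun (\<lambda>x. e \<sigma> x * of_real (\<rho> x))"
      using test_fun01_mult[OF e_sm rho_t] by (auto simp: test_fun01_iff intro: slab_fun_smooth)
    have Q_test: "Q a" if a: "test_fun01 (\<lambda>x. complex_of_real (a x))" for a
    proof -
      let ?J = "integral {0..1} a"
      let ?w = "\<lambda>x. complex_of_real (a x) + (- of_real ?J) * of_real (\<rho> x)"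
      have w: "test_fun01 ?w" by (rule test_fun01_add[OF a test_fun01_cmult[OF rho_t]])
      have "integral {0..1} ?w = integral {0..1} (\<lambda>x. complex_of_real (a x)) + integral {0..1} (\<lambda>x. (- of_real ?J) * complex_of_real (\<rho> x))"
        by (rule integral_add[OF int_test(1)[OF a] integrable_on_mult_right[OF int_test(1)[OF rho_t]]])
      also have "\<dots> = 0"
        by (simp add: int_of_real int_test[OF a] int_test[OF rho_t] rho1)
      finally have mz: "tensor01 (\<lambda>x. e \<sigma> x * ?w x) k \<in> M" by (intro mean_zero w k)
      have asl: "slab_fun (\<lambda>x. e \<sigma> x * of_real (a x))"
        using test_fun01_mult[OF e_sm a] by (auto simp: test_fun01_iff intro: slab_fun_smooth)
      have "tensor01 (\<lambda>x. e \<sigma> x * ?w x) k = tensor01 (\<lambda>x. e \<sigma> x * of_real (a x) + (- of_real ?J) * (e \<sigma> x * of_real (\<rho> x))) k"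
        by (rule tensor01_cong) (simp add: algebra_simps)
      also have "\<dots> = tensor01 (\<lambda>x. e \<sigma> x * of_real (a x)) k + (- of_real ?J) *\<^sub>C r"
        unfolding tensor01_add_fun[OF asl slab_fun_cmult[OF rsl]] tensor01_cmult[OF rsl] r_def ..
      also have "\<dots> = tensor01 (\<lambda>x. e \<sigma> x * of_real (a x)) k - ?J *\<^sub>R r"
        by (simp add: scaleR_L2_eq)
      finally show ?thesis using mz unfolding Q_def by simp
    qed
    \<comment> \<open>Both sides of the congruence are continuous under bounded pointwise
      convergence, so test functions may be replaced by exponentials cut off to an interval. Two
      exponents \<open>\<kappa>\<close> are used below.\<close>
    have Q_ind: "Q (\<lambda>x. exp (\<kappa> * x) * indicator {c<..<d} x)" if cd: "0 \<le> c" "c < d" "d \<le> 1" for \<kappa> c d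
    proof -
      let ?a = "\<lambda>n x. exp (\<kappa> * x) * bump (1 / Suc n) (c + 1 / Suc n) (d - 1 / Suc n) x"
      let ?l = "\<lambda>x. exp (\<kappa> * x) * indicator {c<..<d} x :: real"
      have t: "test_fun01 (\<lambda>x. complex_of_real (?a n x))" for n
      proof -
        from test_fun01_mult[OF smooth_exp[of \<kappa>] test_fun01_bump_seq[OF cd(1,3)]] show ?thesis
          unfolding exp_of_real by (simp only: of_real_mult)
      qed
      have bd: "\<bar>?a n x\<bar> \<le> exp \<bar>\<kappa>\<bar>" if "x \<in> {0..1}" for n x
      proof -
        have "\<bar>\<kappa> * x\<bar> \<le> \<bar>\<kappa>\<bar>"
          using that by (simp add: abs_mult mult_left_le)
        then have "\<kappa> * x \<le> \<bar>\<kappa>\<bar>" by linarith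
        then have "exp (\<kappa> * x) \<le> exp \<bar>\<kappa>\<bar>" by simp
        moreover have "0 \<le> bump (1 / Suc n) (c + 1 / Suc n) (d - 1 / Suc n) x \<and> bump (1 / Suc n) (c + 1 / Suc n) (d - 1 / Suc n) x \<le> 1"
          by (rule bump_bounds) simp
        ultimately show ?thesis using mult_mono[of "exp (\<kappa> * x)" "exp \<bar>\<kappa>\<bar>" "bump (1 / Suc n) (c + 1 / Suc n) (d - 1 / Suc n) x" 1]
          by (simp add: abs_mult)
      qed
      have lim: "(\<lambda>n. ?a n x) \<longlonglongrightarrow> ?l x" for x
        by (intro tendsto_mult_left bump_tendsto cd)
      have "(\<lambda>n. integral {0..1} (?a n)) \<longlonglongrightarrow> integral {0..1} ?l"
        by (rule dominated_convergence(2)[where h="\<lambda>_. exp \<bar>\<kappa>\<bar>"])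
           (use int_test(2)[OF t] bd lim in auto)
      moreover have "(\<lambda>n. tensor01 (\<lambda>x. e \<sigma> x * of_real (?a n x)) k) \<longlonglongrightarrow> tensor01 (\<lambda>x. e \<sigma> x * of_real (?l x)) k"
      proof (rule tensor01_tendsto)
        show "(\<lambda>x. e \<sigma> x * complex_of_real (?a n x)) \<in> borel_measurable lebesgue" for n
          using slab_fun_smooth[of "\<lambda>x. e \<sigma> x * complex_of_real (?a n x)"] test_fun01_mult[OF e_sm t, of \<sigma> n]
          unfolding slab_fun_def test_fun01_iff by blast
        show "cmod (e \<sigma> x * complex_of_real (?a n x)) \<le> exp 1 * exp \<bar>\<kappa>\<bar>" if "x \<in> {0<..<1}" for n x
        proof -
          have "cmod (e \<sigma> x) = exp (\<sigma> * x)" unfolding e_def exp_of_real by (simp only: norm_of_real) simp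
          also have "\<dots> \<le> exp 1" using \<sigma> that by auto
          finally show ?thesis using bd[of x n] that unfolding norm_mult norm_of_real by (intro mult_mono) auto
        qed
        show "(\<lambda>n. e \<sigma> x * complex_of_real (?a n x)) \<longlonglongrightarrow> e \<sigma> x * complex_of_real (?l x)" for x
          by (intro tendsto_mult_left tendsto_of_real lim)
        have "(\<lambda>x. e \<sigma> x * (e \<kappa> x * indicator {c<..<d} x)) \<in> borel_measurable lebesgue"
          using slab_fun_mult[OF e_slab[of \<sigma>] slab_fun_mult[OF e_slab[of \<kappa>] slab_fun_indicator[of c d]]] unfolding slab_fun_def by blast
        then show "(\<lambda>x. e \<sigma> x * complex_of_real (?l x)) \<in> borel_measurable lebesgue"
          unfolding e_def exp_of_real by (simp add: of_real_indicator)
      qed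
      ultimately have "(\<lambda>n. tensor01 (\<lambda>x. e \<sigma> x * of_real (?a n x)) k - integral {0..1} (?a n) *\<^sub>R r)
          \<longlonglongrightarrow> tensor01 (\<lambda>x. e \<sigma> x * of_real (?l x)) k - integral {0..1} ?l *\<^sub>R r"
        by (intro tendsto_intros)
      then show ?thesis
        unfolding Q_def by (rule closed_sequentially[OF cl, rotated]) (use Q_test[OF t] in \<open>simp add: Q_def\<close>)
    qed
    have tens: "tensor01 (\<lambda>x. e \<sigma> x * of_real (exp (\<kappa> * x) * indicator {c<..<d} x)) k
        = tensor01 (\<lambda>x. e (\<sigma> + \<kappa>) x * indicator {c<..<d} x) k" for \<kappa> c d
      unfolding e_add[symmetric] e_def[of \<kappa>] exp_of_real
      by (rule tensor01_cong) (simp add: of_real_indicator mult.assoc)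
    \<comment> \<open>The exponent \<open>- 2 * \<sigma>\<close> turns the weight into
      e^(-\<sigma>x), which \<open>exp_in\<close> places in \<open>M\<close>. Its mean
      \<open>?J\<close> is nonzero, hence \<open>r\<close> itself is in \<open>M\<close>.\<close>
    let ?J = "integral {0..1} (\<lambda>x. exp (- 2 * \<sigma> * x) * indicator {0<..<1} x) :: real"
    have "?J = integral {0..1} (\<lambda>x. exp (- 2 * \<sigma> * x))"
      by (rule integral_spike[of "{0, 1}"]) (auto simp: indicator_def)
    also have "\<dots> \<noteq> 0"
    proof
      assume "integral {0..1} (\<lambda>x. exp (- 2 * \<sigma> * x)) = 0"
      then have "\<forall>x\<in>{0..1::real}. exp (- 2 * \<sigma> * x) = 0"
        by (subst (asm) integral_eq_0_iff) (auto intro!: continuous_intros)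
      then show False by (auto dest: bspec[of _ _ 0])
    qed
    finally have J: "?J \<noteq> 0" .
    have "tensor01 (\<lambda>x. e (\<sigma> + (- 2 * \<sigma>)) x * indicator {0<..<1} x) k = tensor01 (e (- \<sigma>)) k"
      by (rule tensor01_cong) simp
    then have "tensor01 (e (- \<sigma>)) k - ?J *\<^sub>R r \<in> M"
      using Q_ind[of 0 1 "- 2 * \<sigma>"] unfolding Q_def tens by simp
    from subspace_diff[OF sub exp_in[OF k] this] have "?J *\<^sub>R r \<in> M" by simp
    from subspace_scale[OF sub this, of "1 / ?J"] have r: "r \<in> M" using J by simp
    \<comment> \<open>The exponent \<open>- \<sigma>\<close> cancels the weight and leaves the plain
      indicator.\<close>
    have "tensor01 (\<lambda>x. e (\<sigma> + (- \<sigma>)) x * indicator {c<..<d} x) k = tensor01 (indicator {c<..<d}) k"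
      by (rule tensor01_cong) (simp add: e_def)
    then have "tensor01 (indicator {c<..<d}) k - integral {0..1} (\<lambda>x. exp (- \<sigma> * x) * indicator {c<..<d} x) *\<^sub>R r \<in> M"
      using Q_ind[of c d "- \<sigma>"] cd unfolding Q_def tens by simp
    from subspace_add[OF sub this subspace_scale[OF sub r, of "integral {0..1} (\<lambda>x. exp (- \<sigma> * x) * indicator {c<..<d} x)"]]
    show ?thesis by simp
  qed
  have "S \<subseteq> M" by (rule tensor01_total[OF cl sub tot])
  then show ?thesis by (simp add: M_def)
qed

lemma gen_dense: "S \<subseteq> closure (fst ` gen S transl)"
proof (rule closed_subspace_test_total)
  have "subspace (fst ` gen S transl)" by (rule linear_subspace_image[OF linear_fst G.subspace_gen])
  then show "subspace (closure (fst ` gen S transl))" by (rule subspace_closure_normed)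
  fix b h assume b: "test_fun01 b" and h: "h \<in> K"
  then have sm: "smooth b" by (simp add: test_fun01_iff)
  obtain b' where "\<And>t. (b has_vector_derivative b' t) (at t)" using smooth_deriv[OF sm] by blast
  then have "(tensor01 b h, (- \<i>) *\<^sub>C tensor01 b' h) \<in> tensor_core"
    unfolding tensor_core_def using b h by blast
  then have "(tensor01 b h, (- \<i>) *\<^sub>C tensor01 b' h) \<in> gen S transl" using tensor_core_gen by blast
  from imageI[OF this, of fst] have "tensor01 b h \<in> fst ` gen S transl" by simp
  then show "tensor01 b h \<in> closure (fst ` gen S transl)" by (rule subsetD[OF closure_subset])
qed simp

lemma gen_eq: "gen S transl = closure tspan"
  by (rule G.gen_eq_closure[OF tspan_gen subspace_span dense_range]) simp

lemma gen_selfadjoint: "selfadjoint_on S (gen S transl)"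
  by (rule G.selfadjoint_gen[OF tspan_gen subspace_span dense_range gen_dense])

end

context bdry
begin

section \<open>Identification of the generator\<close>

lemma cinner_zero_left [simp]: "cinner 0 f = 0"
  using cinner_scaleC_left[of 0 0 f] by simp

definition slab_test :: "(real \<times> 'a \<Rightarrow> complex) \<Rightarrow> bool" where
  "slab_test \<Phi> \<longleftrightarrow> (\<forall>x y. y \<notin> \<Omega> \<longrightarrow> \<Phi> (x, y) = 0) \<and> (\<forall>y\<in>\<Omega>. test_fun01 (\<lambda>x. \<Phi> (x, y)))"

lemma dx1_graph_eq:
  "dx1_graph \<Omega> = {(L2_of \<Phi>, L2_of (dx1 \<Phi>)) | \<Phi>. square_int \<Phi> \<and> square_int (dx1 \<Phi>) \<and> slab_test \<Phi>}"
  unfolding dx1_graph_def slab_test_def by simp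

lemma slab_test_section:
  assumes "slab_test \<Phi>"
  shows "test_fun01 (\<lambda>x. \<Phi> (x, y))"
proof (cases "y \<in> \<Omega>")
  case False
  then have "(\<lambda>x. \<Phi> (x, y)) = (\<lambda>x. 0)" using assms by (auto simp: slab_test_def)
  moreover have "test_fun01 (\<lambda>x. 0)"
    unfolding test_fun01_iff using smooth_const[of 0] by (intro conjI exI[of _ "1/2"]) auto
  ultimately show ?thesis by simp
qed (use assms in \<open>auto simp: slab_test_def\<close>)

lemma slab_test_deriv:
  assumes "slab_test \<Phi>"
  shows "((\<lambda>s. \<Phi> (s, y)) has_vector_derivative dx1 \<Phi> (x, y)) (at x)"
proof -
  have "smooth (\<lambda>x. \<Phi> (x, y))" using slab_test_section[OF assms, of y] by (simp add: test_fun01_iff)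
  then obtain f' where f': "\<And>t. ((\<lambda>s. \<Phi> (s, y)) has_vector_derivative f' t) (at t)"
    using smooth_deriv by blast
  show ?thesis using f'[of x] vector_derivative_at[OF f'[of x]] by (simp add: dx1_def)
qed

lemma slab_test_dx1_section:
  assumes "slab_test \<Phi>"
  shows "test_fun01 (\<lambda>x. dx1 \<Phi> (x, y))"
  by (rule test_fun01_deriv[OF slab_test_section[OF assms] slab_test_deriv[OF assms]])

lemma dx1_eqI: "(\<And>x y. ((\<lambda>s. \<Phi> (s, y)) has_vector_derivative D (x, y)) (at x)) \<Longrightarrow> dx1 \<Phi> = D"
  using vector_derivative_at by (fastforce simp: dx1_def)

lemma dx1_graph_add:
  assumes "(f, g) \<in> dx1_graph \<Omega>" "(u, v) \<in> dx1_graph \<Omega>"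
  shows "(f + u, g + v) \<in> dx1_graph \<Omega>"
proof -
  obtain \<Phi> where P: "f = L2_of \<Phi>" "g = L2_of (dx1 \<Phi>)" "square_int \<Phi>" "square_int (dx1 \<Phi>)" "slab_test \<Phi>"
    using assms(1) unfolding dx1_graph_eq by blast
  obtain \<Psi> where Q: "u = L2_of \<Psi>" "v = L2_of (dx1 \<Psi>)" "square_int \<Psi>" "square_int (dx1 \<Psi>)" "slab_test \<Psi>"
    using assms(2) unfolding dx1_graph_eq by blast
  have d: "dx1 (\<lambda>p. \<Phi> p + \<Psi> p) = (\<lambda>p. dx1 \<Phi> p + dx1 \<Psi> p)"
    by (rule dx1_eqI) (intro has_vector_derivative_add slab_test_deriv P Q)
  have "slab_test (\<lambda>p. \<Phi> p + \<Psi> p)"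
    using P(5) Q(5) by (auto simp: slab_test_def intro: test_fun01_add)
  then show ?thesis
    unfolding dx1_graph_eq using P Q
    by (auto simp: d L2_of_add square_int_add intro!: exI[of _ "\<lambda>p. \<Phi> p + \<Psi> p"])
qed

lemma dx1_graph_scaleC:
  assumes "(f, g) \<in> dx1_graph \<Omega>"
  shows "(c *\<^sub>C f, c *\<^sub>C g) \<in> dx1_graph \<Omega>"
proof -
  obtain \<Phi> where P: "f = L2_of \<Phi>" "g = L2_of (dx1 \<Phi>)" "square_int \<Phi>" "square_int (dx1 \<Phi>)" "slab_test \<Phi>"
    using assms(1) unfolding dx1_graph_eq by blast
  have d: "dx1 (\<lambda>p. c * \<Phi> p) = (\<lambda>p. c * dx1 \<Phi> p)"
    by (rule dx1_eqI) (intro has_vector_derivative_mult_right slab_test_deriv P)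
  have "slab_test (\<lambda>p. c * \<Phi> p)"
    using P(5) by (auto simp: slab_test_def intro: test_fun01_cmult)
  then show ?thesis
    unfolding dx1_graph_eq using P
    by (auto simp: d L2_of_scaleC square_int_scale intro!: exI[of _ "\<lambda>p. c * \<Phi> p"])
qed

lemma tensor_test_dx1_graph:
  assumes b: "test_fun01 b" and d: "\<And>t. (b has_vector_derivative b' t) (at t)" and h: "h \<in> K"
  shows "(tensor01 b h, tensor01 b' h) \<in> dx1_graph \<Omega>"
proof -
  \<comment> \<open>\<open>dx1_graph\<close> asks for a function that vanishes at every point
    outside \<Omega>, while \<open>h\<close> does so almost everywhere; the indicator adjusts the
    representative.\<close>
  let ?g = "\<lambda>y. indicator \<Omega> y * fun_of_L2 h y"
  let ?T = "\<lambda>b (x, y). b x * ?g y"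
  have b': "test_fun01 b'" by (rule test_fun01_deriv[OF b d])
  have T: "square_int (?T c) \<and> L2_of (?T c) = tensor01 c h" if c: "test_fun01 c" for c
  proof
    have sl: "slab_fun c" using c by (auto simp: test_fun01_iff intro: slab_fun_smooth)
    have ind: "(\<lambda>x. indicator {0<..<1} x * c x) = c"
      using c by (force simp: test_fun01_iff indicator_def)
    have sq: "square_int c" using square_int_slab_fun[OF sl] by (simp only: ind)
    show sqT: "square_int (?T c)" by (rule square_int_tensor[OF sq square_int_mask[OF \<Omega>]])
    show "L2_of (?T c) = tensor01 c h"
    proof (rule slice_eqI)
      show "AE x in lebesgue. slice (L2_of (?T c)) x = slice (tensor01 c h) x"
        using slice_L2_of[OF sqT] slice_tensor01[OF sl, of h]
      proof eventually_elim
        case (elim x)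
        have "slice (L2_of (?T c)) x = c x *\<^sub>C mask \<Omega> h"
          using elim(1) by (simp add: L2_of_scaleC[OF square_int_mask[OF \<Omega>]] mask_def)
        moreover have "mask \<Omega> h = h" using mask_eq_iff[OF \<Omega>] h by blast
        moreover have "c x = 0" if "x \<notin> {0<..<1}" using fun_cong[OF ind, of x] that by simp
        ultimately show ?case using elim(2) by auto
      qed
    qed
  qed
  have dT: "dx1 (?T b) = ?T b'"
    by (rule dx1_eqI) (simp add: has_vector_derivative_mult_left d)
  have "slab_test (?T b)"
    unfolding slab_test_def
  proof (intro conjI allI impI ballI)
    fix y assume "y \<in> \<Omega>"
    then show "test_fun01 (\<lambda>x. ?T b (x, y))"
      using test_fun01_cmult[OF b, of "fun_of_L2 h y"] by (simp add: mult.commute)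
  qed auto
  then show ?thesis
    unfolding dx1_graph_eq using T[OF b] T[OF b'] by (auto simp: dT intro!: exI[of _ "?T b"])
qed

text \<open>In each section the product of \<open>a\<close> with the conjugate test function
  vanishes at both endpoints, so the fundamental theorem leaves no boundary term. Since
  \<open>a\<close> may be an exponential, compact support is asked of the other factor only.\<close>

lemma integration_by_parts:
  assumes \<phi>: "(\<phi>, \<phi>') \<in> dx1_graph \<Omega>" and a: "smooth a" "smooth a'"
    and d: "\<And>t. (a has_vector_derivative a' t) (at t)"
  shows "cinner (tensor01 a' h) \<phi> + cinner (tensor01 a h) \<phi>' = 0"
proof -
  obtain \<Phi> where P: "\<phi> = L2_of \<Phi>" "\<phi>' = L2_of (dx1 \<Phi>)" "square_int \<Phi>" "square_int (dx1 \<Phi>)" "slab_test \<Phi>"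
    using \<phi> unfolding dx1_graph_eq by blast
  define \<tau> where "\<tau> c = (\<lambda>(x, y). (indicator {0<..<1} x * c x) * fun_of_L2 h y)" for c :: "real \<Rightarrow> complex"
  have sq: "square_int (\<tau> a)" "square_int (\<tau> a')"
    unfolding \<tau>_def by (intro square_int_tensor square_int_slab_fun slab_fun_smooth a fun_of_L2_square_int)+
  define G where "G p = \<tau> a' p * cnj (\<Phi> p) + \<tau> a p * cnj (dx1 \<Phi> p)" for p
  have i: "integrable lebesgue (\<lambda>p. \<tau> a' p * cnj (\<Phi> p))" "integrable lebesgue (\<lambda>p. \<tau> a p * cnj (dx1 \<Phi> p))"
    by (intro integrable_square_int_mult sq P)+
  have "cinner (tensor01 a' h) \<phi> + cinner (tensor01 a h) \<phi>' = (\<integral>p. G p \<partial>lebesgue)"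
    unfolding tensor01_eq P(1,2) \<tau>_def[symmetric] G_def
    by (simp add: cinner_L2_of sq P i)
  also have "\<dots> = 0"
  proof (rule integral_lebesgue_prod_eq_0)
    show "integrable lebesgue G" unfolding G_def using i by simp
    fix y
    let ?D = "\<lambda>x. a' x * cnj (\<Phi> (x, y)) + a x * cnj (dx1 \<Phi> (x, y))"
    have t: "test_fun01 (\<lambda>x. \<Phi> (x, y))" "test_fun01 (\<lambda>x. dx1 \<Phi> (x, y))"
      using slab_test_section[OF P(5)] slab_test_dx1_section[OF P(5)] by auto
    have c: "continuous_on {0..1} (\<lambda>x. \<Phi> (x, y))" "continuous_on {0..1} (\<lambda>x. dx1 \<Phi> (x, y))"
      using t by (auto simp: test_fun01_iff intro: smooth_continuous)
    have "has_bochner_integral lborel (\<lambda>x. indicator {0..1} x *\<^sub>R ?D x) (a 1 * cnj (\<Phi> (1, y)) - a 0 * cnj (\<Phi> (0, y)))"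
    proof (rule has_bochner_integral_FTC_Icc)
      fix x :: real
      have "((\<lambda>x. cnj (\<Phi> (x, y))) has_vector_derivative cnj (dx1 \<Phi> (x, y))) (at x)"
        by (rule bounded_linear.has_vector_derivative[OF bounded_linear_cnj slab_test_deriv[OF P(5)]])
      from has_vector_derivative_mult[OF d this]
      show "((\<lambda>x. a x * cnj (\<Phi> (x, y))) has_vector_derivative ?D x) (at x within {0..1})"
        by (rule has_vector_derivative_at_within[OF has_vector_derivative_eq_rhs]) (simp add: add.commute)
    next
      show "continuous_on {0..1} ?D"
        by (intro continuous_on_add continuous_on_mult continuous_on_cnj c smooth_continuous a)
    qed simp
    also have "a 1 * cnj (\<Phi> (1, y)) - a 0 * cnj (\<Phi> (0, y)) = 0"
      using test_fun01_endpoints[OF t(1)] by simp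
    finally have hb: "has_bochner_integral lborel (\<lambda>x. fun_of_L2 h y * (indicator {0..1} x *\<^sub>R ?D x)) (fun_of_L2 h y * 0)"
      by (rule has_bochner_integral_mult_right)
    \<comment> \<open>The tensor lives on the open interval and the fundamental theorem on the
      closed one; at the endpoints the integrand is zero.\<close>
    have G: "G (x, y) = fun_of_L2 h y * (indicator {0..1} x *\<^sub>R ?D x)" for x
    proof -
      have "?D x = 0" if "x = 0 \<or> x = 1"
        using test_fun01_endpoints[OF t(1)] test_fun01_endpoints[OF t(2)] that by auto
      then show ?thesis
        by (cases "x = 0 \<or> x = 1") (auto simp: G_def \<tau>_def indicator_def algebra_simps)
    qed
    have m: "(\<lambda>x. G (x, y)) \<in> borel_measurable lborel"
      unfolding G using hb by (rule borel_measurable_has_bochner_integral)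
    show "(\<lambda>x. G (x, y)) \<in> borel_measurable lebesgue" by (rule measurable_completion[OF m])
    show "(\<integral>x. G (x, y) \<partial>lebesgue) = 0"
      unfolding integral_completion[OF m] unfolding G using has_bochner_integral_integral_eq[OF hb] by simp
  qed
  finally show ?thesis .
qed

lemma dx1_graph_S:
  assumes "(\<phi>, \<phi>') \<in> dx1_graph \<Omega>"
  shows "\<phi> \<in> S" "\<phi>' \<in> S"
proof -
  obtain \<Phi> where P: "\<phi> = L2_of \<Phi>" "\<phi>' = L2_of (dx1 \<Phi>)" "square_int \<Phi>" "square_int (dx1 \<Phi>)" "slab_test \<Phi>"
    using assms unfolding dx1_graph_eq by blast
  have off: "f x = 0" if "test_fun01 f" "x \<notin> {0<..<1}" for f :: "real \<Rightarrow> complex" and x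
    using that unfolding test_fun01_iff by force
  have z: "\<Phi> (x, y) = 0 \<and> dx1 \<Phi> (x, y) = 0" if "(x, y) \<notin> {0<..<1} \<times> \<Omega>" for x y
  proof (cases "y \<in> \<Omega>")
    case True
    then show ?thesis
      using that off[OF slab_test_section[OF P(5), of y], of x] off[OF slab_test_dx1_section[OF P(5), of y], of x] by auto
  next
    case False
    then have "(\<lambda>s. \<Phi> (s, y)) = (\<lambda>s. 0)" using P(5) by (auto simp: slab_test_def)
    then show ?thesis using fun_cong[of "\<lambda>s. \<Phi> (s, y)" "\<lambda>s. 0" x] by (simp add: dx1_def)
  qed
  have z': "\<forall>p. p \<notin> {0<..<1} \<times> \<Omega> \<longrightarrow> \<Phi> p = 0 \<and> dx1 \<Phi> p = 0"
    unfolding split_paired_All using z by blast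
  show "\<phi> \<in> S" "\<phi>' \<in> S"
    unfolding P(1,2) L2_on_iff_L2_of[OF P(3)] L2_on_iff_L2_of[OF P(4)] by (rule AE_I2, use z' in blast)+
qed

lemma dx1_graph_gen:
  assumes \<phi>: "(\<phi>, \<phi>') \<in> dx1_graph \<Omega>"
  shows "(\<phi>, (- \<i>) *\<^sub>C \<phi>') \<in> gen S transl"
proof -
  \<comment> \<open>The set of pairs satisfying the adjoint identity is a closed subspace, so
    checking it on \<open>tensor_core\<close> settles it on the whole generator; self-adjointness
    then admits the new pair.\<close>
  let ?W = "{p. cinner (snd p) \<phi> = cinner (fst p) ((- \<i>) *\<^sub>C \<phi>')}"
  have "tensor_core \<subseteq> ?W"
  proof
    fix p assume "p \<in> tensor_core"
    then show "p \<in> ?W"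
    proof (cases rule: tensor_core_cases)
      case (1 b b' h)
      have "smooth b" "smooth b'" using 1(2) test_fun01_deriv[OF 1(2,3)] by (auto simp: test_fun01_iff)
      then have "cinner (tensor01 b' h) \<phi> = - cinner (tensor01 b h) \<phi>'"
        using integration_by_parts[OF \<phi> _ _ 1(3)] by (simp add: eq_neg_iff_add_eq_0)
      then show ?thesis using 1(1) by (simp add: cinner_scaleC_left cinner_scaleC_right)
    next
      case (2 h)
      have "cinner (E0 h) \<phi> + cinner (E0 h) \<phi>' = 0"
        by (rule integration_by_parts[OF \<phi> smooth_exp_fun smooth_exp_fun]) (use exp_fun_deriv[of 1] in simp)
      then have e0: "cinner (E0 h) \<phi> = - cinner (E0 h) \<phi>'" by (simp add: eq_neg_iff_add_eq_0)
      have sm: "smooth (\<lambda>x. (-1) * exp (complex_of_real (1 - x)))"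
        by (rule smooth_mult[OF smooth_const smooth_exp_reflect])
      have "cinner (tensor01 (\<lambda>x. (-1) * exp (complex_of_real (1 - x))) (V h)) \<phi> + cinner (E1 (V h)) \<phi>' = 0"
        by (rule integration_by_parts[OF \<phi> smooth_exp_reflect sm]) (use exp_reflect_deriv in simp)
      then have e1: "cinner (E1 (V h)) \<phi> = cinner (E1 (V h)) \<phi>'"
        unfolding tensor01_cmult[OF slab_fun_smooth[OF smooth_exp_reflect]] by (simp add: cinner_scaleC_left)
      show ?thesis
        using 2(1) e0 e1
        by (simp add: cinner_scaleC_left cinner_scaleC_right cinner_add_left cinner_diff_left algebra_simps)
    qed
  qed
  moreover have "subspace ?W"
    unfolding subspace_def
    by (auto simp: cinner_add_left scaleR_L2_eq cinner_scaleC_left)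
  ultimately have "tspan \<subseteq> ?W" by (rule span_minimal)
  moreover have "closed ?W"
    unfolding closed_sequential_limits
  proof (intro allI impI, elim conjE)
    fix X L assume X: "\<forall>n. X n \<in> ?W" and XL: "X \<longlonglongrightarrow> L"
    have "(\<lambda>n. cinner (snd (X n)) \<phi>) \<longlonglongrightarrow> cinner (snd L) \<phi>"
      by (intro tendsto_cinner tendsto_snd XL tendsto_const)
    moreover have "(\<lambda>n. cinner (fst (X n)) ((- \<i>) *\<^sub>C \<phi>')) \<longlonglongrightarrow> cinner (fst L) ((- \<i>) *\<^sub>C \<phi>')"
      by (intro tendsto_cinner tendsto_fst XL tendsto_const)
    ultimately show "L \<in> ?W" using X LIMSEQ_unique by auto
  qed
  ultimately have "gen S transl \<subseteq> ?W" unfolding gen_eq by (rule closure_minimal)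
  then have "\<forall>(u, v)\<in>gen S transl. cinner v \<phi> = cinner u ((- \<i>) *\<^sub>C \<phi>')" by auto
  moreover have "gen S transl = {(f, g). f \<in> S \<and> g \<in> S \<and> (\<forall>(u, v)\<in>gen S transl. cinner v f = cinner u g)}"
    using gen_selfadjoint unfolding selfadjoint_on_def by blast
  moreover have "\<phi> \<in> S" "(- \<i>) *\<^sub>C \<phi>' \<in> S"
    using dx1_graph_S[OF \<phi>] by (auto intro: L2_on_scaleC simp del: scaleC_minus_left)
  ultimately show ?thesis by blast
qed

section \<open>The core graph and its closure\<close>

lemma tensor01_zero [simp]: "slab_fun a \<Longrightarrow> tensor01 a 0 = (0 :: (real \<times> 'a) L2)"
  using tensor01_scaleC[of a 0 0] by simp

lemma slab_exp: "slab_fun (\<lambda>x. exp (complex_of_real x))" "slab_fun (\<lambda>x. exp (complex_of_real (1 - x)))"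
  by (intro slab_fun_smooth smooth_exp_fun smooth_exp_reflect)+

text \<open>Solved for \<open>g\<close>, each element splits into a test part and an exponential
  part, which can be placed in the generator separately.\<close>

lemma core_graph_eq:
  "core_graph \<Omega> V = {(\<phi> + (E0 h + E1 (V h)), (- \<i>) *\<^sub>C \<phi>' + (- \<i>) *\<^sub>C (E0 h - E1 (V h))) | \<phi> \<phi>' h.
     (\<phi>, \<phi>') \<in> dx1_graph \<Omega> \<and> h \<in> K}"
proof -
  have i: "\<i> *\<^sub>C g = a + b - c \<longleftrightarrow> g = (- \<i>) *\<^sub>C a + (- \<i>) *\<^sub>C (b - c)" for g a b c :: "(real \<times> 'a) L2"
  proof
    assume "\<i> *\<^sub>C g = a + b - c"
    then have "(- \<i>) *\<^sub>C (\<i> *\<^sub>C g) = (- \<i>) *\<^sub>C (a + b - c)" by (rule arg_cong)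
    then show "g = (- \<i>) *\<^sub>C a + (- \<i>) *\<^sub>C (b - c)" by (simp add: scaleC_add_right scaleC_diff_right)
  next
    assume "g = (- \<i>) *\<^sub>C a + (- \<i>) *\<^sub>C (b - c)"
    then show "\<i> *\<^sub>C g = a + b - c" by (simp add: scaleC_add_right scaleC_diff_right)
  qed
  show ?thesis unfolding core_graph_def i by (auto simp: add.assoc)
qed

lemma core_graph_gen: "core_graph \<Omega> V \<subseteq> gen S transl"
proof
  fix p assume "p \<in> core_graph \<Omega> V"
  then obtain \<phi> \<phi>' h where p: "p = (\<phi> + (E0 h + E1 (V h)), (- \<i>) *\<^sub>C \<phi>' + (- \<i>) *\<^sub>C (E0 h - E1 (V h)))"
    and \<phi>: "(\<phi>, \<phi>') \<in> dx1_graph \<Omega>" and h: "h \<in> K"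
    unfolding core_graph_eq by blast
  have "(E0 h + E1 (V h), (- \<i>) *\<^sub>C (E0 h - E1 (V h))) \<in> gen S transl"
    by (rule subsetD[OF tensor_core_gen]) (use h in \<open>auto simp: tensor_core_def\<close>)
  from G.gen_add[OF dx1_graph_gen[OF \<phi>] this] show "p \<in> gen S transl" by (simp only: p)
qed

lemma zero_dx1_graph: "(0, 0) \<in> dx1_graph \<Omega>"
proof -
  have "test_fun01 (\<lambda>x. 0)"
    unfolding test_fun01_iff using smooth_const[of 0] by (intro conjI exI[of _ "1/2"]) auto
  from tensor_test_dx1_graph[OF this _ L2_on_zero, of "\<lambda>_. 0"] show ?thesis
    using slab_fun_const[of 0] by simp
qed

lemma dx1_graph_core:
  assumes "(\<phi>, \<phi>') \<in> dx1_graph \<Omega>"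
  shows "(\<phi>, (- \<i>) *\<^sub>C \<phi>') \<in> core_graph \<Omega> V"
  unfolding core_graph_eq mem_Collect_eq
  by (rule exI[of _ \<phi>], rule exI[of _ \<phi>'], rule exI[of _ 0]) (simp add: assms slab_exp del: of_real_diff)

lemma tensor_core_core_graph: "tensor_core \<subseteq> core_graph \<Omega> V"
proof
  fix p assume "p \<in> tensor_core"
  then show "p \<in> core_graph \<Omega> V"
  proof (cases rule: tensor_core_cases)
    case (1 b b' h)
    show ?thesis unfolding 1(1) by (rule dx1_graph_core[OF tensor_test_dx1_graph[OF 1(2,3,4)]])
  next
    case (2 h)
    then show ?thesis
      unfolding core_graph_eq mem_Collect_eq
      by (intro exI[of _ "0 :: (real \<times> 'a) L2"] exI[of _ h]) (simp add: zero_dx1_graph)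
  qed
qed

lemma subspace_core_graph: "subspace (core_graph \<Omega> V)"
  unfolding subspace_def
proof (intro conjI ballI allI)
  show "0 \<in> core_graph \<Omega> V" using dx1_graph_core[OF zero_dx1_graph] by (simp add: zero_prod_def)
  fix p q r assume p: "p \<in> core_graph \<Omega> V"
  then obtain \<phi> \<phi>' h where ph: "p = (\<phi> + (E0 h + E1 (V h)), (- \<i>) *\<^sub>C \<phi>' + (- \<i>) *\<^sub>C (E0 h - E1 (V h)))"
    and \<phi>: "(\<phi>, \<phi>') \<in> dx1_graph \<Omega>" and h: "h \<in> K"
    unfolding core_graph_eq by blast
  have "r *\<^sub>R p = (of_real r *\<^sub>C \<phi> + (E0 (of_real r *\<^sub>C h) + E1 (V (of_real r *\<^sub>C h))),
      (- \<i>) *\<^sub>C (of_real r *\<^sub>C \<phi>') + (- \<i>) *\<^sub>C (E0 (of_real r *\<^sub>C h) - E1 (V (of_real r *\<^sub>C h))))"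
    by (simp add: ph scaleR_L2_eq scaleC_add_right scaleC_diff_right unitary_on_scaleC[OF V h] tensor01_scaleC slab_exp mult.commute del: of_real_diff)
  then show "r *\<^sub>R p \<in> core_graph \<Omega> V"
    unfolding core_graph_eq mem_Collect_eq using dx1_graph_scaleC[OF \<phi>] L2_on_scaleC[OF h] by blast
  assume q: "q \<in> core_graph \<Omega> V"
  then obtain \<psi> \<psi>' k where qk: "q = (\<psi> + (E0 k + E1 (V k)), (- \<i>) *\<^sub>C \<psi>' + (- \<i>) *\<^sub>C (E0 k - E1 (V k)))"
    and \<psi>: "(\<psi>, \<psi>') \<in> dx1_graph \<Omega>" and k: "k \<in> K"
    unfolding core_graph_eq by blast
  have "p + q = ((\<phi> + \<psi>) + (E0 (h + k) + E1 (V (h + k))),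
      (- \<i>) *\<^sub>C (\<phi>' + \<psi>') + (- \<i>) *\<^sub>C (E0 (h + k) - E1 (V (h + k))))"
    by (simp add: ph qk scaleC_add_right scaleC_diff_right unitary_on_add[OF V h k] tensor01_add slab_exp algebra_simps del: of_real_diff)
  then show "p + q \<in> core_graph \<Omega> V"
    unfolding core_graph_eq mem_Collect_eq using dx1_graph_add[OF \<phi> \<psi>] L2_on_add[OF h k] by blast
qed

text \<open>The core lies between \<open>tspan\<close> and the generator, and the generator is
  closed and equals the closure of \<open>tspan\<close>; so the closure of the core is
  squeezed.\<close>

lemma H_op_eq: "H_op \<Omega> V = gen S transl"
proof
  show "H_op \<Omega> V \<subseteq> gen S transl"
    unfolding H_op_def by (rule closure_minimal[OF core_graph_gen G.closed_gen])
  have "tspan \<subseteq> core_graph \<Omega> V" by (rule span_minimal[OF tensor_core_core_graph subspace_core_graph])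
  then show "gen S transl \<subseteq> H_op \<Omega> V" unfolding gen_eq H_op_def by (rule closure_mono)
qed

section \<open>Consequences for the generated group\<close>

lemma generates_Tr: "generates_group_on S (H_op \<Omega> V) transl"
  by (simp add: generates_group_on_iff transl_group H_op_eq)

lemma generates_unique:
  assumes "generates_group_on S (H_op \<Omega> V) W" "F \<in> S"
  shows "W t F = transl t F"
  using unitary_group_unique[OF slab_sets[OF \<Omega>] transl_group _ _ gen_dense assms(2), of W t] assms(1)
  by (simp add: generates_group_on_iff H_op_eq)

lemma slice_Tr:
  assumes F: "F \<in> S" and t: "t \<in> {0..1}"
  shows "AE x in lebesgue. x \<in> {0<..<1} \<longrightarrow>
    slice (transl t F) x = (if t < x then slice F (x - t) else inv_into K U (slice F (frac (x - t))))"
proof -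
  \<comment> \<open>At \<open>x = t\<close> the translated point would be an integer, where slices
    are not tied to the extension.\<close>
  have "AE x in lebesgue. x \<noteq> t"
    by (rule AE_not_in[of "{t}", simplified]) simp
  then show ?thesis
    using restrict01_slice[OF HV_shift(1)[OF ext_in_HV], of F t]
      AE_lebesgue_shift[OF ext_slice[OF F], of "- t"] AE_lebesgue_shift[OF ext_slice[OF F], of "1 - t"]
  proof eventually_elim
    case (elim x)
    show ?case
    proof
      assume x: "x \<in> {0<..<1}"
      have Tx: "slice (transl t F) x = ext F (x - t)" using elim(2) x by (simp add: transl_def)
      show "slice (transl t F) x = (if t < x then slice F (x - t) else inv_into K U (slice F (frac (x - t))))"
      proof (cases "t < x")
        case True
        then show ?thesis using elim(3) Tx x t by simp
      next
        case False
        then have xt: "x - t < 0" "x - t + 1 \<in> {0<..<1}" using elim(1) x t by auto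
        have "frac (x - t) = x - t + 1"
          using xt by (subst frac_unique_iff) auto
        moreover have "slice F (x - t + 1) = ext F (x - t + 1)"
          using elim(4) xt(2) by (simp add: algebra_simps)
        moreover have "ext F (x - t + 1) = U (ext F (x - t))" by (rule HV_step[OF ext_in_HV])
        \<comment> \<open>The period rule is read backwards: the value one period to the right is
          the image under \<open>U\<close>, so the value at \<open>x - t\<close> is its
          preimage.\<close>
        ultimately have "inv_into K U (slice F (frac (x - t))) = ext F (x - t)"
          using unitary_on_inv_into(3)[OF U_unitary HV_K[OF ext_in_HV]] by simp
        then show ?thesis using False Tx by simp
      qed
    qed
  qed
qed

end

text \<open>Existence of a generated group is asserted separately; the formulas are then claimed for
  every group generated by \<open>H_op \<Omega> V\<close>, and \<open>generates_unique\<close>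
  reduces them to \<open>transl\<close>. Linearity, the norm identity, the kernel and the image of
  \<open>restrict01\<close> together express that restriction is a unitary isomorphism on classes of
  functions equal almost everywhere.\<close>

theorem corollary4p2:
  fixes \<Omega> :: "(real ^ 'n) set" and V :: "(real ^ 'n) L2 \<Rightarrow> (real ^ 'n) L2"
  assumes "\<Omega> \<in> lmeasurable" and "measure lebesgue \<Omega> > 0"
    and "unitary_on (L2_on \<Omega>) V"
  shows
    "(\<forall>(\<phi>, \<phi>') \<in> dx1_graph \<Omega>. (\<phi>, (1 / \<i>) *\<^sub>C \<phi>') \<in> H_op \<Omega> V) \<and>
     selfadjoint_on (L2_on ({0<..<1} \<times> \<Omega>)) (H_op \<Omega> V) \<and>
     (\<exists>U. generates_group_on (L2_on ({0<..<1} \<times> \<Omega>)) (H_op \<Omega> V) U) \<and>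

     (\<forall>f \<in> HV_space \<Omega> (bdry_op \<Omega> V). \<forall>g \<in> HV_space \<Omega> (bdry_op \<Omega> V).
        (\<lambda>x. f x + g x) \<in> HV_space \<Omega> (bdry_op \<Omega> V) \<and>
        restrict01 \<Omega> (\<lambda>x. f x + g x) = restrict01 \<Omega> f + restrict01 \<Omega> g \<and>
        (restrict01 \<Omega> f = restrict01 \<Omega> g \<longleftrightarrow> (AE x in lebesgue. f x = g x))) \<and>
     (\<forall>f \<in> HV_space \<Omega> (bdry_op \<Omega> V). \<forall>c.
        (\<lambda>x. c *\<^sub>C f x) \<in> HV_space \<Omega> (bdry_op \<Omega> V) \<and>
        restrict01 \<Omega> (\<lambda>x. c *\<^sub>C f x) = c *\<^sub>C restrict01 \<Omega> f) \<and>
     (\<forall>f \<in> HV_space \<Omega> (bdry_op \<Omega> V).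
        (AE x in lebesgue. x \<in> {0<..<1} \<longrightarrow> slice (restrict01 \<Omega> f) x = f x) \<and>
        norm (restrict01 \<Omega> f) = HV_norm f) \<and>
     restrict01 \<Omega> ` HV_space \<Omega> (bdry_op \<Omega> V) = L2_on ({0<..<1} \<times> \<Omega>) \<and>

     (\<forall>U. generates_group_on (L2_on ({0<..<1} \<times> \<Omega>)) (H_op \<Omega> V) U \<longrightarrow>
        (\<forall>f \<in> HV_space \<Omega> (bdry_op \<Omega> V). \<forall>t.
           (\<lambda>x. f (x - t)) \<in> HV_space \<Omega> (bdry_op \<Omega> V) \<and>
           restrict01 \<Omega> (\<lambda>x. f (x - t)) = U t (restrict01 \<Omega> f)) \<and>
        (\<forall>F \<in> L2_on ({0<..<1} \<times> \<Omega>). \<forall>t \<in> {0..1}.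
           AE x in lebesgue. x \<in> {0<..<1} \<longrightarrow>
             slice (U t F) x =
               (if t < x then slice F (x - t)
                else inv_into (L2_on \<Omega>) (bdry_op \<Omega> V) (slice F (frac (x - t))))))"
proof -
  interpret bdry \<Omega> V
    using assms by unfold_locales (auto simp: fmeasurable_def)
  show ?thesis
  proof (intro conjI)
    have i: "1 / \<i> = - \<i>" by (simp add: complex_eq_iff)
    show "\<forall>(\<phi>, \<phi>')\<in>dx1_graph \<Omega>. (\<phi>, (1 / \<i>) *\<^sub>C \<phi>') \<in> H_op \<Omega> V"
      unfolding i H_op_eq using dx1_graph_gen by blast
    show "selfadjoint_on S (H_op \<Omega> V)" unfolding H_op_eq by (rule gen_selfadjoint)
    show "\<exists>U. generates_group_on S (H_op \<Omega> V) U" using generates_Tr by blast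
    show "\<forall>f\<in>HV. \<forall>g\<in>HV. (\<lambda>x. f x + g x) \<in> HV \<and>
        restrict01 \<Omega> (\<lambda>x. f x + g x) = restrict01 \<Omega> f + restrict01 \<Omega> g \<and>
        (restrict01 \<Omega> f = restrict01 \<Omega> g \<longleftrightarrow> (AE x in lebesgue. f x = g x))"
      using HV_add restrict01_add restrict01_eq_iff by blast
    show "\<forall>f\<in>HV. \<forall>c. (\<lambda>x. c *\<^sub>C f x) \<in> HV \<and> restrict01 \<Omega> (\<lambda>x. c *\<^sub>C f x) = c *\<^sub>C restrict01 \<Omega> f"
      using HV_scaleC restrict01_scaleC by blast
    show "\<forall>f\<in>HV. (AE x in lebesgue. x \<in> {0<..<1} \<longrightarrow> slice (restrict01 \<Omega> f) x = f x) \<and>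
        norm (restrict01 \<Omega> f) = HV_norm f"
      using restrict01_slice restrict01_norm by blast
    show "restrict01 \<Omega> ` HV = S" by (rule restrict01_image)
    show "\<forall>W. generates_group_on S (H_op \<Omega> V) W \<longrightarrow>
        (\<forall>f\<in>HV. \<forall>t. (\<lambda>x. f (x - t)) \<in> HV \<and> restrict01 \<Omega> (\<lambda>x. f (x - t)) = W t (restrict01 \<Omega> f)) \<and>
        (\<forall>F\<in>S. \<forall>t\<in>{0..1}. AE x in lebesgue. x \<in> {0<..<1} \<longrightarrow>
             slice (W t F) x = (if t < x then slice F (x - t) else inv_into K U (slice F (frac (x - t)))))"
    proof (intro allI impI conjI ballI)
      fix W assume W: "generates_group_on S (H_op \<Omega> V) W"
      fix f t assume f: "f \<in> HV"
      show "(\<lambda>x. f (x - t)) \<in> HV" by (rule HV_shift(1)[OF f])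
      show "restrict01 \<Omega> (\<lambda>x. f (x - t)) = W t (restrict01 \<Omega> f)"
        unfolding generates_unique[OF W restrict01_S[OF f]] by (rule transl_restrict01[OF f, symmetric])
    next
      fix W F t assume W: "generates_group_on S (H_op \<Omega> V) W" and F: "F \<in> S" and t: "t \<in> {0..1::real}"
      show "AE x in lebesgue. x \<in> {0<..<1} \<longrightarrow>
             slice (W t F) x = (if t < x then slice F (x - t) else inv_into K U (slice F (frac (x - t))))"
        unfolding generates_unique[OF W F] by (rule slice_Tr[OF F t])
    qed
  qed
qed

end
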